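(* Let $T$ be a complete first-order theory, $\pi(x)$ a partial type over $\emptyset$ with $|x|=\lambda$, and let ${\mathfrak C}\prec{\mathfrak C}'$ be models of $T$ which are both $(\aleph_0+\lambda)^+$-saturated and strongly $(\aleph_0+\lambda)^+$-homogeneous. Let $X=\pi({\mathfrak C})$, $r\colon S_X({\mathfrak C}')\to S_X({\mathfrak C})$ the restriction map, $F_{\mathrm{WAP}}$ the finest closed $\operatorname{Aut}({\mathfrak C})$-invariant equivalence relation on $S_X({\mathfrak C})$ whose quotient flow $(\operatorname{Aut}({\mathfrak C}),S_X({\mathfrak C})/F_{\mathrm{WAP}})$ is WAP, and $F'_{\mathrm{WAP}}$ the analogous relation on $S_X({\mathfrak C}')$ for $\operatorname{Aut}({\mathfrak C}')$. Then $\{(r(a),r(b)) : (a,b)\in F'_{\mathrm{WAP}}\}=F_{\mathrm{WAP}}$.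
   Context: $\kappa$-saturated: every complete type over a subset of size $<\kappa$ is realized; strongly $\kappa$-homogeneous: every partial elementary map between subsets of size $<\kappa$ extends to an automorphism. $S_X({\mathfrak C})$ is the space of complete types over ${\mathfrak C}$ containing $\pi$, with $\operatorname{Aut}({\mathfrak C})$ acting by $\sigma(p)=\{\varphi(x,\sigma(a)):\varphi(x,a)\in p\}$. For a flow $(G,Y)$ ($G$ a topological group acting continuously on a compact Hausdorff space $Y$), $G$ acts on $C(Y)$ by $(gf)(y)=f(g^{-1}y)$; $f\in C(Y)$ is WAP if $\{gf:g\in G\}$ is relatively compact in the weak topology of the Banach space $(C(Y),\|\cdot\|_\infty)$, and the flow is WAP if every $f\in C(Y)$ is WAP. The finest closed invariant equivalence relation with WAP quotient exists for every flow. *)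

theory Defs
  imports "HOL-Analysis.Analysis" "HOL-Algebra.Group" "HOL-Combinatorics.Permutations"
begin

unbundle cardinal_syntax

section \<open>First-order logic\<close>

text \<open>The symbols of a language are those with a defined arity.\<close>

record ('f, 'r) fo_language =
  fun_arity :: "'f \<Rightarrow> nat option"
  rel_arity :: "'r \<Rightarrow> nat option"

text \<open>\<open>Var\<close> is used for the variables of a type and for parameters, which are never quantified;
  \<open>Bnd\<close> is used for the variables that quantifiers bind.\<close>

datatype (dead 'f, trm_vars: 'v) trm =
  Var 'v
| Bnd nat
| App 'f "('f, 'v) trm list"
for map: map_trm

datatype (dead 'f, dead 'r, fm_vars: 'v) fm =
  Eq "('f, 'v) trm" "('f, 'v) trm"
| Rel 'r "('f, 'v) trm list"
| Neg "('f, 'r, 'v) fm"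
| Conj "('f, 'r, 'v) fm" "('f, 'r, 'v) fm"
| Exists nat "('f, 'r, 'v) fm"
for map: map_fm

primrec wf_trm :: "('f, 'r) fo_language \<Rightarrow> ('f, 'v) trm \<Rightarrow> bool" where
  "wf_trm L (Var v) \<longleftrightarrow> True"
| "wf_trm L (Bnd n) \<longleftrightarrow> True"
| "wf_trm L (App f ts) \<longleftrightarrow> fun_arity L f = Some (length ts) \<and> list_all (wf_trm L) ts"

primrec wf_fm :: "('f, 'r) fo_language \<Rightarrow> ('f, 'r, 'v) fm \<Rightarrow> bool" where
  "wf_fm L (Eq s t) \<longleftrightarrow> wf_trm L s \<and> wf_trm L t"
| "wf_fm L (Rel R ts) \<longleftrightarrow> rel_arity L R = Some (length ts) \<and> list_all (wf_trm L) ts"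
| "wf_fm L (Neg \<phi>) \<longleftrightarrow> wf_fm L \<phi>"
| "wf_fm L (Conj \<phi> \<psi>) \<longleftrightarrow> wf_fm L \<phi> \<and> wf_fm L \<psi>"
| "wf_fm L (Exists n \<phi>) \<longleftrightarrow> wf_fm L \<phi>"

primrec bnds_trm :: "('f, 'v) trm \<Rightarrow> nat set" where
  "bnds_trm (Var v) = {}"
| "bnds_trm (Bnd n) = {n}"
| "bnds_trm (App f ts) = \<Union> (set (map bnds_trm ts))"

primrec unbound :: "('f, 'r, 'v) fm \<Rightarrow> nat set" where
  "unbound (Eq s t) = bnds_trm s \<union> bnds_trm t"
| "unbound (Rel R ts) = \<Union> (set (map bnds_trm ts))"
| "unbound (Neg \<phi>) = unbound \<phi>"
| "unbound (Conj \<phi> \<psi>) = unbound \<phi> \<union> unbound \<psi>"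
| "unbound (Exists n \<phi>) = unbound \<phi> - {n}"

record ('f, 'r, 'a) fo_structure =
  universe :: "'a set"
  fun_interp :: "'f \<Rightarrow> 'a list \<Rightarrow> 'a"
  rel_interp :: "'r \<Rightarrow> 'a list \<Rightarrow> bool"

definition is_structure :: "('f, 'r) fo_language \<Rightarrow> ('f, 'r, 'a) fo_structure \<Rightarrow> bool" where
  "is_structure L M \<longleftrightarrow> universe M \<noteq> {} \<and>
     (\<forall>f xs. fun_arity L f = Some (length xs) \<and> set xs \<subseteq> universe M
        \<longrightarrow> fun_interp M f xs \<in> universe M)"

primrec eval_trm :: "('f, 'r, 'a) fo_structure \<Rightarrow> ('v \<Rightarrow> 'a) \<Rightarrow> (nat \<Rightarrow> 'a) \<Rightarrow> ('f, 'v) trm \<Rightarrow> 'a" where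
  "eval_trm M e s (Var v) = e v"
| "eval_trm M e s (Bnd n) = s n"
| "eval_trm M e s (App f ts) = fun_interp M f (map (eval_trm M e s) ts)"

primrec sat :: "('f, 'r, 'a) fo_structure \<Rightarrow> ('v \<Rightarrow> 'a) \<Rightarrow> (nat \<Rightarrow> 'a) \<Rightarrow> ('f, 'r, 'v) fm \<Rightarrow> bool" where
  "sat M e s (Eq t u) \<longleftrightarrow> eval_trm M e s t = eval_trm M e s u"
| "sat M e s (Rel R ts) \<longleftrightarrow> rel_interp M R (map (eval_trm M e s) ts)"
| "sat M e s (Neg \<phi>) \<longleftrightarrow> \<not> sat M e s \<phi>"
| "sat M e s (Conj \<phi> \<psi>) \<longleftrightarrow> sat M e s \<phi> \<and> sat M e s \<psi>"
| "sat M e s (Exists n \<phi>) \<longleftrightarrow> (\<exists>a\<in>universe M. sat M e (s(n := a)) \<phi>)"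

subsection \<open>Theories\<close>

definition sentences :: "('f, 'r) fo_language \<Rightarrow> ('f, 'r, unit) fm set" where
  "sentences L = {\<phi>. wf_fm L \<phi> \<and> unbound \<phi> = {} \<and> fm_vars \<phi> = {}}"

text \<open>The assignments are irrelevant for sentences.\<close>

definition is_model ::
  "('f, 'r) fo_language \<Rightarrow> ('f, 'r, unit) fm set \<Rightarrow> ('f, 'r, 'a) fo_structure \<Rightarrow> bool" where
  "is_model L T M \<longleftrightarrow>
     is_structure L M \<and> (\<forall>\<phi>\<in>T. sat M (\<lambda>_. undefined) (\<lambda>_. undefined) \<phi>)"

text \<open>HOL cannot quantify over the types of universes. The type of formulas
  has at least \<open>|L| + \<aleph>\<^sub>0\<close> elements, so by the downward Loewenheim-Skolem theorem a set of
  sentences has a model if and only if it has one whose universe is contained in this type.\<close>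

type_synonym ('f, 'r) small_structure = "('f, 'r, ('f, 'r, unit) fm) fo_structure"

definition entails ::
  "('f, 'r) fo_language \<Rightarrow> ('f, 'r, unit) fm set \<Rightarrow> ('f, 'r, unit) fm \<Rightarrow> bool" where
  "entails L T \<phi> \<longleftrightarrow> (\<forall>M :: ('f, 'r) small_structure. is_model L T M \<longrightarrow> is_model L {\<phi>} M)"

definition complete_theory :: "('f, 'r) fo_language \<Rightarrow> ('f, 'r, unit) fm set \<Rightarrow> bool" where
  "complete_theory L T \<longleftrightarrow> T \<subseteq> sentences L \<and>
     (\<exists>M :: ('f, 'r) small_structure. is_model L T M) \<and>
     (\<forall>\<phi>\<in>sentences L. entails L T \<phi> \<or> entails L T (Neg \<phi>))"

subsection \<open>Formulas with parameters\<close>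

text \<open>A formula \<open>\<phi>(x, a)\<close> has the entries of the tuple \<open>x\<close> as variables \<open>Inl v\<close>
  and those of \<open>a\<close> as parameters \<open>Inr a\<close>. A tuple of variables is given by its index set \<open>V\<close>.\<close>

type_synonym ('f, 'r, 'x, 'a) pfm = "('f, 'r, 'x + 'a) fm"

definition formulas :: "('f, 'r) fo_language \<Rightarrow> 'x set \<Rightarrow> 'a set \<Rightarrow> ('f, 'r, 'x, 'a) pfm set" where
  "formulas L V A = {\<phi>. wf_fm L \<phi> \<and> unbound \<phi> = {} \<and> fm_vars \<phi> \<subseteq> V <+> A}"

definition holds :: "('f, 'r, 'a) fo_structure \<Rightarrow> ('x \<Rightarrow> 'a) \<Rightarrow> ('f, 'r, 'x, 'a) pfm \<Rightarrow> bool" where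
  "holds M b \<phi> \<longleftrightarrow> sat M (case_sum b id) (\<lambda>_. undefined) \<phi>"

definition map_params :: "('a \<Rightarrow> 'b) \<Rightarrow> ('f, 'r, 'x, 'a) pfm \<Rightarrow> ('f, 'r, 'x, 'b) pfm" where
  "map_params \<sigma> = map_fm (map_sum id \<sigma>)"

definition elementary_substructure ::
  "('f, 'r) fo_language \<Rightarrow> ('f, 'r, 'a) fo_structure \<Rightarrow> ('f, 'r, 'a) fo_structure \<Rightarrow> bool" where
  "elementary_substructure L M N \<longleftrightarrow>
     is_structure L M \<and> is_structure L N \<and> universe M \<subseteq> universe N \<and>
     (\<forall>\<phi> \<in> formulas L ({} :: unit set) (universe M).
        holds M (\<lambda>_. undefined) \<phi> \<longleftrightarrow> holds N (\<lambda>_. undefined) \<phi>)"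

subsection \<open>Types\<close>

definition partial_type ::
  "('f, 'r) fo_language \<Rightarrow> ('f, 'r, 'a) fo_structure \<Rightarrow> 'x set \<Rightarrow> 'a set
     \<Rightarrow> ('f, 'r, 'x, 'a) pfm set \<Rightarrow> bool" where
  "partial_type L M V A p \<longleftrightarrow> p \<subseteq> formulas L V A \<and>
     (\<forall>q. finite q \<and> q \<subseteq> p \<longrightarrow> (\<exists>b. b ` V \<subseteq> universe M \<and> (\<forall>\<phi>\<in>q. holds M b \<phi>)))"

definition complete_type ::
  "('f, 'r) fo_language \<Rightarrow> ('f, 'r, 'a) fo_structure \<Rightarrow> 'x set \<Rightarrow> 'a set
     \<Rightarrow> ('f, 'r, 'x, 'a) pfm set \<Rightarrow> bool" where
  "complete_type L M V A p \<longleftrightarrow> partial_type L M V A p \<and>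
     (\<forall>\<phi>\<in>formulas L V A. \<phi> \<in> p \<or> Neg \<phi> \<in> p)"

definition saturated ::
  "('f, 'r) fo_language \<Rightarrow> 'k rel \<Rightarrow> ('f, 'r, 'a) fo_structure \<Rightarrow> bool" where
  "saturated L \<kappa> M \<longleftrightarrow>
     (\<forall>A (n :: nat) p. A \<subseteq> universe M \<and> |A| <o \<kappa> \<and> complete_type L M {..<n} A p
        \<longrightarrow> (\<exists>b. b ` {..<n} \<subseteq> universe M \<and> (\<forall>\<phi>\<in>p. holds M b \<phi>)))"

subsection \<open>Automorphisms\<close>

text \<open>To make automorphisms of \<open>M\<close> total functions, they are extended by the identity
  outside the universe.\<close>

definition automorphisms ::
  "('f, 'r) fo_language \<Rightarrow> ('f, 'r, 'a) fo_structure \<Rightarrow> ('a \<Rightarrow> 'a) set" where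
  "automorphisms L M = {\<sigma>. \<sigma> permutes universe M \<and>
     (\<forall>f xs. fun_arity L f = Some (length xs) \<and> set xs \<subseteq> universe M
        \<longrightarrow> \<sigma> (fun_interp M f xs) = fun_interp M f (map \<sigma> xs)) \<and>
     (\<forall>R xs. rel_arity L R = Some (length xs) \<and> set xs \<subseteq> universe M
        \<longrightarrow> (rel_interp M R xs \<longleftrightarrow> rel_interp M R (map \<sigma> xs)))}"

definition partial_elementary_map ::
  "('f, 'r) fo_language \<Rightarrow> ('f, 'r, 'a) fo_structure \<Rightarrow> 'a set \<Rightarrow> 'a set \<Rightarrow> ('a \<Rightarrow> 'a) \<Rightarrow> bool" where
  "partial_elementary_map L M A B h \<longleftrightarrow>
     A \<subseteq> universe M \<and> B \<subseteq> universe M \<and> h ` A = B \<and>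
     (\<forall>\<phi> \<in> formulas L ({} :: unit set) A.
        holds M (\<lambda>_. undefined) \<phi> \<longleftrightarrow> holds M (\<lambda>_. undefined) (map_params h \<phi>))"

definition strongly_homogeneous ::
  "('f, 'r) fo_language \<Rightarrow> 'k rel \<Rightarrow> ('f, 'r, 'a) fo_structure \<Rightarrow> bool" where
  "strongly_homogeneous L \<kappa> M \<longleftrightarrow>
     (\<forall>A B h. |A| <o \<kappa> \<and> |B| <o \<kappa> \<and> partial_elementary_map L M A B h
        \<longrightarrow> (\<exists>\<sigma>\<in>automorphisms L M. \<forall>a\<in>A. \<sigma> a = h a))"

definition aut_group ::
  "('f, 'r) fo_language \<Rightarrow> ('f, 'r, 'a) fo_structure \<Rightarrow> ('a \<Rightarrow> 'a) monoid" where
  "aut_group L M = \<lparr>carrier = automorphisms L M, mult = (\<circ>), one = id\<rparr>"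

text \<open>The topology of pointwise convergence on a discrete structure.\<close>

definition aut_topology ::
  "('f, 'r) fo_language \<Rightarrow> ('f, 'r, 'a) fo_structure \<Rightarrow> ('a \<Rightarrow> 'a) topology" where
  "aut_topology L M =
     subtopology (product_topology (\<lambda>_. discrete_topology UNIV) UNIV) (automorphisms L M)"

subsection \<open>Type spaces\<close>

definition types_containing ::
  "('f, 'r) fo_language \<Rightarrow> ('f, 'r, 'a) fo_structure \<Rightarrow> 'x set \<Rightarrow> ('f, 'r, 'x, 'a) pfm set
     \<Rightarrow> ('f, 'r, 'x, 'a) pfm set set" where
  "types_containing L M V \<pi> = {p. complete_type L M V (universe M) p \<and> \<pi> \<subseteq> p}"

definition type_space ::
  "('f, 'r) fo_language \<Rightarrow> ('f, 'r, 'a) fo_structure \<Rightarrow> 'x set \<Rightarrow> ('f, 'r, 'x, 'a) pfm set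
     \<Rightarrow> ('f, 'r, 'x, 'a) pfm set topology" where
  "type_space L M V \<pi> = topology_generated_by
     {{p \<in> types_containing L M V \<pi>. \<phi> \<in> p} | \<phi>. \<phi> \<in> formulas L V (universe M)}"

definition type_action ::
  "('a \<Rightarrow> 'a) \<Rightarrow> ('f, 'r, 'x, 'a) pfm set \<Rightarrow> ('f, 'r, 'x, 'a) pfm set" where
  "type_action \<sigma> p = map_params \<sigma> ` p"

definition restrict_type ::
  "('f, 'r) fo_language \<Rightarrow> ('f, 'r, 'a) fo_structure \<Rightarrow> 'x set
     \<Rightarrow> ('f, 'r, 'x, 'a) pfm set \<Rightarrow> ('f, 'r, 'x, 'a) pfm set" where
  "restrict_type L M V p = p \<inter> formulas L V (universe M)"

section \<open>Flows\<close>

definition topological_group :: "('g, 'm) monoid_scheme \<Rightarrow> 'g topology \<Rightarrow> bool" where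
  "topological_group G \<tau> \<longleftrightarrow> group G \<and> topspace \<tau> = carrier G \<and>
     continuous_map (prod_topology \<tau> \<tau>) \<tau> (\<lambda>(g, h). g \<otimes>\<^bsub>G\<^esub> h) \<and>
     continuous_map \<tau> \<tau> (\<lambda>g. inv\<^bsub>G\<^esub> g)"

definition is_flow ::
  "('g, 'm) monoid_scheme \<Rightarrow> 'g topology \<Rightarrow> 'y topology \<Rightarrow> ('g \<Rightarrow> 'y \<Rightarrow> 'y) \<Rightarrow> bool" where
  "is_flow G \<tau> Y act \<longleftrightarrow> topological_group G \<tau> \<and> compact_space Y \<and> Hausdorff_space Y \<and>
     (\<forall>y\<in>topspace Y. act \<one>\<^bsub>G\<^esub> y = y) \<and>
     (\<forall>g\<in>carrier G. \<forall>h\<in>carrier G. \<forall>y\<in>topspace Y. act (g \<otimes>\<^bsub>G\<^esub> h) y = act g (act h y)) \<and>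
     continuous_map (prod_topology \<tau> Y) Y (\<lambda>(g, y). act g y)"

subsection \<open>The weak topology on the space of continuous functions\<close>

text \<open>For compact \<open>Y\<close> this is the set of all continuous functions, taken to be \<open>undefined\<close>
  outside \<open>topspace Y\<close>, with the metric of the supremum norm.\<close>

abbreviation C_metric :: "'y topology \<Rightarrow> ('y \<Rightarrow> real) metric" where
  "C_metric Y \<equiv> cfunspace Y euclidean_metric"

abbreviation C_space :: "'y topology \<Rightarrow> ('y \<Rightarrow> real) set" where
  "C_space Y \<equiv> mspace (C_metric Y)"

definition C_dual :: "'y topology \<Rightarrow> (('y \<Rightarrow> real) \<Rightarrow> real) set" where
  "C_dual Y = {\<mu>.
     (\<forall>f\<in>C_space Y. \<forall>g\<in>C_space Y. \<mu> (\<lambda>y\<in>topspace Y. f y + g y) = \<mu> f + \<mu> g) \<and>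
     (\<forall>c. \<forall>f\<in>C_space Y. \<mu> (\<lambda>y\<in>topspace Y. c * f y) = c * \<mu> f) \<and>
     continuous_map (mtopology_of (C_metric Y)) euclideanreal \<mu>}"

definition C_weak_topology :: "'y topology \<Rightarrow> ('y \<Rightarrow> real) topology" where
  "C_weak_topology Y =
     topology_generated_by {{f \<in> C_space Y. \<mu> f \<in> U} | \<mu> U. \<mu> \<in> C_dual Y \<and> open U}"

definition C_action ::
  "('g, 'm) monoid_scheme \<Rightarrow> 'y topology \<Rightarrow> ('g \<Rightarrow> 'y \<Rightarrow> 'y) \<Rightarrow> 'g \<Rightarrow> ('y \<Rightarrow> real) \<Rightarrow> 'y \<Rightarrow> real" where
  "C_action G Y act g f = (\<lambda>y\<in>topspace Y. f (act (inv\<^bsub>G\<^esub> g) y))"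

definition wap_function ::
  "('g, 'm) monoid_scheme \<Rightarrow> 'y topology \<Rightarrow> ('g \<Rightarrow> 'y \<Rightarrow> 'y) \<Rightarrow> ('y \<Rightarrow> real) \<Rightarrow> bool" where
  "wap_function G Y act f \<longleftrightarrow> compactin (C_weak_topology Y)
     (C_weak_topology Y closure_of ((\<lambda>g. C_action G Y act g f) ` carrier G))"

definition wap_flow ::
  "('g, 'm) monoid_scheme \<Rightarrow> 'g topology \<Rightarrow> 'y topology \<Rightarrow> ('g \<Rightarrow> 'y \<Rightarrow> 'y) \<Rightarrow> bool" where
  "wap_flow G \<tau> Y act \<longleftrightarrow> is_flow G \<tau> Y act \<and> (\<forall>f\<in>C_space Y. wap_function G Y act f)"

subsection \<open>Quotient flows\<close>

definition quotient_topology :: "'y topology \<Rightarrow> 'y rel \<Rightarrow> 'y set topology" where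
  "quotient_topology Y E = topology (\<lambda>U. U \<subseteq> topspace Y // E \<and> openin Y (\<Union>U))"

lemma openin_quotient_topology:
  assumes "equiv (topspace Y) E"
  shows "openin (quotient_topology Y E) U \<longleftrightarrow> U \<subseteq> topspace Y // E \<and> openin Y (\<Union>U)"
proof -
  have "\<Union>(S \<inter> T) = \<Union>S \<inter> \<Union>T" if "S \<subseteq> topspace Y // E" "T \<subseteq> topspace Y // E" for S T
    using that quotient_disj[OF assms] by blast
  moreover have "openin Y (\<Union>(\<Union>K))" if "\<forall>S\<in>K. openin Y (\<Union>S)" for K
  proof -
    have "\<Union>(\<Union>K) = (\<Union>S\<in>K. \<Union>S)"
      by blast
    then show ?thesis
      using that by (metis openin_Union imageE)
  qed
  ultimately have "istopology (\<lambda>U. U \<subseteq> topspace Y // E \<and> openin Y (\<Union>U))"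
    unfolding istopology_def by (auto simp: Sup_le_iff le_infI1 intro: openin_Int)
  then show ?thesis
    by (simp add: quotient_topology_def topology_inverse')
qed

definition closed_invariant_equiv ::
  "('g, 'm) monoid_scheme \<Rightarrow> 'y topology \<Rightarrow> ('g \<Rightarrow> 'y \<Rightarrow> 'y) \<Rightarrow> 'y rel \<Rightarrow> bool" where
  "closed_invariant_equiv G Y act E \<longleftrightarrow> equiv (topspace Y) E \<and>
     closedin (prod_topology Y Y) E \<and>
     (\<forall>g\<in>carrier G. \<forall>(a, b)\<in>E. (act g a, act g b) \<in> E)"

definition has_wap_quotient ::
  "('g, 'm) monoid_scheme \<Rightarrow> 'g topology \<Rightarrow> 'y topology \<Rightarrow> ('g \<Rightarrow> 'y \<Rightarrow> 'y) \<Rightarrow> 'y rel \<Rightarrow> bool" where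
  "has_wap_quotient G \<tau> Y act E \<longleftrightarrow> wap_flow G \<tau> (quotient_topology Y E) (\<lambda>g c. act g ` c)"

definition finest_wap_equiv ::
  "('g, 'm) monoid_scheme \<Rightarrow> 'g topology \<Rightarrow> 'y topology \<Rightarrow> ('g \<Rightarrow> 'y \<Rightarrow> 'y) \<Rightarrow> 'y rel \<Rightarrow> bool" where
  "finest_wap_equiv G \<tau> Y act F \<longleftrightarrow>
     closed_invariant_equiv G Y act F \<and> has_wap_quotient G \<tau> Y act F \<and>
     (\<forall>E. closed_invariant_equiv G Y act E \<and> has_wap_quotient G \<tau> Y act E \<longrightarrow> F \<subseteq> E)"

end

theory Submission
  imports Defs "HOL-Library.Ramsey"
begin

text \<open>Call a continuous function \<open>f\<close> on a flow stable if there are no \<open>g\<^sub>n\<close>, \<open>y\<^sub>n\<close> and \<open>\<epsilon> > 0\<close> with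
  \<open>\<bar>f (g\<^sub>n y\<^sub>m) - f (g\<^sub>m y\<^sub>n)\<bar> \<ge> \<epsilon>\<close> for all \<open>n < m\<close>. By Grothendieck's double limit criterion the stable
  functions are exactly the WAP ones, and the finest WAP equivalence relation identifies the points
  that no stable function separates.

  A continuous function on a type space depends on countably many parameters, and up to \<open>\<epsilon>\<close> on a
  single formula. Hence instability only concerns countable sequences of parameters, which saturation
  and homogeneity move between \<open>C\<close> and \<open>C'\<close>: \<open>f\<close> is stable if and only if \<open>f \<circ> r\<close> is. This gives one
  inclusion. For the other one, compactness of the type space over \<open>C'\<close> reduces the lifting of a pair
  to finitely many formulas over \<open>C\<close> and finitely many stable functions, and an automorphism of \<open>C'\<close>
  that fixes the parameters of the former moves those of the latter into \<open>C\<close>, where these functions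
  factor through \<open>r\<close>.\<close>

section \<open>Order property and Ramsey's theorem\<close>

text \<open>The inequality in the overview keeps only a gap between an entry of a double sequence
  and its mirror image; no limit is asked to exist. For bounded values Ramsey's theorem recovers two
  constants, one on each side of the diagonal. Instability thus becomes a statement about two
  formulas, one true above the diagonal and one below, and in this form it can travel between
  \<open>C\<close> and \<open>C'\<close>. Two formulas are used because "near \<open>u\<close>" and
  "near \<open>v\<close>" are conditions with a gap between them, neither being the negation of the
  other.

  Grothendieck's criterion is proved without representing functionals by measures: pointwise limits
  of a family without the order property are continuous, and every functional respects them because
  its modulus obeys a form of Fatou's lemma.

  The obstacle in the lifting is that a stable function over \<open>C'\<close> need not factor
  through \<open>r\<close>. Translation by an automorphism repairs this for countably many
  parameters at a time, which covers finitely many functions but not all of them at once.\<close>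

definition order_property :: "('y \<Rightarrow> real) set \<Rightarrow> 'y set \<Rightarrow> bool" where
  "order_property A S \<longleftrightarrow> (\<exists>F y \<epsilon>. (\<forall>n::nat. F n \<in> A) \<and> (\<forall>n. y n \<in> S) \<and> 0 < \<epsilon> \<and>
     (\<forall>n m. n < m \<longrightarrow> \<epsilon> \<le> \<bar>F n (y m) - F m (y n)\<bar>))"

lemma Ramsey_pairs:
  fixes c :: "nat \<Rightarrow> nat \<Rightarrow> 'c"
  assumes "finite K" "\<And>n m. n < m \<Longrightarrow> c n m \<in> K"
  obtains s :: "nat \<Rightarrow> nat" and k where "strict_mono s" "k \<in> K" "\<And>n m. n < m \<Longrightarrow> c (s n) (s m) = k"
proof -
  obtain b where b: "bij_betw b K {0..<card K}"
    using ex_bij_betw_finite_nat[OF assms(1)] by blast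
  \<comment> \<open>\<open>Ramsey2\<close> colours two-element sets by naturals, so an ordered pair
    is read off by \<open>Min\<close> and \<open>Max\<close>, and the colours are numbered by
    \<open>b\<close>.\<close>
  define f where "f X = b (c (Min X) (Max X))" for X
  have f: "f {n, m} = b (c n m)" if "n < m" for n m
    using that by (simp add: f_def min_def max_def)
  have "f {x, y} < card K" if "x \<noteq> y" for x y
    using that f[of x y] f[of y x] assms(2)[of x y] assms(2)[of y x] b
    by (cases "x < y") (auto simp: bij_betw_def insert_commute)
  then obtain Y t where Y: "infinite Y" "\<forall>x\<in>Y. \<forall>y\<in>Y. x \<noteq> y \<longrightarrow> f {x, y} = t"
    using Ramsey2[of UNIV f "card K"] by auto
  define s where "s = enumerate Y"
  have s: "strict_mono s" "s n \<in> Y" for n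
    using Y(1) by (auto simp: s_def strict_mono_enumerate enumerate_in_set)
  have eq: "c (s n) (s m) = c (s 0) (s 1)" if "n < m" for n m
  proof -
    have lt: "s n < s m" "s 0 < s 1"
      using s(1) that by (auto simp: strict_mono_def)
    then have "b (c (s n) (s m)) = b (c (s 0) (s 1))"
      using f Y(2) s(2) by (metis less_irrefl)
    then show ?thesis
      using b assms(2)[OF lt(1)] assms(2)[OF lt(2)] by (auto simp: bij_betw_def inj_on_def)
  qed
  show thesis
    by (rule that[OF s(1) _ eq], rule assms(2)) (use s(1) in \<open>simp_all add: strict_mono_def\<close>)
qed

text \<open>Round all values to a grid with finitely many relevant points and colour
  \<open>n < m\<close> by the two rounded values at \<open>(n, m)\<close> and \<open>(m, n)\<close>.
  On a homogeneous subsequence both are constant, which gives \<open>u\<close> and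
  \<open>v\<close>.\<close>

lemma order_property_separated:
  assumes "order_property A S" and B: "\<And>f y. f \<in> A \<Longrightarrow> y \<in> S \<Longrightarrow> \<bar>f y\<bar> \<le> B"
  obtains F y u v and \<epsilon> :: real where "\<And>n::nat. F n \<in> A" "\<And>n::nat. y n \<in> S" "0 < \<epsilon>" "3 * \<epsilon> \<le> \<bar>u - v\<bar>"
    "\<And>n m. n < m \<Longrightarrow> \<bar>F n (y m) - u\<bar> \<le> \<epsilon>" "\<And>n m. m < n \<Longrightarrow> \<bar>F n (y m) - v\<bar> \<le> \<epsilon>"
proof -
  obtain F y \<epsilon> where F: "\<And>n::nat. F n \<in> A" "\<And>n::nat. y n \<in> S" "0 < \<epsilon>"
    and gap: "\<And>n m. n < m \<Longrightarrow> \<epsilon> \<le> \<bar>F n (y m) - F m (y n)\<bar>"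
    using assms(1) unfolding order_property_def by blast
  \<comment> \<open>Each of the two entries may lie \<open>d\<close> away from its constant, so a
    gap of \<open>5 * d\<close> leaves a distance of at least \<open>3 * d\<close> between the
    constants.\<close>
  define d where "d = \<epsilon> / 5"
  have d: "d > 0" using F by (simp add: d_def)
  define bin where "bin x = \<lfloor>x / d\<rfloor>" for x
  have bin: "\<bar>x - d * bin x\<bar> \<le> d" for x
  proof -
    have "bin x \<le> x / d" "x / d \<le> bin x + 1"
      unfolding bin_def by linarith+
    then have "d * bin x \<le> x" "x \<le> d * (bin x + 1)"
      using d by (simp_all add: field_simps)
    then show ?thesis using d by (auto simp: algebra_simps abs_le_iff)
  qed
  have bin_mono: "bin x \<le> bin x'" if "x \<le> x'" for x x'
    unfolding bin_def by (intro floor_mono divide_right_mono) (use that d in auto)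
  define I where "I = {bin (-B)..bin B}"
  have I: "bin (F n (y m)) \<in> I" for n m
    using B[OF F(1) F(2), of n m] unfolding I_def by (auto simp: abs_le_iff intro!: bin_mono)
  then obtain s :: "nat \<Rightarrow> nat" and k where s: "strict_mono s"
    "\<And>n m. n < m \<Longrightarrow> (bin (F (s n) (y (s m))), bin (F (s m) (y (s n)))) = k"
    using Ramsey_pairs[of "I \<times> I" "\<lambda>n m. (bin (F n (y m)), bin (F m (y n)))"] by (metis I_def SigmaI finite_SigmaI finite_atLeastAtMost_int)
  define u v where "u = d * of_int (fst k)" and "v = d * of_int (snd k)"
  have u: "\<bar>F (s n) (y (s m)) - u\<bar> \<le> d" if "n < m" for n m
    using bin[of "F (s n) (y (s m))"] by (simp add: u_def flip: s(2)[OF that])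
  have v: "\<bar>F (s n) (y (s m)) - v\<bar> \<le> d" if "m < n" for n m
    using bin[of "F (s n) (y (s m))"] by (simp add: v_def flip: s(2)[OF that])
  have "\<epsilon> \<le> \<bar>F (s 0) (y (s 1)) - F (s 1) (y (s 0))\<bar>"
    using gap s(1) by (simp add: strict_mono_def)
  then have "3 * d \<le> \<bar>u - v\<bar>"
    using u[of 0 1] v[of 0 1] unfolding d_def by linarith
  then show thesis
    using that[of "F \<circ> s" "y \<circ> s" d u v] F u v d by simp
qed

section \<open>Continuous functions on a compact space\<close>

lemma C_space_iff:
  assumes "compact_space Y"
  shows "f \<in> C_space Y \<longleftrightarrow> f \<in> extensional (topspace Y) \<and> continuous_map Y euclideanreal f"
proof -
  have "C_space Y = {f. f \<in> extensional (topspace Y) \<and> continuous_map Y euclideanreal f}"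
    using assms compactin_mspace_cfunspace[of Y euclidean_metric]
    by (simp add: compact_space_def del: mspace_cfunspace)
  then show ?thesis by blast
qed

lemma restrict_in_C_space:
  assumes "compact_space Y" "continuous_map Y euclideanreal f"
  shows "restrict f (topspace Y) \<in> C_space Y"
  using assms by (auto simp: C_space_iff simp del: mspace_cfunspace intro: continuous_map_eq[where f = f])

lemma C_space_restrict: "f \<in> C_space Y \<Longrightarrow> restrict f (topspace Y) = f"
  by (auto simp: extensional_restrict)

lemma continuous_map_bounded:
  assumes "compact_space Y" "continuous_map Y euclideanreal f"
  obtains B where "0 < B" "\<And>y. y \<in> topspace Y \<Longrightarrow> \<bar>f y\<bar> \<le> B"
proof -
  have "compact (f ` topspace Y)"
    using assms image_compactin compact_space_def compactin_euclidean_iff by blast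
  then have "bounded (f ` topspace Y)" by (rule compact_imp_bounded)
  then obtain B where "0 < B" "\<And>x. x \<in> f ` topspace Y \<Longrightarrow> norm x \<le> B"
    using bounded_pos[of "f ` topspace Y"] by auto
  then show thesis using that by auto
qed

text \<open>Continuity at the zero function gives a ball that \<open>\<mu>\<close> maps into
  \<open>ball 0 1\<close>, and homogeneity spreads this bound. It is phrased with a pointwise
  estimate \<open>\<delta>\<close> in place of the norm, the form in which it is applied.\<close>

lemma C_dual_bounded:
  assumes Y: "compact_space Y" and \<mu>: "\<mu> \<in> C_dual Y"
  obtains K where "0 < K"
    "\<And>f \<delta>. f \<in> C_space Y \<Longrightarrow> 0 < \<delta> \<Longrightarrow> (\<And>y. y \<in> topspace Y \<Longrightarrow> \<bar>f y\<bar> \<le> \<delta>) \<Longrightarrow> \<bar>\<mu> f\<bar> \<le> K * \<delta>"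
proof -
  interpret M: Metric_space "C_space Y" "mdist (C_metric Y)"
    by (rule Metric_space_mspace_mdist)
  let ?z = "\<lambda>y\<in>topspace Y. 0::real"
  have z: "?z \<in> C_space Y"
    using restrict_in_C_space[OF Y, of "\<lambda>_. 0"] by simp
  have scale: "\<mu> (\<lambda>y\<in>topspace Y. c * f y) = c * \<mu> f" if "f \<in> C_space Y" for c f
    using \<mu> that unfolding C_dual_def by blast
  have cont: "continuous_map M.mtopology euclideanreal \<mu>"
    using \<mu> unfolding C_dual_def mtopology_of_def by blast
  have \<mu>0: "\<mu> ?z = 0"
    using scale[OF z, of 0] by simp
  have "openin M.mtopology {f \<in> topspace M.mtopology. \<mu> f \<in> ball 0 1}"
    by (rule openin_continuous_map_preimage[OF cont]) simp
  moreover have "?z \<in> {f \<in> topspace M.mtopology. \<mu> f \<in> ball 0 1}"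
    using z \<mu>0 by (simp del: mspace_cfunspace)
  ultimately obtain r where r: "r > 0" "M.mball ?z r \<subseteq> {f \<in> topspace M.mtopology. \<mu> f \<in> ball 0 1}"
    unfolding M.openin_mtopology by blast
  show thesis
  proof
    show "0 < 2 / r" using r by simp
    fix f and \<delta> :: real assume f: "f \<in> C_space Y" "0 < \<delta>" "\<And>y. y \<in> topspace Y \<Longrightarrow> \<bar>f y\<bar> \<le> \<delta>"
    \<comment> \<open>Scales \<open>f\<close> to sup norm at most \<open>r / 2\<close>, because the
      ball of radius \<open>r\<close> is open.\<close>
    define c where "c = r / (2 * \<delta>)"
    have c: "c > 0" using r f by (simp add: c_def)
    let ?g = "\<lambda>y\<in>topspace Y. c * f y"
    have g: "?g \<in> C_space Y"
      using restrict_in_C_space[OF Y, of "\<lambda>y. c * f y"] f(1) Y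
      by (simp add: C_space_iff continuous_map_real_mult_left del: mspace_cfunspace)
    have "mdist (C_metric Y) ?z ?g \<le> r / 2"
    proof (rule mdist_cfunspace_le)
      fix y assume "y \<in> topspace Y"
      then have "c * \<bar>f y\<bar> \<le> c * \<delta>" using f(3) c by simp
      also have "c * \<delta> = r / 2" using f(2) by (simp add: c_def)
      finally show "mdist euclidean_metric (?z y) (?g y) \<le> r / 2"
        using \<open>y \<in> topspace Y\<close> c by (simp add: dist_real_def abs_mult)
    qed (use r in simp)
    then have "?g \<in> M.mball ?z r"
      using z g r(1) unfolding M.in_mball by (auto simp del: mspace_cfunspace)
    then have "\<bar>\<mu> ?g\<bar> < 1" using r(2) by (auto simp: dist_real_def)
    then have "c * \<bar>\<mu> f\<bar> < 1" using scale[OF f(1)] c by (simp add: abs_mult)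
    then show "\<bar>\<mu> f\<bar> \<le> 2 / r * \<delta>"
      using r f(2) by (simp add: c_def field_simps)
  qed
qed

lemma evaluation_in_C_dual:
  assumes Y: "compact_space Y" and y: "y \<in> topspace Y"
  shows "(\<lambda>f. f y) \<in> C_dual Y"
proof -
  have "continuous_map (mtopology_of (C_metric Y)) euclideanreal (\<lambda>f. f y)"
  proof -
    have "Lipschitz_continuous_map (C_metric Y) euclidean_metric (\<lambda>f. f y)"
      unfolding Lipschitz_continuous_map_def
    proof (intro conjI exI[of _ 1] ballI)
      fix f g assume "f \<in> C_space Y" "g \<in> C_space Y"
      then show "mdist euclidean_metric (f y) (g y) \<le> 1 * mdist (C_metric Y) f g"
        using mdist_cfunspace_imp_mdist_le[of f Y euclidean_metric g, OF _ _ order_refl y]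
        by (simp del: mspace_cfunspace)
    qed simp
    then show ?thesis
      using Lipschitz_continuous_imp_continuous_map by fastforce
  qed
  then show ?thesis
    using y by (simp add: C_dual_def del: mspace_cfunspace)
qed

declare mspace_cfunspace [simp del]

section \<open>Weak compactness and the order property\<close>

text \<open>Takes the place of the reverse Fatou lemma for a measure behind \<open>\<nu>\<close>:
  nonnegative functions with a common upper bound whose integrals stay above
  \<open>\<epsilon>\<close> cannot tend to 0 at every point. Only finite maxima and minima are
  formed, since infinite ones leave the continuous functions; the common point comes from
  compactness.\<close>

lemma positive_functional_limsup:
  fixes Y :: "'y topology" and \<nu> :: "('y \<Rightarrow> real) \<Rightarrow> real" and F :: "nat \<Rightarrow> 'y \<Rightarrow> real"
  defines "pos f \<equiv> continuous_map Y euclideanreal f \<and> (\<forall>y\<in>topspace Y. 0 \<le> f y)"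
  assumes Y: "compact_space Y"
    and add: "\<And>f g. pos f \<Longrightarrow> pos g \<Longrightarrow> \<nu> (\<lambda>y. f y + g y) = \<nu> f + \<nu> g"
    and mono: "\<And>f g. pos f \<Longrightarrow> pos g \<Longrightarrow> (\<And>y. y \<in> topspace Y \<Longrightarrow> f y \<le> g y) \<Longrightarrow> \<nu> f \<le> \<nu> g"
    and K: "0 < K" "\<And>\<delta>. 0 < \<delta> \<Longrightarrow> \<nu> (\<lambda>_. \<delta>) \<le> K * \<delta>"
    and F: "\<And>n. pos (F n)" "\<And>n y. y \<in> topspace Y \<Longrightarrow> F n y \<le> B"
    and \<epsilon>: "0 < \<epsilon>" "\<And>n. \<epsilon> \<le> \<nu> (F n)"
  obtains y \<delta> where "y \<in> topspace Y" "0 < \<delta>" "\<And>n. \<exists>k\<ge>n. \<delta> \<le> F k y"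
proof -
  \<comment> \<open>The maximum of \<open>F n, ..., F (n + k)\<close>, a continuous stand-in for the
    supremum of the tail from \<open>n\<close>.\<close>
  define g where "g n = rec_nat (F n) (\<lambda>k f y. max (f y) (F (n + Suc k) y))" for n
  have g0: "g n 0 = F n" and gS: "g n (Suc k) = (\<lambda>y. max (g n k y) (F (n + Suc k) y))" for n k
    by (simp_all add: g_def)
  have gpos: "pos (g n k)" for n k
  proof (induction k)
    case (Suc k)
    then show ?case
      using F(1)[of "n + Suc k"]
      by (auto simp: gS pos_def le_max_iff_disj intro!: continuous_map_real_max)
  qed (use F(1) in \<open>simp add: g0\<close>)
  have gB: "g n k y \<le> B" if "y \<in> topspace Y" for n k y
    by (induction k) (use that F(2) in \<open>auto simp: g0 gS\<close>)
  have gle: "F i y \<le> g n k y" if "i \<in> {n..n+k}" for i n k y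
    using that
  proof (induction k)
    case (Suc k)
    then show ?case by (cases "i = n + Suc k") (auto simp: gS le_max_iff_disj)
  qed (simp add: g0)
  have gex: "\<exists>i\<in>{n..n+k}. g n k y = F i y" for n k y
  proof (induction k)
    case (Suc k)
    then obtain i where i: "i \<in> {n..n+k}" "g n k y = F i y" by blast
    show ?case
    proof (cases "F i y \<le> F (n + Suc k) y")
      case True
      then show ?thesis by (intro bexI[of _ "n + Suc k"]) (simp_all add: gS i)
    next
      case False
      then show ?thesis using i by (intro bexI[of _ i]) (simp_all add: gS)
    qed
  qed (simp add: g0)
  have gmono: "g n k y \<le> g n' k' y" if "n' \<le> n" "n + k \<le> n' + k'" for n k n' k' y
  proof -
    obtain i where "i \<in> {n..n+k}" "g n k y = F i y" using gex by blast
    then show ?thesis using gle[of i n' k' y] that by auto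
  qed
  have Bpos: "pos (\<lambda>_. max B 0)"
    by (simp add: pos_def)
  define s where "s n = (SUP k. \<nu> (g n k))" for n
  have bdd: "bdd_above (range (\<lambda>k. \<nu> (g n k)))" for n
  proof (rule bdd_aboveI2)
    show "\<nu> (g n k) \<le> \<nu> (\<lambda>_. max B 0)" for k
      by (rule mono[OF gpos Bpos]) (simp add: gB le_max_iff_disj)
  qed
  have sge: "\<nu> (g n k) \<le> s n" for n k
    unfolding s_def by (rule cSUP_upper[OF _ bdd]) simp
  have "\<exists>k. s n - \<epsilon> / 2 ^ (n + 2) < \<nu> (g n k)" for n
  proof -
    have "s n - \<epsilon> / 2 ^ (n + 2) < s n" using \<epsilon>(1) by simp
    then show ?thesis unfolding s_def using less_cSUP_iff[OF _ bdd] by auto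
  qed
  \<comment> \<open>Windows that are nearly maximal for \<open>\<nu>\<close>; the losses are
    summable, with total \<open>\<epsilon> / 2\<close>.\<close>
  then obtain k where k: "\<And>n. s n - \<epsilon> / 2 ^ (n + 2) < \<nu> (g n (k n))" by metis
  define h where "h = rec_nat (g 0 (k 0)) (\<lambda>n f y. min (f y) (g (Suc n) (k (Suc n)) y))"
  have h0: "h 0 = g 0 (k 0)" and hS: "h (Suc n) = (\<lambda>y. min (h n y) (g (Suc n) (k (Suc n)) y))" for n
    by (simp_all add: h_def)
  have hpos: "pos (h n)" for n
  proof (induction n)
    case (Suc n)
    then show ?case
      using gpos[of "Suc n" "k (Suc n)"]
      by (auto simp: hS pos_def intro!: continuous_map_real_min)
  qed (use gpos in \<open>simp add: h0\<close>)
  have hle: "h n y \<le> g n (k n) y" for n y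
    by (cases n) (auto simp: h0 hS)
  have hdec: "h m y \<le> h n y" if "n \<le> m" for n m y
    using that by (induction rule: dec_induct) (auto simp: hS min.coboundedI1)
  \<comment> \<open>Modularity: the minimum and the maximum of \<open>h n\<close> and the next
    window have the same sum as these two functions. The maximum lies under a window starting at
    \<open>n\<close>, so its \<open>\<nu>\<close> is at most \<open>s n\<close>, and the minimum
    inherits the rest. The summand \<open>\<epsilon> / 2 ^ (n + 2)\<close> is the part of the error
    budget not yet spent.\<close>
  have \<nu>h: "s n - \<epsilon> / 2 + \<epsilon> / 2 ^ (n + 2) \<le> \<nu> (h n)" for n
  proof (induction n)
    case 0
    then show ?case using k[of 0] by (simp add: h0)
  next
    case (Suc n)
    let ?G = "g (Suc n) (k (Suc n))"
    let ?M = "\<lambda>y. max (h n y) (?G y)"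
    have Mpos: "pos ?M"
      using hpos[of n] gpos[of "Suc n" "k (Suc n)"]
      by (auto simp: pos_def le_max_iff_disj intro!: continuous_map_real_max)
    have "\<nu> ?M \<le> \<nu> (g n (max (k n) (Suc (k (Suc n)))))"
    proof (rule mono[OF Mpos gpos])
      fix y
      show "?M y \<le> g n (max (k n) (Suc (k (Suc n)))) y"
        using order_trans[OF hle gmono[of n n "k n" "max (k n) (Suc (k (Suc n)))" y]]
          gmono[of n "Suc n" "k (Suc n)" "max (k n) (Suc (k (Suc n)))" y] by simp
    qed
    also have "\<dots> \<le> s n" by (rule sge)
    finally have "\<nu> ?M \<le> s n" .
    moreover have "\<nu> (h (Suc n)) + \<nu> ?M = \<nu> (h n) + \<nu> ?G"
    proof -
      have "(\<lambda>y. h (Suc n) y + ?M y) = (\<lambda>y. h n y + ?G y)"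
        by (auto simp: hS min_def max_def)
      then show ?thesis using add[OF hpos Mpos] add[OF hpos gpos] by metis
    qed
    moreover have "\<epsilon> / 2 ^ (n + 2) = 2 * (\<epsilon> / 2 ^ (Suc n + 2))"
      by simp
    ultimately show ?case using Suc k[of "Suc n"] by linarith
  qed
  have "\<epsilon> / 2 < \<nu> (h n)" for n
  proof -
    have "\<epsilon> \<le> s n" using sge[of n 0] \<epsilon>(2)[of n] by (simp add: g0)
    moreover have "0 < \<epsilon> / 2 ^ (n + 2)" using \<epsilon> by simp
    ultimately show ?thesis using \<nu>h[of n] by linarith
  qed
  \<comment> \<open>If \<open>h n\<close> stayed below this \<open>\<delta>\<close> everywhere,
    \<open>\<nu> (h n)\<close> would be at most
    \<open>K * \<delta> = \<epsilon> / 2\<close>.\<close>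
  define \<delta> where "\<delta> = \<epsilon> / (2 * K)"
  have \<delta>: "0 < \<delta>" "K * \<delta> = \<epsilon> / 2" using K(1) \<epsilon>(1) by (simp_all add: \<delta>_def)
  have ex: "\<exists>y\<in>topspace Y. \<delta> \<le> h n y" for n
  proof (rule ccontr)
    assume "\<not> ?thesis"
    then have "\<nu> (h n) \<le> \<nu> (\<lambda>_. \<delta>)"
      using \<delta> by (intro mono hpos) (simp_all add: pos_def not_le less_imp_le)
    also have "\<dots> \<le> K * \<delta>" by (rule K(2)[OF \<delta>(1)])
    finally show False using \<open>\<epsilon> / 2 < \<nu> (h n)\<close> \<delta> by simp
  qed
  define D where "D n = {y \<in> topspace Y. \<delta> \<le> h n y}" for n
  have "\<Inter> (range D) \<noteq> {}"
  proof (rule compact_space_fip[THEN iffD1, OF Y, rule_format], intro conjI strip)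
    fix S assume "S \<in> range D"
    then obtain n where n: "S = D n" by blast
    have "closedin Y {y \<in> topspace Y. h n y \<in> {\<delta>..}}"
      by (rule closedin_continuous_map_preimage) (use hpos[of n] in \<open>auto simp: pos_def\<close>)
    then show "closedin Y S" by (simp add: n D_def)
  next
    fix \<F> assume \<F>: "finite \<F> \<and> \<F> \<subseteq> range D"
    then obtain I where I: "finite I" "\<F> = D ` I" using finite_subset_image by metis
    obtain N where "\<forall>i\<in>I. i \<le> N" using I finite_nat_set_iff_bounded_le by metis
    then have "D N \<subseteq> \<Inter> \<F>" using order_trans[OF _ hdec] unfolding I D_def by blast
    then show "\<Inter> \<F> \<noteq> {}" using ex[of N] unfolding D_def by blast
  qed
  then obtain y where y: "\<And>n. y \<in> D n" by blast
  show thesis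
  proof
    show "y \<in> topspace Y" "0 < \<delta>" using y \<delta> by (auto simp: D_def)
    fix n
    obtain i where "i \<in> {n..n + k n}" "g n (k n) y = F i y" using gex by blast
    then show "\<exists>k\<ge>n. \<delta> \<le> F k y" using y[of n] hle[of n y] by (auto simp: D_def)
  qed
qed

text \<open>The preceding lemma wants a functional that is monotone on nonnegative functions, which
  \<open>\<mu>\<close> need not be. It is applied to the modulus of \<open>\<mu>\<close>, which
  sends \<open>f\<close> to the supremum of \<open>\<mu> g\<close> over
  \<open>\<bar>g\<bar> \<le> f\<close>, and to the absolute values of the given functions.\<close>

lemma C_dual_limsup:
  assumes Y: "compact_space Y" and \<mu>: "\<mu> \<in> C_dual Y"
    and f: "\<And>n. f n \<in> C_space Y" "\<And>n y. y \<in> topspace Y \<Longrightarrow> \<bar>f n y\<bar> \<le> B"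
    and \<epsilon>: "0 < \<epsilon>" "\<And>n. \<epsilon> \<le> \<bar>\<mu> (f n)\<bar>"
  obtains y \<delta> where "y \<in> topspace Y" "0 < \<delta>" "\<And>n::nat. \<exists>k\<ge>n. \<delta> \<le> \<bar>f k y\<bar>"
proof -
  obtain K where K: "0 < K"
    "\<And>f \<delta>. f \<in> C_space Y \<Longrightarrow> 0 < \<delta> \<Longrightarrow> (\<And>y. y \<in> topspace Y \<Longrightarrow> \<bar>f y\<bar> \<le> \<delta>) \<Longrightarrow> \<bar>\<mu> f\<bar> \<le> K * \<delta>"
    using C_dual_bounded[OF Y \<mu>] by blast
  \<comment> \<open>Members of \<open>C_space Y\<close> are \<open>undefined\<close> off the space;
    \<open>m\<close> lets \<open>\<mu>\<close> accept any continuous function.\<close>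
  define m where "m g = \<mu> (restrict g (topspace Y))" for g
  have restr: "restrict g (topspace Y) \<in> C_space Y" if "continuous_map Y euclideanreal g" for g
    by (rule restrict_in_C_space[OF Y that])
  have madd: "m (\<lambda>y. a y + b y) = m a + m b"
    if "continuous_map Y euclideanreal a" "continuous_map Y euclideanreal b" for a b
  proof -
    have "\<mu> (\<lambda>y\<in>topspace Y. restrict a (topspace Y) y + restrict b (topspace Y) y) = m a + m b"
      using \<mu> restr[OF that(1)] restr[OF that(2)] unfolding C_dual_def m_def by blast
    moreover have "(\<lambda>y\<in>topspace Y. restrict a (topspace Y) y + restrict b (topspace Y) y)
        = (\<lambda>y\<in>topspace Y. a y + b y)"
      by auto
    ultimately show ?thesis by (simp add: m_def)
  qed
  have mneg: "m (\<lambda>y. - a y) = - m a" if "continuous_map Y euclideanreal a" for a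
  proof -
    have "\<mu> (\<lambda>y\<in>topspace Y. (-1) * restrict a (topspace Y) y) = (-1) * m a"
      using \<mu> restr[OF that] unfolding C_dual_def m_def by blast
    moreover have "(\<lambda>y\<in>topspace Y. (-1) * restrict a (topspace Y) y) = (\<lambda>y\<in>topspace Y. - a y)"
      by auto
    ultimately show ?thesis by (simp add: m_def)
  qed
  let ?pos = "\<lambda>f. continuous_map Y euclideanreal f \<and> (\<forall>y\<in>topspace Y. 0 \<le> f y)"
  define D where "D f = {g. continuous_map Y euclideanreal g \<and> (\<forall>y\<in>topspace Y. \<bar>g y\<bar> \<le> f y)}" for f
  define \<nu> where "\<nu> f = (SUP g\<in>D f. m g)" for f
  have mK: "\<bar>m g\<bar> \<le> K * \<delta>" if "g \<in> D (\<lambda>_. \<delta>)" "0 < \<delta>" for g \<delta>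
    unfolding m_def by (rule K(2)) (use that restr in \<open>auto simp: D_def\<close>)
  have D0: "(\<lambda>_. 0) \<in> D f" if "?pos f" for f
    using that by (auto simp: D_def)
  have bdd: "bdd_above (m ` D f)" if f: "?pos f" for f
  proof -
    obtain b where b: "0 < b" "\<And>y. y \<in> topspace Y \<Longrightarrow> \<bar>f y\<bar> \<le> b"
      using continuous_map_bounded[OF Y] f by metis
    then have "D f \<subseteq> D (\<lambda>_. b)" using f by (force simp: D_def)
    then show ?thesis using mK[OF _ b(1)] by (intro bdd_aboveI2[of _ _ "K * b"]) (force simp: abs_le_iff)
  qed
  have upper: "m g \<le> \<nu> f" if "?pos f" "g \<in> D f" for f g
    unfolding \<nu>_def by (rule cSUP_upper[OF that(2) bdd[OF that(1)]])
  have upper_abs: "\<bar>m g\<bar> \<le> \<nu> f" if "?pos f" "g \<in> D f" for f g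
  proof -
    have "(\<lambda>y. - g y) \<in> D f" "continuous_map Y euclideanreal g"
      using that by (auto simp: D_def)
    then show ?thesis using upper[OF that] upper[OF that(1), of "\<lambda>y. - g y"] mneg[of g] by (simp add: abs_le_iff)
  qed
  have least: "\<nu> f \<le> c" if "?pos f" "\<And>g. g \<in> D f \<Longrightarrow> m g \<le> c" for f c
    unfolding \<nu>_def by (rule cSUP_least) (use D0[OF that(1)] that(2) in auto)
  have add: "\<nu> (\<lambda>y. a y + b y) = \<nu> a + \<nu> b" if ab: "?pos a" "?pos b" for a b
  proof (rule antisym)
    have pos: "?pos (\<lambda>y. a y + b y)" using ab by (auto intro: continuous_intros)
    show "\<nu> (\<lambda>y. a y + b y) \<le> \<nu> a + \<nu> b"
    proof (rule least[OF pos])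
      fix g assume g: "g \<in> D (\<lambda>y. a y + b y)"
      \<comment> \<open>Riesz decomposition: clipping \<open>g\<close> to the interval from
        \<open>- a\<close> to \<open>a\<close> leaves a remainder bounded by
        \<open>b\<close>.\<close>
      let ?g = "\<lambda>y. max (- a y) (min (a y) (g y))"
      have c: "continuous_map Y euclideanreal ?g" "continuous_map Y euclideanreal (\<lambda>y. g y - ?g y)"
        using g ab by (auto simp: D_def intro!: continuous_intros)
      have "\<bar>?g y\<bar> \<le> a y \<and> \<bar>g y - ?g y\<bar> \<le> b y" if "y \<in> topspace Y" for y
      proof -
        have "0 \<le> a y" "0 \<le> b y" "\<bar>g y\<bar> \<le> a y + b y" using g ab that by (auto simp: D_def)
        then show ?thesis by arith
      qed
      then have "?g \<in> D a" "(\<lambda>y. g y - ?g y) \<in> D b"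
        using c by (simp_all add: D_def)
      then have "m ?g + m (\<lambda>y. g y - ?g y) \<le> \<nu> a + \<nu> b"
        using upper ab by (meson add_mono)
      then show "m g \<le> \<nu> a + \<nu> b" using madd[OF c] by simp
    qed
    have "m g + m h \<le> \<nu> (\<lambda>y. a y + b y)" if "g \<in> D a" "h \<in> D b" for g h
    proof -
      have "(\<lambda>y. g y + h y) \<in> D (\<lambda>y. a y + b y)"
        using that by (auto simp: D_def intro!: continuous_intros) (meson abs_triangle_ineq add_mono order_trans)
      then show ?thesis
        using upper[OF pos] madd[of g h] that unfolding D_def by fastforce
    qed
    then have "m g \<le> \<nu> (\<lambda>y. a y + b y) - m h" if "g \<in> D a" "h \<in> D b" for g h
      using that by (simp add: le_diff_eq)
    then have "\<nu> a \<le> \<nu> (\<lambda>y. a y + b y) - m h" if "h \<in> D b" for h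
      using least[OF ab(1)] that by blast
    then have "m h \<le> \<nu> (\<lambda>y. a y + b y) - \<nu> a" if "h \<in> D b" for h
      using that by fastforce
    then have "\<nu> b \<le> \<nu> (\<lambda>y. a y + b y) - \<nu> a"
      using least[OF ab(2)] by blast
    then show "\<nu> a + \<nu> b \<le> \<nu> (\<lambda>y. a y + b y)" by simp
  qed
  have fc: "continuous_map Y euclideanreal (f n)" for n
    using f(1) Y by (simp add: C_space_iff)
  have fa: "continuous_map Y euclideanreal (\<lambda>y. \<bar>f n y\<bar>)" for n
    using fc by (intro continuous_intros)
  show thesis
  proof (rule positive_functional_limsup[of Y \<nu> K "\<lambda>n y. \<bar>f n y\<bar>" B \<epsilon>])
    show "\<nu> a \<le> \<nu> b" if "?pos a" "?pos b" "\<And>y. y \<in> topspace Y \<Longrightarrow> a y \<le> b y" for a b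
      by (rule least[OF that(1)], rule upper[OF that(2)]) (use that(3) in \<open>force simp: D_def\<close>)
    show "\<nu> (\<lambda>_. \<delta>) \<le> K * \<delta>" if "0 < \<delta>" for \<delta>
      by (rule least) (use that mK in \<open>auto simp: abs_le_iff\<close>)
    show "\<epsilon> \<le> \<nu> (\<lambda>y. \<bar>f n y\<bar>)" for n
    proof -
      have "\<bar>m (f n)\<bar> \<le> \<nu> (\<lambda>y. \<bar>f n y\<bar>)"
        by (rule upper_abs) (use fc[of n] fa[of n] in \<open>auto simp: D_def\<close>)
      moreover have "m (f n) = \<mu> (f n)" using f(1) by (simp add: m_def C_space_restrict)
      ultimately show ?thesis using \<epsilon>(2)[of n] by simp
    qed
  qed (use Y add K f fa \<epsilon> that in auto)
qed

text \<open>Dependent choice in which every new element may depend on the whole list of earlier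
  ones. Every list over \<open>D\<close> must be extendable, so conditions that only make sense for
  good lists enter as implications.\<close>

lemma sequence_with_history:
  assumes "\<And>xs. set xs \<subseteq> D \<Longrightarrow> \<exists>x\<in>D. Q xs x"
  obtains p where "\<And>n::nat. p n \<in> D" "\<And>n. Q (map p [0..<n]) (p n)"
proof -
  obtain pick where pick: "\<And>xs. set xs \<subseteq> D \<Longrightarrow> pick xs \<in> D \<and> Q xs (pick xs)"
    using assms by metis
  define l where "l = rec_nat [] (\<lambda>_ xs. xs @ [pick xs])"
  define p where "p n = pick (l n)" for n
  have l: "l n = map p [0..<n]" for n
    by (induction n) (simp_all add: l_def p_def)
  have D: "set (l n) \<subseteq> D" for n
  proof (induction n)
    case (Suc n)
    then show ?case using pick[OF Suc] by (simp add: l_def)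
  qed (simp add: l_def)
  show thesis
    using that[of p] pick[OF D] by (simp add: p_def flip: l)
qed

section \<open>Limits of families without the order property\<close>

lemma continuous_map_euclideanreal_iff:
  "continuous_map X euclideanreal f \<longleftrightarrow>
     (\<forall>x\<in>topspace X. \<forall>\<epsilon>>0. \<exists>U. openin X U \<and> x \<in> U \<and> (\<forall>y\<in>U. \<bar>f y - f x\<bar> < \<epsilon>))"
  using Met_TC.continuous_map_to_metric[of X f]
  by (simp add: dist_real_def abs_minus_commute)

text \<open>Serves to replace a point of the space, up to \<open>\<delta>\<close> and for finitely
  many functions at once, by one from a finite set fixed in advance.\<close>

lemma compact_space_finite_net:
  assumes Y: "compact_space Y" and "finite \<F>" "\<And>f. f \<in> \<F> \<Longrightarrow> continuous_map Y euclideanreal f" "0 < \<delta>"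
  obtains S where "finite S" "S \<subseteq> topspace Y"
    "\<And>y. y \<in> topspace Y \<Longrightarrow> \<exists>z\<in>S. \<forall>f\<in>\<F>. \<bar>f y - f z\<bar> < \<delta>"
proof -
  define U where "U z = {y \<in> topspace Y. \<forall>f\<in>\<F>. \<bar>f y - f z\<bar> < \<delta>}" for z
  have "openin Y {y \<in> topspace Y. \<bar>f y - f z\<bar> < \<delta>}" if "f \<in> \<F>" for f z
  proof -
    have "openin Y {y \<in> topspace Y. f y \<in> ball (f z) \<delta>}"
      by (rule openin_continuous_map_preimage[OF assms(3)[OF that]]) simp
    then show ?thesis by (simp add: dist_real_def abs_minus_commute)
  qed
  moreover have "U z = topspace Y \<inter> (\<Inter>f\<in>\<F>. {y \<in> topspace Y. \<bar>f y - f z\<bar> < \<delta>})" for z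
    by (auto simp: U_def)
  ultimately have op: "openin Y (U z)" for z
    using assms(2) by (cases "\<F> = {}") (auto intro!: openin_Int openin_INT2)
  have "topspace Y \<subseteq> \<Union> (U ` topspace Y)"
    using assms(4) by (auto simp: U_def)
  then obtain G where "finite G" "G \<subseteq> U ` topspace Y" "topspace Y \<subseteq> \<Union> G"
    using Y op unfolding compact_space_alt by (metis (no_types, lifting) imageE)
  then obtain S where S: "S \<subseteq> topspace Y" "finite S" "topspace Y \<subseteq> \<Union> (U ` S)"
    by (metis finite_subset_image)
  show thesis
    by (rule that[OF S(2,1)]) (use S(3) in \<open>auto simp: U_def\<close>)
qed

text \<open>Near a discontinuity \<open>y0\<close> of \<open>h\<close>, functions and points are
  chosen alternately. Each new function is close to \<open>h\<close> at \<open>y0\<close> and at the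
  earlier points; each new point is so close to \<open>y0\<close> that the functions chosen so far
  hardly change, while \<open>h\<close> jumps by \<open>\<epsilon>\<close>. For
  \<open>n < m\<close>, then, \<open>F n (y m)\<close> is near \<open>h y0\<close> and
  \<open>F m (y n)\<close> is near \<open>h (y n)\<close>.\<close>

lemma continuous_limit_if_no_order_property:
  assumes A: "A \<subseteq> C_space Y" and Y: "compact_space Y" and nop: "\<not> order_property A (topspace Y)"
    and h: "\<And>S \<delta>. finite S \<Longrightarrow> S \<subseteq> topspace Y \<Longrightarrow> 0 < \<delta> \<Longrightarrow> \<exists>f\<in>A. \<forall>y\<in>S. \<bar>f y - h y\<bar> < \<delta>"
  shows "continuous_map Y euclideanreal h"
proof (rule ccontr)
  assume "\<not> ?thesis"
  then obtain y0 \<epsilon> where y0: "y0 \<in> topspace Y" "0 < \<epsilon>"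
    and disc: "\<And>U. openin Y U \<Longrightarrow> y0 \<in> U \<Longrightarrow> \<exists>y\<in>U. \<epsilon> \<le> \<bar>h y - h y0\<bar>"
    unfolding continuous_map_euclideanreal_iff by (metis not_le)
  have cont: "continuous_map Y euclideanreal f" if "f \<in> A" for f
    using A Y that by (auto simp: C_space_iff)
  define Q where "Q xs = (\<lambda>(f, y). (\<forall>z\<in>insert y0 (snd ` set xs). \<bar>f z - h z\<bar> < \<epsilon> / 4) \<and>
    (\<forall>g\<in>insert f (fst ` set xs). \<bar>g y - g y0\<bar> < \<epsilon> / 4) \<and> \<epsilon> \<le> \<bar>h y - h y0\<bar>)" for xs :: "(('a \<Rightarrow> real) \<times> 'a) list"
  have "\<exists>x\<in>A \<times> topspace Y. Q xs x" if xs: "set xs \<subseteq> A \<times> topspace Y" for xs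
  proof -
    have "insert y0 (snd ` set xs) \<subseteq> topspace Y" using xs y0(1) by auto
    then have "\<exists>f\<in>A. \<forall>z\<in>insert y0 (snd ` set xs). \<bar>f z - h z\<bar> < \<epsilon> / 4"
      using y0(2) by (intro h) simp_all
    then obtain f where f: "f \<in> A" "\<forall>z\<in>insert y0 (snd ` set xs). \<bar>f z - h z\<bar> < \<epsilon> / 4"
      by blast
    have fin: "finite (insert f (fst ` set xs))" by simp
    have op: "\<exists>U. openin Y U \<and> y0 \<in> U \<and> (\<forall>y\<in>U. \<bar>g y - g y0\<bar> < \<epsilon> / 4)" if "g \<in> insert f (fst ` set xs)" for g
    proof -
      have "continuous_map Y euclideanreal g"
        using that f(1) xs by (intro cont) auto
      then show ?thesis
        using y0 unfolding continuous_map_euclideanreal_iff by (meson divide_pos_pos zero_less_numeral)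
    qed
    then obtain U where U: "\<And>g. g \<in> insert f (fst ` set xs) \<Longrightarrow>
        openin Y (U g) \<and> y0 \<in> U g \<and> (\<forall>y\<in>U g. \<bar>g y - g y0\<bar> < \<epsilon> / 4)"
      by metis
    have "openin Y (\<Inter> (U ` insert f (fst ` set xs)))"
      using U by (intro openin_INT2 fin) auto
    moreover have "y0 \<in> \<Inter> (U ` insert f (fst ` set xs))"
      using U by blast
    ultimately obtain y where y: "y \<in> \<Inter> (U ` insert f (fst ` set xs))" "\<epsilon> \<le> \<bar>h y - h y0\<bar>"
      using disc by meson
    have "y \<in> topspace Y"
      using y(1) U[of f] openin_subset by fastforce
    then have "(f, y) \<in> A \<times> topspace Y" "Q xs (f, y)"
      using f y U unfolding Q_def by auto
    then show ?thesis by blast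
  qed
  then obtain p where p: "\<And>n. p n \<in> A \<times> topspace Y" "\<And>n. Q (map p [0..<n]) (p n)"
    using sequence_with_history[of "A \<times> topspace Y" Q] by blast
  define F y where "F n = fst (p n)" and "y n = snd (p n)" for n
  have Q: "\<bar>F n y0 - h y0\<bar> < \<epsilon> / 4" "i < n \<Longrightarrow> \<bar>F n (y i) - h (y i)\<bar> < \<epsilon> / 4"
    "i < n \<Longrightarrow> \<bar>F i (y n) - F i y0\<bar> < \<epsilon> / 4" "\<epsilon> \<le> \<bar>h (y n) - h y0\<bar>" for n i
    using p(2)[of n] unfolding Q_def F_def y_def by (auto simp: case_prod_beta)
  have "order_property A (topspace Y)"
    unfolding order_property_def
  proof (intro exI conjI strip)
    show "F n \<in> A" "y n \<in> topspace Y" for n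
      using p(1)[of n] by (auto simp: F_def y_def mem_Times_iff)
    \<comment> \<open>Three errors of \<open>\<epsilon> / 4\<close> are subtracted from the jump
      \<open>\<epsilon>\<close>.\<close>
    show "0 < \<epsilon> / 4" using y0 by simp
    fix n m :: nat assume "n < m"
    then show "\<epsilon> / 4 \<le> \<bar>F n (y m) - F m (y n)\<bar>"
      using Q(1)[of n] Q(2)[of n m] Q(3)[of n m] Q(4)[of n] by arith
  qed
  then show False using nop by simp
qed

text \<open>If \<open>\<mu>\<close> missed the limit, \<open>C_dual_limsup\<close> would give a
  point \<open>y\<close> at which \<open>F k\<close> stays away from \<open>h\<close> for infinitely
  many \<open>k\<close>. Closeness of \<open>F k\<close> to \<open>h\<close> is only arranged on
  finite sets, which need not contain \<open>y\<close>. Net points \<open>z n\<close> that imitate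
  \<open>y\<close> for \<open>h\<close> and the functions chosen so far turn the distance at
  \<open>y\<close> into an order property.\<close>

lemma functional_limit_if_no_order_property:
  assumes A: "A \<subseteq> C_space Y" and Y: "compact_space Y" and nop: "\<not> order_property A (topspace Y)"
    and B: "\<And>f y. f \<in> A \<Longrightarrow> y \<in> topspace Y \<Longrightarrow> \<bar>f y\<bar> \<le> B"
    and \<mu>: "\<mu> \<in> C_dual Y" and hC: "h \<in> C_space Y"
    and h: "\<And>S \<delta>. finite S \<Longrightarrow> S \<subseteq> topspace Y \<Longrightarrow> 0 < \<delta> \<Longrightarrow>
      \<exists>f\<in>A. (\<forall>y\<in>S. \<bar>f y - h y\<bar> < \<delta>) \<and> \<bar>\<mu> f - c\<bar> < \<delta>"
  shows "c = \<mu> h"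
proof (rule ccontr)
  assume "c \<noteq> \<mu> h"
  define \<epsilon> where "\<epsilon> = \<bar>c - \<mu> h\<bar> / 2"
  have \<epsilon>: "0 < \<epsilon>" using \<open>c \<noteq> \<mu> h\<close> by (simp add: \<epsilon>_def)
  have cont: "continuous_map Y euclideanreal f" if "f \<in> insert h A" for f
    using A Y hC that by (auto simp: C_space_iff)
  define D where "D = A \<times> {S. finite S \<and> S \<subseteq> topspace Y}"
  \<comment> \<open>Every new function approximates \<open>h\<close> on all earlier nets, and its
    own net serves \<open>h\<close> together with all functions up to this one. The tolerance
    shrinks to 0 along the sequence.\<close>
  define Q where "Q xs = (\<lambda>(f, S). (\<forall>y\<in>\<Union> (snd ` set xs). \<bar>f y - h y\<bar> < inverse (Suc (length xs))) \<and>
    \<bar>\<mu> f - c\<bar> < \<epsilon> \<and>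
    (\<forall>y\<in>topspace Y. \<exists>z\<in>S. \<forall>g\<in>insert h (insert f (fst ` set xs)). \<bar>g y - g z\<bar> < inverse (Suc (length xs))))"
    for xs :: "(('a \<Rightarrow> real) \<times> 'a set) list"
  have "\<exists>x\<in>D. Q xs x" if xs: "set xs \<subseteq> D" for xs
  proof -
    let ?\<delta> = "inverse (Suc (length xs)) :: real"
    have "\<forall>x\<in>set xs. x \<in> A \<times> {S. finite S \<and> S \<subseteq> topspace Y}"
      using xs unfolding D_def by blast
    then have "\<forall>x\<in>set xs. fst x \<in> A \<and> finite (snd x) \<and> snd x \<subseteq> topspace Y"
      by (simp add: mem_Times_iff)
    then have "finite (\<Union> (snd ` set xs))" "\<Union> (snd ` set xs) \<subseteq> topspace Y"
      by auto
    then have "\<exists>f\<in>A. (\<forall>y\<in>\<Union> (snd ` set xs). \<bar>f y - h y\<bar> < min ?\<delta> \<epsilon>) \<and> \<bar>\<mu> f - c\<bar> < min ?\<delta> \<epsilon>"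
      using \<epsilon> by (intro h) simp_all
    then obtain f where f: "f \<in> A" "\<forall>y\<in>\<Union> (snd ` set xs). \<bar>f y - h y\<bar> < min ?\<delta> \<epsilon>" "\<bar>\<mu> f - c\<bar> < min ?\<delta> \<epsilon>"
      by blast
    have "fst ` set xs \<subseteq> A" using xs by (auto simp: D_def)
    then have "continuous_map Y euclideanreal g" if "g \<in> insert h (insert f (fst ` set xs))" for g
      using that f(1) by (intro cont) auto
    then obtain S where S: "finite S" "S \<subseteq> topspace Y"
      "\<And>y. y \<in> topspace Y \<Longrightarrow> \<exists>z\<in>S. \<forall>g\<in>insert h (insert f (fst ` set xs)). \<bar>g y - g z\<bar> < ?\<delta>"
      by (rule compact_space_finite_net[OF Y, of "insert h (insert f (fst ` set xs))" ?\<delta>, rotated]) simp_all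
    have "(f, S) \<in> D" "Q xs (f, S)"
      using f S by (auto simp: D_def Q_def)
    then show ?thesis by blast
  qed
  then obtain p where p: "\<And>n. p n \<in> D" "\<And>n. Q (map p [0..<n]) (p n)"
    using sequence_with_history[of D Q] by blast
  define F S where "F n = fst (p n)" and "S n = snd (p n)" for n
  have FS: "F n \<in> A" "S n \<subseteq> topspace Y" for n
    using p(1)[of n] by (auto simp: F_def S_def D_def mem_Times_iff)
  have Q1: "\<bar>F n y - h y\<bar> < inverse (Suc n)" if "i < n" "y \<in> S i" for n i y
    using p(2)[of n] that unfolding Q_def F_def S_def by (auto simp: case_prod_beta)
  have Q2: "\<bar>\<mu> (F n) - c\<bar> < \<epsilon>" for n
    using p(2)[of n] unfolding Q_def F_def by (auto simp: case_prod_beta)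
  have Q3: "\<exists>z\<in>S n. \<bar>h y - h z\<bar> < inverse (Suc n) \<and> (\<forall>i\<le>n. \<bar>F i y - F i z\<bar> < inverse (Suc n))"
    if "y \<in> topspace Y" for n y
  proof -
    have "\<exists>z\<in>S n. \<forall>g\<in>insert h (insert (F n) (F ` {0..<n})). \<bar>g y - g z\<bar> < inverse (Suc n)"
      using p(2)[of n] that unfolding Q_def F_def S_def by (auto simp: case_prod_beta image_image)
    then obtain z where z: "z \<in> S n"
      "\<And>g. g \<in> insert h (insert (F n) (F ` {0..<n})) \<Longrightarrow> \<bar>g y - g z\<bar> < inverse (Suc n)" by blast
    have "F i \<in> insert h (insert (F n) (F ` {0..<n}))" if "i \<le> n" for i
      using that by (cases "i = n") auto
    then show ?thesis using z by blast
  qed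
  define d where "d n = (\<lambda>y\<in>topspace Y. F n y - h y)" for n
  have hcont: "continuous_map Y euclideanreal h" using cont by simp
  have Fcont: "continuous_map Y euclideanreal (F n)" for n using cont FS by simp
  have dC: "d n \<in> C_space Y" for n
    unfolding d_def by (intro restrict_in_C_space[OF Y] continuous_intros Fcont hcont)
  obtain b where b: "\<And>y. y \<in> topspace Y \<Longrightarrow> \<bar>h y\<bar> \<le> b"
    using continuous_map_bounded[OF Y hcont] by metis
  have dB: "\<bar>d n y\<bar> \<le> B + b" if "y \<in> topspace Y" for n y
    using B[OF FS(1) that, of n] b[OF that] that by (simp add: d_def)
  have d\<mu>: "\<epsilon> \<le> \<bar>\<mu> (d n)\<bar>" for n
  proof -
    have "\<mu> (\<lambda>y\<in>topspace Y. d n y + h y) = \<mu> (d n) + \<mu> h"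
      using \<mu> dC hC unfolding C_dual_def by blast
    moreover have "(\<lambda>y\<in>topspace Y. d n y + h y) = F n"
    proof -
      have "(\<lambda>y\<in>topspace Y. d n y + h y) = restrict (F n) (topspace Y)"
        by (auto simp: d_def)
      then show ?thesis using C_space_restrict[OF subsetD[OF A FS(1)]] by simp
    qed
    ultimately have "\<mu> (F n) = \<mu> (d n) + \<mu> h" by simp
    moreover have "\<bar>c - \<mu> h\<bar> = 2 * \<epsilon>" by (simp add: \<epsilon>_def)
    ultimately show ?thesis using Q2[of n] by linarith
  qed
  obtain y \<delta> where y: "y \<in> topspace Y" "0 < \<delta>" "\<And>n. \<exists>k\<ge>n. \<delta> \<le> \<bar>d k y\<bar>"
    using C_dual_limsup[of Y \<mu> d "B + b" \<epsilon>, OF Y \<mu> dC dB \<epsilon> d\<mu>] by blast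
  obtain N where N: "inverse (Suc N) < \<delta> / 8"
    using reals_Archimedean[of "\<delta> / 8"] y(2) by auto
  \<comment> \<open>Indices at which the distance at \<open>y\<close> is seen, beyond
    \<open>N\<close>, where the tolerance is below \<open>\<delta> / 8\<close>; three such errors
    leave more than \<open>\<delta> / 2\<close>.\<close>
  define K where "K = {k. N \<le> k \<and> \<delta> \<le> \<bar>F k y - h y\<bar>}"
  have "infinite K"
    unfolding infinite_nat_iff_unbounded_le
  proof
    fix m
    obtain k where "k \<ge> max m N" "\<delta> \<le> \<bar>d k y\<bar>" using y(3) by blast
    then show "\<exists>n\<ge>m. n \<in> K" using y(1) by (auto simp: K_def d_def)
  qed
  define s where "s = enumerate K"
  have s: "strict_mono s" "s n \<in> K" for n
    using \<open>infinite K\<close> by (auto simp: s_def strict_mono_enumerate enumerate_in_set)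
  have small: "inverse (Suc (s n)) < \<delta> / 8" for n
  proof -
    have "inverse (real (Suc (s n))) \<le> inverse (Suc N)"
      using s(2)[of n] by (simp add: K_def)
    then show ?thesis using N by (rule le_less_trans)
  qed
  have "\<forall>n. \<exists>z. z \<in> S (s n) \<and> \<bar>h y - h z\<bar> < inverse (Suc (s n)) \<and>
      (\<forall>i\<le>s n. \<bar>F i y - F i z\<bar> < inverse (Suc (s n)))"
    using Q3[OF y(1)] by blast
  from choice[OF this] obtain z where z: "\<And>n. z n \<in> S (s n)" "\<And>n. \<bar>h y - h (z n)\<bar> < inverse (Suc (s n))"
    "\<And>n i. i \<le> s n \<Longrightarrow> \<bar>F i y - F i (z n)\<bar> < inverse (Suc (s n))"
    by blast
  have "order_property A (topspace Y)"
    unfolding order_property_def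
  proof (intro exI conjI strip)
    show "F (s n) \<in> A" "z n \<in> topspace Y" for n
      using FS z(1) by blast+
    show "0 < \<delta> / 2" using y by simp
    fix n m :: nat assume "n < m"
    then have lt: "s n < s m" using s(1) by (simp add: strict_mono_def)
    have "\<bar>F (s n) y - F (s n) (z m)\<bar> < \<delta> / 8"
      using z(3)[of "s n" m] small[of m] lt by simp
    moreover have "\<bar>F (s m) (z n) - h (z n)\<bar> < \<delta> / 8"
      using Q1[OF lt z(1)] small[of m] by simp
    moreover have "\<bar>h y - h (z n)\<bar> < \<delta> / 8"
      using z(2)[of n] small[of n] by simp
    moreover have "\<delta> \<le> \<bar>F (s n) y - h y\<bar>"
      using s(2)[of n] by (simp add: K_def)
    ultimately show "\<delta> / 2 \<le> \<bar>F (s n) (z m) - F (s m) (z n)\<bar>"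
      using y(2) by arith
  qed
  then show False using nop by simp
qed

section \<open>The two directions of Grothendieck's criterion\<close>

lemma topspace_C_weak_topology [simp]: "topspace (C_weak_topology Y) = C_space Y"
proof -
  have "(\<lambda>_. 0) \<in> C_dual Y" by (simp add: C_dual_def)
  then have "C_space Y \<in> {{f \<in> C_space Y. \<mu> f \<in> U} | \<mu> U. \<mu> \<in> C_dual Y \<and> open U}"
    by (auto intro!: exI[of _ "\<lambda>_. 0"] exI[of _ UNIV])
  then show ?thesis
    unfolding C_weak_topology_def topology_generated_by_topspace by blast
qed

lemma openin_C_weak_topology:
  "\<mu> \<in> C_dual Y \<Longrightarrow> open U \<Longrightarrow> openin (C_weak_topology Y) {f \<in> C_space Y. \<mu> f \<in> U}"
  unfolding C_weak_topology_def by (rule topology_generated_by_Basis) blast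

text \<open>With its weak topology, \<open>C_space Y\<close> sits in the product of lines indexed by
  the dual. There the closure of the bounded family is compact by Tychonoff's theorem. By
  \<open>continuous_limit_if_no_order_property\<close> and
  \<open>functional_limit_if_no_order_property\<close>, each point of this closure consists of the
  values of all functionals at one continuous function, so the closure stays inside
  \<open>C_space Y\<close>.\<close>

theorem relatively_weakly_compact_if_no_order_property:
  assumes A: "A \<subseteq> C_space Y" and Y: "compact_space Y" and nop: "\<not> order_property A (topspace Y)"
    and B: "\<And>f y. f \<in> A \<Longrightarrow> y \<in> topspace Y \<Longrightarrow> \<bar>f y\<bar> \<le> B"
  shows "compactin (C_weak_topology Y) (C_weak_topology Y closure_of A)"
proof -
  let ?P = "product_topology (\<lambda>_. euclideanreal) (C_dual Y)"
  define ev where "ev f = (\<lambda>\<mu>\<in>C_dual Y. \<mu> f)" for f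
  define K where "K = ?P closure_of (ev ` A)"
  \<comment> \<open>The only candidate for the function behind \<open>\<xi>\<close>: its value at
    \<open>y\<close> is the coordinate of \<open>\<xi>\<close> at the evaluation functional.\<close>
  define j where "j \<xi> = (\<lambda>y\<in>topspace Y. \<xi> (\<lambda>f. f y))" for \<xi> :: "(('a \<Rightarrow> real) \<Rightarrow> real) \<Rightarrow> real"
  have ev_top: "ev f \<in> topspace ?P" for f
    by (simp add: ev_def)
  have "\<exists>b. \<forall>f\<in>A. \<bar>\<mu> f\<bar> \<le> b" if \<mu>: "\<mu> \<in> C_dual Y" for \<mu>
  proof -
    obtain c where c: "0 < c"
      "\<And>f \<delta>. f \<in> C_space Y \<Longrightarrow> 0 < \<delta> \<Longrightarrow> (\<And>y. y \<in> topspace Y \<Longrightarrow> \<bar>f y\<bar> \<le> \<delta>) \<Longrightarrow> \<bar>\<mu> f\<bar> \<le> c * \<delta>"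
      using C_dual_bounded[OF Y \<mu>] by metis
    have "\<bar>\<mu> f\<bar> \<le> c * max B 1" if "f \<in> A" for f
      by (rule c(2)) (use that A B in \<open>auto simp: le_max_iff_disj\<close>)
    then show ?thesis by blast
  qed
  then obtain b where b: "\<And>\<mu> f. \<mu> \<in> C_dual Y \<Longrightarrow> f \<in> A \<Longrightarrow> \<bar>\<mu> f\<bar> \<le> b \<mu>"
    by metis
  have box: "compactin ?P (\<Pi>\<^sub>E \<mu>\<in>C_dual Y. {- b \<mu>..b \<mu>})"
    by (simp add: compactin_PiE)
  have "ev ` A \<subseteq> (\<Pi>\<^sub>E \<mu>\<in>C_dual Y. {- b \<mu>..b \<mu>})"
    using b by (force simp: ev_def abs_le_iff)
  moreover have "closedin ?P (\<Pi>\<^sub>E \<mu>\<in>C_dual Y. {- b \<mu>..b \<mu>})"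
    by (simp add: closedin_product_topology)
  ultimately have "K \<subseteq> (\<Pi>\<^sub>E \<mu>\<in>C_dual Y. {- b \<mu>..b \<mu>})"
    unfolding K_def by (rule closure_of_minimal)
  then have K: "compactin ?P K"
    by (rule closed_compactin[OF box]) (simp add: K_def)
  have approx: "\<exists>f\<in>A. \<forall>\<mu>\<in>M. \<bar>\<mu> f - \<xi> \<mu>\<bar> < \<delta>"
    if \<xi>: "\<xi> \<in> K" and M: "finite M" "M \<subseteq> C_dual Y" and \<delta>: "0 < \<delta>" for \<xi> M \<delta>
  proof -
    have "openin ?P {\<eta> \<in> topspace ?P. \<eta> \<mu> \<in> ball (\<xi> \<mu>) \<delta>}" if "\<mu> \<in> M" for \<mu>
      by (rule openin_continuous_map_preimage[OF continuous_map_product_projection]) (use that M in auto)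
    then have "openin ?P (topspace ?P \<inter> (\<Inter>\<mu>\<in>M. {\<eta> \<in> topspace ?P. \<eta> \<mu> \<in> ball (\<xi> \<mu>) \<delta>}))"
      using M(1) by (cases "M = {}") (auto intro!: openin_Int openin_INT2 simp del: topspace_product_topology)
    moreover have "\<xi> \<in> topspace ?P \<inter> (\<Inter>\<mu>\<in>M. {\<eta> \<in> topspace ?P. \<eta> \<mu> \<in> ball (\<xi> \<mu>) \<delta>})"
      using \<xi> \<delta> closure_of_subset_topspace[of ?P] unfolding K_def by auto
    ultimately obtain f where "f \<in> A" "ev f \<in> topspace ?P \<inter> (\<Inter>\<mu>\<in>M. {\<eta> \<in> topspace ?P. \<eta> \<mu> \<in> ball (\<xi> \<mu>) \<delta>})"
      using \<xi> unfolding K_def in_closure_of by blast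
    then show ?thesis
      using M(2) by (auto simp: ev_def dist_real_def abs_minus_commute subset_iff intro!: bexI[of _ f])
  qed
  have dual: "(\<lambda>f. f y) \<in> C_dual Y" if "y \<in> topspace Y" for y
    by (rule evaluation_in_C_dual[OF Y that])
  have jC: "j \<xi> \<in> C_space Y" and j\<mu>: "\<And>\<mu>. \<mu> \<in> C_dual Y \<Longrightarrow> \<mu> (j \<xi>) = \<xi> \<mu>" if \<xi>: "\<xi> \<in> K" for \<xi>
  proof -
    \<comment> \<open>The points of \<open>S\<close> enter as evaluation functionals, so one
      approximation in the product controls points and functionals alike.\<close>
    have lim: "\<exists>f\<in>A. (\<forall>y\<in>S. \<bar>f y - j \<xi> y\<bar> < \<delta>) \<and> (\<forall>\<mu>\<in>M. \<bar>\<mu> f - \<xi> \<mu>\<bar> < \<delta>)"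
      if "finite S" "S \<subseteq> topspace Y" "0 < \<delta>" "finite M" "M \<subseteq> C_dual Y" for S \<delta> M
    proof -
      have "\<exists>f\<in>A. \<forall>\<mu>\<in>(\<lambda>y f. f y) ` S \<union> M. \<bar>\<mu> f - \<xi> \<mu>\<bar> < \<delta>"
        by (rule approx[OF \<xi>]) (use that dual in auto)
      then show ?thesis using that(2) by (fastforce simp: j_def)
    qed
    have "continuous_map Y euclideanreal (j \<xi>)"
      by (rule continuous_limit_if_no_order_property[OF A Y nop]) (use lim[of _ _ "{}"] in auto)
    then show C: "j \<xi> \<in> C_space Y" using Y by (simp add: C_space_iff j_def)
    show "\<mu> (j \<xi>) = \<xi> \<mu>" if "\<mu> \<in> C_dual Y" for \<mu>
      by (rule functional_limit_if_no_order_property[where B = B and c = "\<xi> \<mu>", OF A Y nop _ that C, symmetric])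
        (use B lim[of _ _ "{\<mu>}"] that in auto)
  qed
  have j_ev: "j (ev f) = f" if "f \<in> C_space Y" for f
  proof -
    have "j (ev f) = restrict f (topspace Y)" using dual by (auto simp: j_def ev_def)
    then show ?thesis using C_space_restrict[OF that] by simp
  qed
  have "continuous_map (subtopology ?P K) (C_weak_topology Y) j"
    unfolding C_weak_topology_def
  proof (rule continuous_on_generated_topo)
    fix W assume "W \<in> {{f \<in> C_space Y. \<mu> f \<in> U} | \<mu> U. \<mu> \<in> C_dual Y \<and> open U}"
    then obtain \<mu> U where W: "W = {f \<in> C_space Y. \<mu> f \<in> U}" "\<mu> \<in> C_dual Y" "open U" by blast
    have "openin (subtopology ?P K) {\<xi> \<in> topspace (subtopology ?P K). \<xi> \<mu> \<in> U}"
      by (rule openin_continuous_map_preimage[OF continuous_map_from_subtopology[OF continuous_map_product_projection]])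
        (use W in auto)
    also have "{\<xi> \<in> topspace (subtopology ?P K). \<xi> \<mu> \<in> U} = j -` W \<inter> topspace (subtopology ?P K)"
      using jC j\<mu>[OF _ W(2)] unfolding W(1) by auto
    finally show "openin (subtopology ?P K) (j -` W \<inter> topspace (subtopology ?P K))" .
  next
    show "j ` topspace (subtopology ?P K) \<subseteq> \<Union> {{f \<in> C_space Y. \<mu> f \<in> U} | \<mu> U. \<mu> \<in> C_dual Y \<and> open U}"
      using jC topspace_C_weak_topology[of Y] unfolding C_weak_topology_def topology_generated_by_topspace by auto
  qed
  then have comp: "compactin (C_weak_topology Y) (j ` K)"
    using image_compactin[of "subtopology ?P K" K] K by (simp add: compactin_subtopology)
  have ev_cont: "continuous_map (C_weak_topology Y) ?P ev"
    unfolding continuous_map_componentwise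
  proof (intro conjI ballI)
    show "ev ` topspace (C_weak_topology Y) \<subseteq> extensional (C_dual Y)" by (auto simp: ev_def)
    fix \<mu> assume \<mu>: "\<mu> \<in> C_dual Y"
    show "continuous_map (C_weak_topology Y) euclideanreal (\<lambda>f. ev f \<mu>)"
      using \<mu> openin_C_weak_topology[OF \<mu>] by (simp add: continuous_map_def ev_def)
  qed
  have "C_weak_topology Y closure_of A \<subseteq> j ` K"
  proof
    fix f assume f: "f \<in> C_weak_topology Y closure_of A"
    then have "ev f \<in> K"
      using continuous_map_image_closure_subset[OF ev_cont, of A] unfolding K_def by blast
    moreover have "f \<in> C_space Y"
      using f closure_of_subset_topspace[of "C_weak_topology Y" A] by auto
    ultimately show "f \<in> j ` K" using j_ev by (metis imageI)
  qed
  then show ?thesis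
    by (rule closed_compactin[OF comp]) simp
qed

lemma compactin_cluster_point:
  assumes K: "compactin X K" and s: "\<And>n::nat. s n \<in> K"
  obtains x where "x \<in> K" "\<And>U n. openin X U \<Longrightarrow> x \<in> U \<Longrightarrow> \<exists>k\<ge>n. s k \<in> U"
proof -
  define D where "D n = X closure_of (s ` {n..})" for n
  have sub: "s ` {n..} \<subseteq> D n" for n
    using s K unfolding D_def by (intro closure_of_subset) (auto dest: compactin_subset_topspace)
  have "K \<inter> \<Inter> (range D) \<noteq> {}"
  proof (rule compactin_fip[THEN iffD1, OF K, THEN conjunct2, rule_format], intro conjI strip)
    show "closedin X C" if "C \<in> range D" for C using that by (auto simp: D_def)
  next
    fix \<F> assume "finite \<F> \<and> \<F> \<subseteq> range D"
    then obtain I where I: "finite I" "\<F> = D ` I" using finite_subset_image by metis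
    obtain N where "\<forall>i\<in>I. i \<le> N" using I finite_nat_set_iff_bounded_le by metis
    then have "s N \<in> \<Inter> \<F>" using sub unfolding I by auto
    then show "K \<inter> \<Inter> \<F> \<noteq> {}" using s by blast
  qed
  then obtain x where x: "x \<in> K" "\<And>n. x \<in> D n" by blast
  show thesis
  proof (rule that[OF x(1)])
    fix U n assume "openin X U" "x \<in> U"
    then show "\<exists>k\<ge>n. s k \<in> U" using x(2)[of n] unfolding D_def in_closure_of by auto
  qed
qed

text \<open>Let \<open>h\<close> be a weak cluster point of the functions and \<open>z\<close> a
  cluster point of the points. Choosing a point first and a later function after it brings
  \<open>h z\<close> near \<open>v\<close>; the opposite order brings it near
  \<open>u\<close>.\<close>

theorem no_order_property_if_relatively_weakly_compact:
  assumes A: "A \<subseteq> C_space Y" and Y: "compact_space Y"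
    and B: "\<And>f y. f \<in> A \<Longrightarrow> y \<in> topspace Y \<Longrightarrow> \<bar>f y\<bar> \<le> B"
    and comp: "compactin (C_weak_topology Y) (C_weak_topology Y closure_of A)"
  shows "\<not> order_property A (topspace Y)"
proof
  assume "order_property A (topspace Y)"
  then obtain F y u v and \<epsilon> :: real where F: "\<And>n::nat. F n \<in> A" "\<And>n::nat. y n \<in> topspace Y" "0 < \<epsilon>" "3 * \<epsilon> \<le> \<bar>u - v\<bar>"
    "\<And>n m. n < m \<Longrightarrow> \<bar>F n (y m) - u\<bar> \<le> \<epsilon>" "\<And>n m. m < n \<Longrightarrow> \<bar>F n (y m) - v\<bar> \<le> \<epsilon>"
    using order_property_separated[of A "topspace Y" B] B by metis
  have "F n \<in> C_weak_topology Y closure_of A" for n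
    using closure_of_subset[of A "C_weak_topology Y"] A F(1) by auto
  then obtain h where h: "h \<in> C_weak_topology Y closure_of A"
    "\<And>U n. openin (C_weak_topology Y) U \<Longrightarrow> h \<in> U \<Longrightarrow> \<exists>k\<ge>n. F k \<in> U"
    using compactin_cluster_point[OF comp, of F] by blast
  have hC: "h \<in> C_space Y"
    using h(1) closure_of_subset_topspace[of "C_weak_topology Y" A] by auto
  obtain z where z: "z \<in> topspace Y" "\<And>U n. openin Y U \<Longrightarrow> z \<in> U \<Longrightarrow> \<exists>k\<ge>n. y k \<in> U"
    using compactin_cluster_point[of Y "topspace Y" y, OF Y[unfolded compact_space_def] F(2)] by blast
  have hlim: "\<exists>k\<ge>n. \<bar>F k x - h x\<bar> < \<delta>" if "x \<in> topspace Y" "0 < \<delta>" for n x \<delta>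
  proof -
    have "\<exists>k\<ge>n. F k \<in> {f \<in> C_space Y. f x \<in> ball (h x) \<delta>}"
      using openin_C_weak_topology[OF evaluation_in_C_dual[OF Y that(1)], of "ball (h x) \<delta>"] hC that
      by (intro h(2)) auto
    then show ?thesis by (auto simp: dist_real_def abs_minus_commute)
  qed
  have zlim: "\<exists>k\<ge>n. \<bar>f (y k) - f z\<bar> < \<delta>" if f: "f \<in> C_space Y" and \<delta>: "0 < \<delta>" for n f \<delta>
  proof -
    have "continuous_map Y euclideanreal f" using f Y by (simp add: C_space_iff)
    then obtain U where "openin Y U" "z \<in> U" "\<forall>y\<in>U. \<bar>f y - f z\<bar> < \<delta>"
      using z(1) \<delta> unfolding continuous_map_euclideanreal_iff by blast
    then show ?thesis using z(2) by blast
  qed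
  \<comment> \<open>Each estimate costs less than \<open>\<epsilon> + 2 * \<delta>\<close>; with
    this \<open>\<delta>\<close> the two costs add up to \<open>3 * \<epsilon>\<close>.\<close>
  define \<delta> where "\<delta> = \<epsilon> / 4"
  have \<delta>: "0 < \<delta>" using F by (simp add: \<delta>_def)
  obtain m where m: "\<bar>h (y m) - h z\<bar> < \<delta>" using zlim[OF hC \<delta>] by blast
  obtain n where "n \<ge> Suc m" "\<bar>F n (y m) - h (y m)\<bar> < \<delta>" using hlim[OF F(2) \<delta>] by blast
  then have v: "\<bar>h z - v\<bar> < \<epsilon> + 2 * \<delta>" using F(6)[of m n] m by simp
  obtain n' where n': "\<bar>F n' z - h z\<bar> < \<delta>" using hlim[OF z(1) \<delta>] by blast
  have "F n' \<in> C_space Y" using F(1) A by blast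
  then obtain m' where "m' \<ge> Suc n'" "\<bar>F n' (y m') - F n' z\<bar> < \<delta>" using zlim[OF _ \<delta>] by blast
  then have "\<bar>h z - u\<bar> < \<epsilon> + 2 * \<delta>" using F(5)[of n' m'] n' by simp
  then show False using v F(4) unfolding \<delta>_def by linarith
qed

section \<open>Stable functions on flows\<close>

definition stable_function ::
  "('g, 'm) monoid_scheme \<Rightarrow> 'y topology \<Rightarrow> ('g \<Rightarrow> 'y \<Rightarrow> 'y) \<Rightarrow> ('y \<Rightarrow> real) \<Rightarrow> bool" where
  "stable_function G Y act f \<longleftrightarrow> continuous_map Y euclideanreal f \<and>
     \<not> order_property ((\<lambda>g y. f (act g y)) ` carrier G) (topspace Y)"

lemma order_property_orbit_iff:
  "order_property ((\<lambda>g y. f (act g y)) ` carrier G) S \<longleftrightarrow>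
     (\<exists>g y \<epsilon>. (\<forall>n::nat. g n \<in> carrier G) \<and> (\<forall>n. y n \<in> S) \<and> 0 < \<epsilon> \<and>
       (\<forall>n m. n < m \<longrightarrow> \<epsilon> \<le> \<bar>f (act (g n) (y m)) - f (act (g m) (y n))\<bar>))" (is "?L \<longleftrightarrow> ?R")
proof
  assume ?L
  then obtain F y \<epsilon> where F: "\<And>n::nat. F n \<in> (\<lambda>g y. f (act g y)) ` carrier G" "\<And>n. y n \<in> S" "0 < \<epsilon>"
    "\<And>n m. n < m \<Longrightarrow> \<epsilon> \<le> \<bar>F n (y m) - F m (y n)\<bar>"
    unfolding order_property_def by blast
  have "\<forall>n. \<exists>g. g \<in> carrier G \<and> F n = (\<lambda>y. f (act g y))" using F(1) by blast
  from choice[OF this] obtain g where g: "\<And>n. g n \<in> carrier G" "\<And>n. F n = (\<lambda>y. f (act (g n) y))"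
    by blast
  show ?R
    by (intro exI[of _ g] exI[of _ y] exI[of _ \<epsilon>]) (use F g in simp)
next
  assume ?R
  then obtain g y \<epsilon> where "\<And>n::nat. g n \<in> carrier G" "\<And>n. y n \<in> S" "0 < \<epsilon>"
    "\<And>n m. n < m \<Longrightarrow> \<epsilon> \<le> \<bar>f (act (g n) (y m)) - f (act (g m) (y n))\<bar>" by blast
  then show ?L
    unfolding order_property_def
    by (intro exI[of _ "\<lambda>n y. f (act (g n) y)"] exI[of _ y] exI[of _ \<epsilon>]) simp
qed

lemma order_property_mono:
  assumes "order_property A S" "\<And>f. f \<in> A \<Longrightarrow> \<exists>f'\<in>A'. \<forall>y\<in>S. f y = f' y"
  shows "order_property A' S"
proof -
  obtain F y \<epsilon> where F: "\<And>n::nat. F n \<in> A" "\<And>n. y n \<in> S" "0 < \<epsilon>"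
    "\<And>n m. n < m \<Longrightarrow> \<epsilon> \<le> \<bar>F n (y m) - F m (y n)\<bar>"
    using assms(1) unfolding order_property_def by blast
  have "\<forall>n. \<exists>f'. f' \<in> A' \<and> (\<forall>y\<in>S. F n y = f' y)" using assms(2)[OF F(1)] by blast
  from choice[OF this] obtain F' where "\<And>n. F' n \<in> A'" "\<And>n y. y \<in> S \<Longrightarrow> F n y = F' n y" by blast
  then show ?thesis
    unfolding order_property_def using F
    by (intro exI[of _ F'] exI[of _ y] exI[of _ \<epsilon>]) simp
qed

lemma is_flowD:
  assumes "is_flow G \<tau> Y act"
  shows "group G" "topspace \<tau> = carrier G" "compact_space Y"
    "\<And>y. y \<in> topspace Y \<Longrightarrow> act \<one>\<^bsub>G\<^esub> y = y"
    "\<And>g h y. g \<in> carrier G \<Longrightarrow> h \<in> carrier G \<Longrightarrow> y \<in> topspace Y \<Longrightarrow> act (g \<otimes>\<^bsub>G\<^esub> h) y = act g (act h y)"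
    "\<And>g. g \<in> carrier G \<Longrightarrow> continuous_map Y Y (act g)"
    "\<And>g y. g \<in> carrier G \<Longrightarrow> y \<in> topspace Y \<Longrightarrow> act g y \<in> topspace Y"
proof -
  show top: "topspace \<tau> = carrier G"
    using assms unfolding is_flow_def topological_group_def by blast
  show cont: "continuous_map Y Y (act g)" if "g \<in> carrier G" for g
  proof -
    have "continuous_map Y (prod_topology \<tau> Y) (\<lambda>y. (g, y))"
      using that top by (simp add: continuous_map_pairedI)
    moreover have "continuous_map (prod_topology \<tau> Y) Y (\<lambda>(g, y). act g y)"
      using assms unfolding is_flow_def by blast
    ultimately show ?thesis
      using continuous_map_compose[of Y "prod_topology \<tau> Y" "\<lambda>y. (g, y)" Y "\<lambda>(g, y). act g y"]
      by (simp add: comp_def)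
  qed
  show "act g y \<in> topspace Y" if "g \<in> carrier G" "y \<in> topspace Y" for g y
    using continuous_map_image_subset_topspace[OF cont[OF that(1)]] that(2) by blast
qed (use assms in \<open>simp_all add: is_flow_def topological_group_def\<close>)

text \<open>\<open>C_action\<close> translates by inverses and cuts off outside the space; taken
  over the whole group, both families of functions have the same values on the space.\<close>

lemma wap_function_iff_stable_function:
  assumes flow: "is_flow G \<tau> Y act" and f: "f \<in> C_space Y"
  shows "wap_function G Y act f \<longleftrightarrow> stable_function G Y act f"
proof -
  note fl = is_flowD[OF flow]
  define A where "A = (\<lambda>g. C_action G Y act g f) ` carrier G"
  let ?O = "(\<lambda>g y. f (act g y)) ` carrier G"
  have fc: "continuous_map Y euclideanreal f" using f fl(3) by (simp add: C_space_iff)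
  obtain B where B: "\<And>y. y \<in> topspace Y \<Longrightarrow> \<bar>f y\<bar> \<le> B"
    using continuous_map_bounded[OF fl(3) fc] by metis
  have inv: "inv\<^bsub>G\<^esub> g \<in> carrier G" "inv\<^bsub>G\<^esub> (inv\<^bsub>G\<^esub> g) = g" if "g \<in> carrier G" for g
    using fl(1) that by (simp_all add: group.inv_closed group.inv_inv)
  have A: "A \<subseteq> C_space Y"
  proof
    fix h assume "h \<in> A"
    then obtain g where g: "g \<in> carrier G" "h = (\<lambda>y\<in>topspace Y. f (act (inv\<^bsub>G\<^esub> g) y))"
      by (auto simp: A_def C_action_def)
    have "continuous_map Y euclideanreal (\<lambda>y. f (act (inv\<^bsub>G\<^esub> g) y))"
      using continuous_map_compose[OF fl(6)[OF inv(1)[OF g(1)]] fc] by (simp add: comp_def)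
    then show "h \<in> C_space Y" unfolding g(2) by (rule restrict_in_C_space[OF fl(3)])
  qed
  have AB: "\<bar>h y\<bar> \<le> B" if "h \<in> A" "y \<in> topspace Y" for h y
    using that B fl(7) inv by (auto simp: A_def C_action_def)
  have "order_property A (topspace Y) \<longleftrightarrow> order_property ?O (topspace Y)"
  proof
    assume "order_property A (topspace Y)"
    then show "order_property ?O (topspace Y)"
    proof (rule order_property_mono)
      fix h assume "h \<in> A"
      then obtain g where g: "g \<in> carrier G" "h = (\<lambda>y\<in>topspace Y. f (act (inv\<^bsub>G\<^esub> g) y))"
        by (auto simp: A_def C_action_def)
      then show "\<exists>f'\<in>?O. \<forall>y\<in>topspace Y. h y = f' y"
        using inv(1)[OF g(1)] by auto
    qed
  next
    assume "order_property ?O (topspace Y)"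
    then show "order_property A (topspace Y)"
    proof (rule order_property_mono)
      fix h assume "h \<in> ?O"
      then obtain g where g: "g \<in> carrier G" "h = (\<lambda>y. f (act g y))" by blast
      have "C_action G Y act (inv\<^bsub>G\<^esub> g) f \<in> A" using inv(1)[OF g(1)] by (simp add: A_def)
      moreover have "\<forall>y\<in>topspace Y. h y = C_action G Y act (inv\<^bsub>G\<^esub> g) f y"
        using inv(2)[OF g(1)] g(2) by (simp add: C_action_def)
      ultimately show "\<exists>f'\<in>A. \<forall>y\<in>topspace Y. h y = f' y" by blast
    qed
  qed
  moreover have "wap_function G Y act f \<longleftrightarrow> \<not> order_property A (topspace Y)"
    unfolding wap_function_def A_def[symmetric]
    using relatively_weakly_compact_if_no_order_property[where B = B, OF A fl(3)]
      no_order_property_if_relatively_weakly_compact[where B = B, OF A fl(3)] AB by metis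
  ultimately show ?thesis using fc by (simp add: stable_function_def)
qed

section \<open>Quotient flows\<close>

lemma topspace_quotient_topology:
  assumes "equiv (topspace Y) E"
  shows "topspace (quotient_topology Y E) = topspace Y // E"
proof -
  have "\<Union> (topspace Y // E) = topspace Y" by (rule Union_quotient[OF assms])
  then have "openin (quotient_topology Y E) (topspace Y // E)"
    by (simp add: openin_quotient_topology[OF assms])
  then show ?thesis
    using openin_quotient_topology[OF assms, of "topspace (quotient_topology Y E)"] openin_subset
    by blast
qed

lemma quotient_map_quotient_topology:
  assumes E: "equiv (topspace Y) E"
  shows "quotient_map Y (quotient_topology Y E) (\<lambda>y. E `` {y})"
  unfolding quotient_map_def
proof (intro conjI strip)
  show "(\<lambda>y. E `` {y}) ` topspace Y = topspace (quotient_topology Y E)"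
    unfolding topspace_quotient_topology[OF E] quotient_def by auto
  fix U assume U: "U \<subseteq> topspace (quotient_topology Y E)"
  then have sub: "U \<subseteq> topspace Y // E" by (simp add: topspace_quotient_topology[OF E])
  have "{y \<in> topspace Y. E `` {y} \<in> U} = \<Union> U"
  proof (intro equalityI subsetI)
    fix y assume "y \<in> {y \<in> topspace Y. E `` {y} \<in> U}"
    then show "y \<in> \<Union> U" using equiv_class_self[OF E, of y] by blast
  next
    fix y assume "y \<in> \<Union> U"
    then obtain c where c: "c \<in> U" "y \<in> c" by blast
    then obtain x where x: "c = E `` {x}" "x \<in> topspace Y" using sub by (auto simp: quotient_def)
    then have "(x, y) \<in> E" using c by blast
    then have "E `` {y} = c" "y \<in> topspace Y"
      using equiv_class_eq[OF E] x E by (auto simp: equiv_def)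
    then show "y \<in> {y \<in> topspace Y. E `` {y} \<in> U}" using c by simp
  qed
  then show "openin Y {x \<in> topspace Y. E `` {x} \<in> U} = openin (quotient_topology Y E) U"
    by (simp add: openin_quotient_topology[OF E] sub)
qed

text \<open>Invariance under \<open>g\<close> gives one inclusion, invariance under its inverse the
  other, so that the image of a class is a whole class.\<close>

lemma action_image_class:
  assumes flow: "is_flow G \<tau> Y act" and E: "closed_invariant_equiv G Y act E"
    and g: "g \<in> carrier G" and y: "y \<in> topspace Y"
  shows "act g ` (E `` {y}) = E `` {act g y}"
proof -
  note fl = is_flowD[OF flow]
  have inv: "(act h a, act h b) \<in> E" if "h \<in> carrier G" "(a, b) \<in> E" for h a b
    using E that unfolding closed_invariant_equiv_def by blast
  have sub: "E \<subseteq> topspace Y \<times> topspace Y"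
    using E unfolding closed_invariant_equiv_def equiv_def by blast
  let ?g' = "inv\<^bsub>G\<^esub> g"
  have g': "?g' \<in> carrier G" using fl(1) g by (simp add: group.inv_closed)
  show ?thesis
  proof (intro equalityI subsetI)
    fix z assume "z \<in> act g ` (E `` {y})"
    then show "z \<in> E `` {act g y}" using inv[OF g] by blast
  next
    fix z assume z: "z \<in> E `` {act g y}"
    then have zY: "z \<in> topspace Y" using sub by blast
    have "(act ?g' (act g y), act ?g' z) \<in> E" using inv[OF g'] z by blast
    moreover have "act ?g' (act g y) = y"
      using fl(5)[OF g' g y] fl(4)[OF y] fl(1) g by (simp add: group.l_inv)
    ultimately have "act ?g' z \<in> E `` {y}" by simp
    moreover have "act g (act ?g' z) = z"
      using fl(5)[OF g g' zY] fl(4)[OF zY] fl(1) g by (simp add: group.r_inv)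
    ultimately show "z \<in> act g ` (E `` {y})" by (metis imageI)
  qed
qed

text \<open>Continuity is the universal property of the quotient map; for the order property,
  representatives are chosen for the points of the quotient.\<close>

lemma stable_function_quotient_iff:
  assumes flow: "is_flow G \<tau> Y act" and E: "closed_invariant_equiv G Y act E"
  shows "stable_function G (quotient_topology Y E) (\<lambda>g c. act g ` c) f \<longleftrightarrow>
    stable_function G Y act (\<lambda>y. f (E `` {y}))"
proof -
  have eq: "equiv (topspace Y) E" using E unfolding closed_invariant_equiv_def by blast
  note qm = quotient_map_quotient_topology[OF eq]
  note cls = action_image_class[OF flow E]
  have cont: "continuous_map (quotient_topology Y E) euclideanreal f \<longleftrightarrow>
      continuous_map Y euclideanreal (\<lambda>y. f (E `` {y}))"
    using continuous_compose_quotient_map_eq[OF qm, of euclideanreal f] by (simp add: comp_def)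
  have surj: "topspace (quotient_topology Y E) = (\<lambda>y. E `` {y}) ` topspace Y"
    using quotient_imp_surjective_map[OF qm] by simp
  have "order_property ((\<lambda>g c. f (act g ` c)) ` carrier G) (topspace (quotient_topology Y E)) \<longleftrightarrow>
      order_property ((\<lambda>g y. f (E `` {act g y})) ` carrier G) (topspace Y)" (is "?L \<longleftrightarrow> ?R")
  proof
    assume ?L
    then obtain g y \<epsilon> where *: "\<And>n::nat. g n \<in> carrier G" "\<And>n. y n \<in> topspace (quotient_topology Y E)" "0 < \<epsilon>"
      "\<And>n m. n < m \<Longrightarrow> \<epsilon> \<le> \<bar>f (act (g n) ` y m) - f (act (g m) ` y n)\<bar>"
      unfolding order_property_orbit_iff[of f "\<lambda>g c. act g ` c"] by blast
    have "\<forall>n. \<exists>x. x \<in> topspace Y \<and> y n = E `` {x}" using *(2) unfolding surj by blast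
    from choice[OF this] obtain x where x: "\<And>n. x n \<in> topspace Y" "\<And>n. y n = E `` {x n}" by blast
    show ?R
      unfolding order_property_orbit_iff[of "\<lambda>y. f (E `` {y})" act]
      by (intro exI[of _ g] exI[of _ x] exI[of _ \<epsilon>]) (use * x cls in simp)
  next
    assume ?R
    then obtain g y \<epsilon> where *: "\<And>n::nat. g n \<in> carrier G" "\<And>n. y n \<in> topspace Y" "0 < \<epsilon>"
      "\<And>n m. n < m \<Longrightarrow> \<epsilon> \<le> \<bar>f (E `` {act (g n) (y m)}) - f (E `` {act (g m) (y n)})\<bar>"
      unfolding order_property_orbit_iff[of "\<lambda>y. f (E `` {y})" act] by blast
    show ?L
      unfolding order_property_orbit_iff[of f "\<lambda>g c. act g ` c"]
      by (intro exI[of _ g] exI[of _ "\<lambda>n. E `` {y n}"] exI[of _ \<epsilon>]) (use * cls surj in simp)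
  qed
  then show ?thesis unfolding stable_function_def cont by simp
qed

section \<open>The relation of being inseparable by stable functions\<close>

definition stable_equiv :: "('g, 'm) monoid_scheme \<Rightarrow> 'y topology \<Rightarrow> ('g \<Rightarrow> 'y \<Rightarrow> 'y) \<Rightarrow> 'y rel" where
  "stable_equiv G Y act = {(p, q). p \<in> topspace Y \<and> q \<in> topspace Y \<and>
     (\<forall>f. stable_function G Y act f \<longrightarrow> f p = f q)}"

lemma continuous_map_difference:
  fixes f :: "'y \<Rightarrow> real"
  assumes "continuous_map Y euclideanreal f"
  shows "continuous_map (prod_topology Y Y) euclideanreal (\<lambda>x. f (fst x) - f (snd x))"
proof -
  have "continuous_map (prod_topology Y Y) euclideanreal (f \<circ> fst)"
    "continuous_map (prod_topology Y Y) euclideanreal (f \<circ> snd)"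
    using continuous_map_compose[OF continuous_map_fst assms] continuous_map_compose[OF continuous_map_snd assms]
    by auto
  then show ?thesis
    by (intro continuous_map_diff) (simp_all add: comp_def)
qed

lemma closedin_stable_equiv: "closedin (prod_topology Y Y) (stable_equiv G Y act)"
proof -
  have "closedin (prod_topology Y Y) {x \<in> topspace (prod_topology Y Y). f (fst x) - f (snd x) \<in> {0}}"
    if "stable_function G Y act f" for f
  proof (rule closedin_continuous_map_preimage)
    show "continuous_map (prod_topology Y Y) euclideanreal (\<lambda>x. f (fst x) - f (snd x))"
      using that by (intro continuous_map_difference) (simp add: stable_function_def)
  qed simp
  note closed = this
  have eq: "stable_equiv G Y act = \<Inter> (insert (topspace (prod_topology Y Y))
     ((\<lambda>f. {x \<in> topspace (prod_topology Y Y). f (fst x) - f (snd x) \<in> {0}}) ` {f. stable_function G Y act f}))"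
    by (auto simp: stable_equiv_def)
  show ?thesis
    unfolding eq by (rule closedin_Inter) (use closed closedin_topspace[of "prod_topology Y Y"] in auto)
qed

text \<open>The factor \<open>g\<close> is absorbed into the group element, so the orbit of the
  translate is contained in the orbit of \<open>f\<close>.\<close>

lemma stable_function_translate:
  assumes flow: "is_flow G \<tau> Y act" and f: "stable_function G Y act f" and g: "g \<in> carrier G"
  shows "stable_function G Y act (\<lambda>y. f (act g y))"
  unfolding stable_function_def
proof
  note fl = is_flowD[OF flow]
  show "continuous_map Y euclideanreal (\<lambda>y. f (act g y))"
    using continuous_map_compose[OF fl(6)[OF g], of euclideanreal f] f
    by (simp add: stable_function_def comp_def)
  show "\<not> order_property ((\<lambda>h y. f (act g (act h y))) ` carrier G) (topspace Y)"
  proof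
    assume "order_property ((\<lambda>h y. f (act g (act h y))) ` carrier G) (topspace Y)"
    then have "order_property ((\<lambda>h y. f (act h y)) ` carrier G) (topspace Y)"
    proof (rule order_property_mono)
      fix F assume "F \<in> (\<lambda>h y. f (act g (act h y))) ` carrier G"
      then obtain h where h: "h \<in> carrier G" "F = (\<lambda>y. f (act g (act h y)))" by blast
      have "g \<otimes>\<^bsub>G\<^esub> h \<in> carrier G"
        using fl(1) g h(1) by (simp add: group.is_monoid monoid.m_closed)
      moreover have "\<forall>y\<in>topspace Y. F y = f (act (g \<otimes>\<^bsub>G\<^esub> h) y)"
        using fl(5)[OF g h(1)] h(2) by simp
      ultimately show "\<exists>f'\<in>(\<lambda>h y. f (act h y)) ` carrier G. \<forall>y\<in>topspace Y. F y = f' y"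
        by (intro bexI[of _ "\<lambda>y. f (act (g \<otimes>\<^bsub>G\<^esub> h) y)"]) auto
    qed
    then show False using f by (simp add: stable_function_def)
  qed
qed

lemma closed_invariant_equiv_stable_equiv:
  assumes flow: "is_flow G \<tau> Y act"
  shows "closed_invariant_equiv G Y act (stable_equiv G Y act)"
  unfolding closed_invariant_equiv_def
proof (intro conjI ballI)
  show "equiv (topspace Y) (stable_equiv G Y act)"
    by (auto simp: stable_equiv_def intro!: equivI refl_onI symI transI)
  show "closedin (prod_topology Y Y) (stable_equiv G Y act)" by (rule closedin_stable_equiv)
  fix g x assume g: "g \<in> carrier G" and "x \<in> stable_equiv G Y act"
  then show "case x of (a, b) \<Rightarrow> (act g a, act g b) \<in> stable_equiv G Y act"
    using is_flowD(7)[OF flow g] stable_function_translate[OF flow _ g]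
    by (auto simp: stable_equiv_def)
qed

text \<open>By compactness, an invariant continuous function is controlled by finitely many stable ones;
  Ramsey's theorem then transfers a failure of stability to one of these.\<close>

lemma stable_function_if_stable_equiv_invariant:
  assumes flow: "is_flow G \<tau> Y act" and h: "continuous_map Y euclideanreal h"
    and inv: "\<And>p q. (p, q) \<in> stable_equiv G Y act \<Longrightarrow> h p = h q"
  shows "stable_function G Y act h"
proof (rule ccontr)
  note fl = is_flowD[OF flow]
  assume "\<not> ?thesis"
  then obtain g y \<epsilon> where *: "\<And>n::nat. g n \<in> carrier G" "\<And>n. y n \<in> topspace Y" "0 < \<epsilon>"
    and gap: "\<And>n m. n < m \<Longrightarrow> \<epsilon> \<le> \<bar>h (act (g n) (y m)) - h (act (g m) (y n))\<bar>"
    using h unfolding stable_function_def order_property_orbit_iff by blast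
  let ?YY = "prod_topology Y Y"
  note diff = continuous_map_difference
  define D where "D = {x \<in> topspace ?YY. \<epsilon> \<le> \<bar>h (fst x) - h (snd x)\<bar>}"
  \<comment> \<open>Pairs that a stable \<open>f\<close> separates by more than
    \<open>1 / (k + 1)\<close>. These open sets cover the compact set \<open>D\<close>, and the
    members of a finite subcover become the colours of the pairs \<open>n < m\<close>.\<close>
  define U where "U = (\<lambda>(f, k). {x \<in> topspace ?YY. inverse (Suc k) < \<bar>f (fst x) - f (snd x)\<bar>})"
  define J where "J = {f. stable_function G Y act f} \<times> (UNIV :: nat set)"
  have "closedin ?YY {x \<in> topspace ?YY. (\<lambda>x. \<bar>h (fst x) - h (snd x)\<bar>) x \<in> {\<epsilon>..}}"
  proof (rule closedin_continuous_map_preimage)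
    show "continuous_map ?YY euclideanreal (\<lambda>x. \<bar>h (fst x) - h (snd x)\<bar>)"
      by (intro continuous_map_real_abs diff h)
  qed simp
  then have "closedin ?YY D" by (simp add: D_def)
  moreover have "compact_space ?YY" using fl(3) by (simp add: compact_space_prod_topology)
  ultimately have D: "compactin ?YY D" by (simp add: closedin_compact_space)
  have op: "openin ?YY (U j)" if jJ: "j \<in> J" for j
  proof -
    obtain f k where j: "j = (f, k)" "stable_function G Y act f" using jJ unfolding J_def by blast
    have "openin ?YY {x \<in> topspace ?YY. (\<lambda>x. \<bar>f (fst x) - f (snd x)\<bar>) x \<in> {inverse (Suc k)<..}}"
    proof (rule openin_continuous_map_preimage)
      show "continuous_map ?YY euclideanreal (\<lambda>x. \<bar>f (fst x) - f (snd x)\<bar>)"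
        using j(2) by (intro continuous_map_real_abs diff) (simp add: stable_function_def)
    qed simp
    then show ?thesis by (simp add: U_def j)
  qed
  have "D \<subseteq> \<Union> (U ` J)"
  proof
    fix x assume x: "x \<in> D"
    then have "h (fst x) \<noteq> h (snd x)" using *(3) by (auto simp: D_def)
    then have "(fst x, snd x) \<notin> stable_equiv G Y act" using inv by blast
    then obtain f where f: "stable_function G Y act f" "f (fst x) \<noteq> f (snd x)"
    proof -
      have "fst x \<in> topspace Y" "snd x \<in> topspace Y" using x by (auto simp: D_def)
      then show thesis
        using that \<open>(fst x, snd x) \<notin> stable_equiv G Y act\<close> unfolding stable_equiv_def by blast
    qed
    then obtain k where "inverse (Suc k) < \<bar>f (fst x) - f (snd x)\<bar>"
      using reals_Archimedean[of "\<bar>f (fst x) - f (snd x)\<bar>"] by auto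
    then have "x \<in> U (f, k)" "(f, k) \<in> J" using x f by (auto simp: U_def J_def D_def)
    then show "x \<in> \<Union> (U ` J)" by blast
  qed
  then obtain J' where J': "finite J'" "J' \<subseteq> J" "D \<subseteq> \<Union> (U ` J')"
    using compactinD[OF D, of "U ` J"] op finite_subset_image[of _ U J] by (metis imageE)
  have "\<exists>j\<in>J'. (act (g n) (y m), act (g m) (y n)) \<in> U j" if "n < m" for n m
  proof -
    have "(act (g n) (y m), act (g m) (y n)) \<in> D"
      using gap[OF that] fl(7) * by (simp add: D_def)
    then show ?thesis using J'(3) by blast
  qed
  then obtain c where c: "\<And>n m. n < m \<Longrightarrow> c n m \<in> J' \<and> (act (g n) (y m), act (g m) (y n)) \<in> U (c n m)"
    by metis
  obtain s :: "nat \<Rightarrow> nat" and j where s: "strict_mono s" "j \<in> J'" "\<And>n m. n < m \<Longrightarrow> c (s n) (s m) = j"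
    using Ramsey_pairs[of J' c] J'(1) c by metis
  obtain f k where j: "j = (f, k)" "stable_function G Y act f" using s(2) J'(2) unfolding J_def by blast
  have "inverse (Suc k) \<le> \<bar>f (act (g (s n)) (y (s m))) - f (act (g (s m)) (y (s n)))\<bar>" if "n < m" for n m
  proof -
    have "s n < s m" using s(1) that by (simp add: strict_mono_def)
    then have "(act (g (s n)) (y (s m)), act (g (s m)) (y (s n))) \<in> U (f, k)"
      using c[of "s n" "s m"] s(3)[OF that] j(1) by simp
    then show ?thesis by (simp add: U_def)
  qed
  then have "order_property ((\<lambda>g y. f (act g y)) ` carrier G) (topspace Y)"
    unfolding order_property_orbit_iff
    by (intro exI[of _ "g \<circ> s"] exI[of _ "y \<circ> s"] exI[of _ "inverse (Suc k)"]) (use * in simp)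
  then show False using j(2) by (simp add: stable_function_def)
qed

text \<open>Stable functions descend to the quotient and separate its points, hence it is Hausdorff.
  Joint continuity of the action is delicate, because the product of a quotient map with an identity
  need not be a quotient map. Here the projection is proper, as a continuous map from a compact to a
  Hausdorff space, and properness survives the product.\<close>

lemma is_flow_quotient_stable_equiv:
  assumes flow: "is_flow G \<tau> Y act"
  defines "E \<equiv> stable_equiv G Y act"
  shows "is_flow G \<tau> (quotient_topology Y E) (\<lambda>g c. act g ` c)"
proof -
  note fl = is_flowD[OF flow]
  let ?Z = "quotient_topology Y E"
  let ?q = "\<lambda>y. E `` {y}"
  have E: "closed_invariant_equiv G Y act E"
    unfolding E_def by (rule closed_invariant_equiv_stable_equiv[OF flow])
  then have eq: "equiv (topspace Y) E" unfolding closed_invariant_equiv_def by blast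
  note qm = quotient_map_quotient_topology[OF eq]
  have qc: "continuous_map Y ?Z ?q" by (rule quotient_imp_continuous_map[OF qm])
  have surj: "topspace ?Z = ?q ` topspace Y"
    using quotient_imp_surjective_map[OF qm] by simp
  have comp: "compact_space ?Z"
    unfolding compact_space_def surj
    using image_compactin[OF _ qc] fl(3) unfolding compact_space_def by blast
  have haus: "Hausdorff_space ?Z"
    unfolding Hausdorff_space_def
  proof (intro allI impI)
    fix c d assume cd: "c \<in> topspace ?Z \<and> d \<in> topspace ?Z \<and> c \<noteq> d"
    then obtain p q where pq: "p \<in> topspace Y" "c = ?q p" "q \<in> topspace Y" "d = ?q q"
      unfolding surj by blast
    then have "(p, q) \<notin> E" using cd equiv_class_eq[OF eq] by blast
    then obtain f where f: "stable_function G Y act f" "f p \<noteq> f q"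
      using pq unfolding E_def stable_equiv_def by blast
    define f' where "f' c = f (SOME y. y \<in> c)" for c
    have f'q: "f' (?q y) = f y" if "y \<in> topspace Y" for y
    proof -
      have "y \<in> ?q y" using equiv_class_self[OF eq that] .
      then have "(SOME x. x \<in> ?q y) \<in> ?q y" by (rule someI)
      then have "(y, SOME x. x \<in> ?q y) \<in> E" by blast
      then have "f y = f (SOME x. x \<in> ?q y)"
        using f(1) unfolding E_def stable_equiv_def by blast
      then show ?thesis by (simp add: f'_def)
    qed
    have "continuous_map Y euclideanreal (f' \<circ> ?q)"
      using f(1) f'q by (auto simp: stable_function_def intro: continuous_map_eq[where f = f])
    then have f'c: "continuous_map ?Z euclideanreal f'"
      by (rule continuous_compose_quotient_map[OF qm])
    have "f' c \<noteq> f' d" using f(2) f'q pq by simp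
    then obtain A B where AB: "open A" "open B" "f' c \<in> A" "f' d \<in> B" "A \<inter> B = {}"
      using hausdorff by metis
    show "\<exists>U V. openin ?Z U \<and> openin ?Z V \<and> c \<in> U \<and> d \<in> V \<and> disjnt U V"
      by (intro exI[of _ "{z \<in> topspace ?Z. f' z \<in> A}"] exI[of _ "{z \<in> topspace ?Z. f' z \<in> B}"])
        (use AB cd openin_continuous_map_preimage[OF f'c] in \<open>auto simp: disjnt_def\<close>)
  qed
  have act_q: "act g ` ?q y = ?q (act g y)" if "g \<in> carrier G" "y \<in> topspace Y" for g y
    by (rule action_image_class[OF flow E that])
  have cont: "continuous_map (prod_topology \<tau> ?Z) ?Z (\<lambda>(g, c). act g ` c)"
  proof -
    have "proper_map Y ?Z ?q"
      by (rule continuous_imp_proper_map[OF fl(3) Hausdorff_imp_kc_space[OF haus] qc])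
    then have "proper_map (prod_topology \<tau> Y) (prod_topology \<tau> ?Z) (\<lambda>(g, y). (id g, ?q y))"
      unfolding proper_map_prod using proper_map_id[of \<tau>] by (simp add: id_def)
    then have cl: "closed_map (prod_topology \<tau> Y) (prod_topology \<tau> ?Z) (\<lambda>(g, y). (id g, ?q y))"
      by (rule proper_imp_closed_map)
    have co: "continuous_map (prod_topology \<tau> Y) (prod_topology \<tau> ?Z) (\<lambda>(g, y). (id g, ?q y))"
      using qc by (simp add: continuous_map_prod_top)
    have "(\<lambda>(g, y). (id g, ?q y)) ` topspace (prod_topology \<tau> Y) = topspace (prod_topology \<tau> ?Z)"
      unfolding topspace_prod_topology surj by auto
    then have qm2: "quotient_map (prod_topology \<tau> Y) (prod_topology \<tau> ?Z) (\<lambda>(g, y). (id g, ?q y))"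
      by (rule continuous_closed_imp_quotient_map[OF co cl])
    have "continuous_map (prod_topology \<tau> Y) ?Z (?q \<circ> (\<lambda>(g, y). act g y))"
      by (rule continuous_map_compose[OF _ qc]) (use flow in \<open>simp add: is_flow_def\<close>)
    then have "continuous_map (prod_topology \<tau> Y) ?Z ((\<lambda>(g, c). act g ` c) \<circ> (\<lambda>(g, y). (id g, ?q y)))"
      by (rule continuous_map_eq) (use act_q fl(2) in auto)
    then show ?thesis by (rule continuous_compose_quotient_map[OF qm2])
  qed
  have sub: "c \<subseteq> topspace Y" if "c \<in> topspace ?Z" for c
    using that eq unfolding surj equiv_def by blast
  show ?thesis
    unfolding is_flow_def
  proof (intro conjI ballI comp haus cont)
    show "topological_group G \<tau>" using flow unfolding is_flow_def by blast
    fix c assume c: "c \<in> topspace ?Z"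
    show "act \<one>\<^bsub>G\<^esub> ` c = c" using sub[OF c] fl(4) by force
    fix g h assume "g \<in> carrier G" "h \<in> carrier G"
    then show "act (g \<otimes>\<^bsub>G\<^esub> h) ` c = act g ` act h ` c"
      unfolding image_image using sub[OF c] fl(5) by (intro image_cong) auto
  qed
qed

text \<open>By minimality of \<open>F\<close>, one inclusion needs only that the stable relation has
  a WAP quotient: continuous functions there pull back to functions invariant under the relation,
  hence to stable ones. For the other, the quotient by \<open>F\<close> is compact Hausdorff, so
  distinct classes are separated by a continuous function, which is WAP and pulls back to a stable
  one.\<close>

theorem finest_wap_equiv_eq_stable_equiv:
  assumes flow: "is_flow G \<tau> Y act" and F: "finest_wap_equiv G \<tau> Y act F"
  shows "F = stable_equiv G Y act"
proof (rule antisym)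
  note fl = is_flowD[OF flow]
  let ?E = "stable_equiv G Y act"
  have E: "closed_invariant_equiv G Y act ?E"
    by (rule closed_invariant_equiv_stable_equiv[OF flow])
  have eqE: "equiv (topspace Y) ?E" using E unfolding closed_invariant_equiv_def by blast
  note flowE = is_flow_quotient_stable_equiv[OF flow]
  have "has_wap_quotient G \<tau> Y act ?E"
    unfolding has_wap_quotient_def wap_flow_def
  proof (intro conjI ballI flowE)
    fix f assume f: "f \<in> C_space (quotient_topology Y ?E)"
    then have "continuous_map (quotient_topology Y ?E) euclideanreal f"
      using is_flowD(3)[OF flowE] by (simp add: C_space_iff)
    then have "continuous_map Y euclideanreal (\<lambda>y. f (?E `` {y}))"
      using continuous_map_compose[OF quotient_imp_continuous_map[OF quotient_map_quotient_topology[OF eqE]]]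
      by (fastforce simp: comp_def)
    then have "stable_function G Y act (\<lambda>y. f (?E `` {y}))"
      by (rule stable_function_if_stable_equiv_invariant[OF flow]) (simp add: equiv_class_eq[OF eqE])
    then show "wap_function G (quotient_topology Y ?E) (\<lambda>g c. act g ` c) f"
      unfolding wap_function_iff_stable_function[OF flowE f] stable_function_quotient_iff[OF flow E] .
  qed
  then show "F \<subseteq> ?E" using F E unfolding finest_wap_equiv_def by blast
next
  have F': "closed_invariant_equiv G Y act F" "wap_flow G \<tau> (quotient_topology Y F) (\<lambda>g c. act g ` c)"
    using F unfolding finest_wap_equiv_def has_wap_quotient_def by blast+
  then have flowF: "is_flow G \<tau> (quotient_topology Y F) (\<lambda>g c. act g ` c)" unfolding wap_flow_def by blast
  have eq: "equiv (topspace Y) F" using F' unfolding closed_invariant_equiv_def by blast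
  let ?Z = "quotient_topology Y F"
  have Z: "compact_space ?Z" "Hausdorff_space ?Z" using flowF unfolding is_flow_def by blast+
  then have norm: "normal_space ?Z" by (simp add: compact_Hausdorff_or_regular_imp_normal_space)
  have q: "F `` {y} \<in> topspace ?Z" if "y \<in> topspace Y" for y
    unfolding topspace_quotient_topology[OF eq] using that by (rule quotientI)
  show "stable_equiv G Y act \<subseteq> F"
  proof (rule subrelI, rule ccontr)
    fix p q assume pq: "(p, q) \<in> stable_equiv G Y act" and "(p, q) \<notin> F"
    then have top: "p \<in> topspace Y" "q \<in> topspace Y" by (auto simp: stable_equiv_def)
    have ne: "F `` {p} \<noteq> F `` {q}"
      using \<open>(p, q) \<notin> F\<close> eq_equiv_class[OF _ eq top(2)] by blast
    have "closedin ?Z {F `` {p}}" "closedin ?Z {F `` {q}}"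
      using Z(2) q top by (simp_all add: closedin_Hausdorff_singleton)
    then obtain f where f: "continuous_map ?Z euclideanreal f" "f ` {F `` {p}} \<subseteq> {0}" "f ` {F `` {q}} \<subseteq> {1}"
      using Urysohn_lemma_alt[OF norm, of "{F `` {p}}" "{F `` {q}}"] ne by (auto simp: disjnt_def)
    define f' where "f' = restrict f (topspace ?Z)"
    have f': "f' \<in> C_space ?Z" unfolding f'_def by (rule restrict_in_C_space[OF Z(1) f(1)])
    then have "wap_function G ?Z (\<lambda>g c. act g ` c) f'" using F'(2) unfolding wap_flow_def by blast
    then have "stable_function G Y act (\<lambda>y. f' (F `` {y}))"
      unfolding wap_function_iff_stable_function[OF flowF f'] stable_function_quotient_iff[OF flow F'(1)] .
    then have "f' (F `` {p}) = f' (F `` {q})" using pq unfolding stable_equiv_def by blast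
    then show False using f(2,3) q top by (simp add: f'_def)
  qed
qed

section \<open>Formulas and elementary equivalence of assignments\<close>

lemma eval_trm_cong:
  "(\<And>v. v \<in> trm_vars t \<Longrightarrow> e v = e' v) \<Longrightarrow> (\<And>n. n \<in> bnds_trm t \<Longrightarrow> s n = s' n) \<Longrightarrow>
   eval_trm M e s t = eval_trm M e' s' t"
proof (induction t)
  case (App f ts)
  have "eval_trm M e s t = eval_trm M e' s' t" if "t \<in> set ts" for t
    by (rule App.IH[OF that]) (use App.prems that in auto)
  then have "map (eval_trm M e s) ts = map (eval_trm M e' s') ts" by simp
  then show ?case by (simp only: eval_trm.simps)
qed auto

lemma sat_cong:
  "(\<And>v. v \<in> fm_vars \<phi> \<Longrightarrow> e v = e' v) \<Longrightarrow> (\<And>n. n \<in> unbound \<phi> \<Longrightarrow> s n = s' n) \<Longrightarrow>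
   sat M e s \<phi> = sat M e' s' \<phi>"
proof (induction \<phi> arbitrary: s s')
  case (Eq t u)
  then have "eval_trm M e s t = eval_trm M e' s' t" "eval_trm M e s u = eval_trm M e' s' u"
    by (auto intro!: eval_trm_cong)
  then show ?case by simp
next
  case (Rel R ts)
  then have "map (eval_trm M e s) ts = map (eval_trm M e' s') ts" by (auto intro!: eval_trm_cong)
  then show ?case by (simp only: sat.simps)
next
  case (Exists n \<phi>)
  have "sat M e (s(n := a)) \<phi> = sat M e' (s'(n := a)) \<phi>" for a
    by (rule Exists.IH) (use Exists.prems in auto)
  then show ?case by simp
next
  case (Neg \<phi>)
  have "sat M e s \<phi> = sat M e' s' \<phi>" by (rule Neg.IH) (use Neg.prems in auto)
  then show ?case by simp
next
  case (Conj \<phi> \<psi>)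
  have "sat M e s \<phi> = sat M e' s' \<phi>" by (rule Conj.IH(1)) (use Conj.prems in auto)
  moreover have "sat M e s \<psi> = sat M e' s' \<psi>" by (rule Conj.IH(2)) (use Conj.prems in auto)
  ultimately show ?case by simp
qed

lemma eval_trm_map: "eval_trm M e s (map_trm f t) = eval_trm M (e \<circ> f) s t"
proof (induction t)
  case (App g ts)
  then have "map (eval_trm M e s) (map (map_trm f) ts) = map (eval_trm M (e \<circ> f) s) ts"
    unfolding map_map map_eq_conv comp_apply[of "eval_trm M e s" "map_trm f"] by blast
  then show ?case by (simp only: eval_trm.simps trm.map)
qed auto

lemma sat_map: "sat M e s (map_fm f \<phi>) = sat M (e \<circ> f) s \<phi>"
  by (induction \<phi> arbitrary: s) (simp_all add: eval_trm_map comp_def)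

lemma wf_trm_map: "wf_trm L (map_trm f t) = wf_trm L t"
  by (induction t) (auto simp: list_all_iff)

lemma wf_fm_map: "wf_fm L (map_fm f \<phi>) = wf_fm L \<phi>"
  by (induction \<phi>) (auto simp: list_all_iff wf_trm_map)

lemma bnds_trm_map: "bnds_trm (map_trm f t) = bnds_trm t"
  by (induction t) auto

lemma unbound_map: "unbound (map_fm f \<phi>) = unbound \<phi>"
  by (induction \<phi>) (auto simp: bnds_trm_map)

lemma finite_trm_vars: "finite (trm_vars t)"
  by (induction t) auto

lemma finite_fm_vars: "finite (fm_vars \<phi>)"
  by (induction \<phi>) (auto simp: finite_trm_vars)

lemma finite_bnds_trm: "finite (bnds_trm t)"
  by (induction t) auto

section \<open>Quantifying a free variable\<close>

primrec abs_trm :: "'v \<Rightarrow> nat \<Rightarrow> ('f, 'v) trm \<Rightarrow> ('f, 'v) trm" where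
  "abs_trm v n (Var w) = (if w = v then Bnd n else Var w)"
| "abs_trm v n (Bnd m) = Bnd m"
| "abs_trm v n (App f ts) = App f (map (abs_trm v n) ts)"

primrec abs_fm :: "'v \<Rightarrow> nat \<Rightarrow> ('f, 'r, 'v) fm \<Rightarrow> ('f, 'r, 'v) fm" where
  "abs_fm v n (Eq t u) = Eq (abs_trm v n t) (abs_trm v n u)"
| "abs_fm v n (Rel R ts) = Rel R (map (abs_trm v n) ts)"
| "abs_fm v n (Neg \<phi>) = Neg (abs_fm v n \<phi>)"
| "abs_fm v n (Conj \<phi> \<psi>) = Conj (abs_fm v n \<phi>) (abs_fm v n \<psi>)"
| "abs_fm v n (Exists m \<phi>) = Exists m (abs_fm v n \<phi>)"

text \<open>Includes the indices that quantifiers bind. An index outside this set neither clashes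
  with one in use nor is captured when it is inserted under a quantifier.\<close>

primrec indices :: "('f, 'r, 'v) fm \<Rightarrow> nat set" where
  "indices (Eq s t) = bnds_trm s \<union> bnds_trm t"
| "indices (Rel R ts) = \<Union> (set (map bnds_trm ts))"
| "indices (Neg \<phi>) = indices \<phi>"
| "indices (Conj \<phi> \<psi>) = indices \<phi> \<union> indices \<psi>"
| "indices (Exists n \<phi>) = insert n (indices \<phi>)"

lemma finite_indices: "finite (indices \<phi>)"
  by (induction \<phi>) (auto simp: finite_bnds_trm)

lemma eval_abs_trm:
  "n \<notin> bnds_trm t \<Longrightarrow> eval_trm M e (s(n := a)) (abs_trm v n t) = eval_trm M (e(v := a)) s t"
proof (induction t)
  case (App f ts)
  have "eval_trm M e (s(n := a)) (abs_trm v n t) = eval_trm M (e(v := a)) s t" if "t \<in> set ts" for t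
    by (rule App.IH[OF that]) (use App.prems that in auto)
  then have "map (eval_trm M e (s(n := a))) (map (abs_trm v n) ts) = map (eval_trm M (e(v := a)) s) ts"
    unfolding map_map by (intro map_cong) simp_all
  then show ?case by (simp only: eval_trm.simps abs_trm.simps)
qed auto

lemma sat_abs_fm:
  "n \<notin> indices \<phi> \<Longrightarrow> sat M e (s(n := a)) (abs_fm v n \<phi>) = sat M (e(v := a)) s \<phi>"
proof (induction \<phi> arbitrary: s)
  case (Rel R ts)
  have "eval_trm M e (s(n := a)) (abs_trm v n t) = eval_trm M (e(v := a)) s t" if "t \<in> set ts" for t
    by (rule eval_abs_trm) (use Rel that in auto)
  then have "map (eval_trm M e (s(n := a))) (map (abs_trm v n) ts) = map (eval_trm M (e(v := a)) s) ts"
    unfolding map_map by (intro map_cong) simp_all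
  then show ?case by (simp only: sat.simps abs_fm.simps)
next
  case (Exists m \<phi>)
  have "sat M e (s(n := a, m := b)) (abs_fm v n \<phi>) = sat M (e(v := a)) (s(m := b)) \<phi>" for b
  proof -
    have "s(n := a, m := b) = s(m := b, n := a)" using Exists.prems by (simp add: fun_upd_twist)
    moreover have "sat M e (s(m := b, n := a)) (abs_fm v n \<phi>) = sat M (e(v := a)) (s(m := b)) \<phi>"
      by (rule Exists.IH) (use Exists.prems in simp)
    ultimately show ?thesis by (simp only:)
  qed
  then show ?case by (simp only: sat.simps abs_fm.simps)
qed (auto simp: eval_abs_trm)

lemma wf_abs_trm: "wf_trm L (abs_trm v n t) = wf_trm L t"
  by (induction t) (auto simp: list_all_iff)

lemma wf_abs_fm: "wf_fm L (abs_fm v n \<phi>) = wf_fm L \<phi>"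
  by (induction \<phi>) (auto simp: list_all_iff wf_abs_trm)

lemma bnds_abs_trm: "bnds_trm (abs_trm v n t) \<subseteq> insert n (bnds_trm t)"
  by (induction t) auto

lemma unbound_abs_fm: "unbound (abs_fm v n \<phi>) \<subseteq> insert n (unbound \<phi>)"
proof (induction \<phi>)
  case (Eq t u)
  then show ?case using bnds_abs_trm[of v n t] bnds_abs_trm[of v n u] by auto
next
  case (Rel R ts)
  then show ?case using bnds_abs_trm[of v n] by fastforce
qed auto

lemma vars_abs_trm: "trm_vars (abs_trm v n t) = trm_vars t - {v}"
  by (induction t) auto

lemma vars_abs_fm: "fm_vars (abs_fm v n \<phi>) = fm_vars \<phi> - {v}"
  by (induction \<phi>) (auto simp: vars_abs_trm)

text \<open>\<open>Exists\<close> binds only \<open>Bnd\<close> indices, so \<open>v\<close> is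
  first turned into a fresh index; one exists because a formula has finitely many.\<close>

definition ex_var :: "'v \<Rightarrow> ('f, 'r, 'v) fm \<Rightarrow> ('f, 'r, 'v) fm" where
  "ex_var v \<phi> = (let n = (SOME n. n \<notin> indices \<phi>) in Exists n (abs_fm v n \<phi>))"

lemma sat_ex_var: "sat M e s (ex_var v \<phi>) \<longleftrightarrow> (\<exists>a\<in>universe M. sat M (e(v := a)) s \<phi>)"
proof -
  have fresh: "(SOME n. n \<notin> indices \<phi>) \<notin> indices \<phi>"
    using ex_new_if_finite[OF infinite_UNIV_nat finite_indices] by (rule someI_ex)
  show ?thesis unfolding ex_var_def Let_def sat.simps sat_abs_fm[OF fresh] by (rule refl)
qed

text \<open>Parameters are treated as variables, so that a type of a tuple in a structure becomes
  a set of formulas evaluated under an assignment.\<close>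

definition fms :: "('f, 'r) fo_language \<Rightarrow> 'v set \<Rightarrow> ('f, 'r, 'v) fm set" where
  "fms L I = {\<phi>. wf_fm L \<phi> \<and> unbound \<phi> = {} \<and> fm_vars \<phi> \<subseteq> I}"

abbreviation sat0 :: "('f, 'r, 'a) fo_structure \<Rightarrow> ('v \<Rightarrow> 'a) \<Rightarrow> ('f, 'r, 'v) fm \<Rightarrow> bool" where
  "sat0 M e \<equiv> sat M e (\<lambda>_. undefined)"

lemma formulas_eq_fms: "formulas L V A = fms L (Inl ` V \<union> Inr ` A)"
  by (simp add: formulas_def fms_def Plus_def)

lemma fms_mono: "I \<subseteq> J \<Longrightarrow> fms L I \<subseteq> fms L J"
  by (auto simp: fms_def)

lemma formulas_mono: "A \<subseteq> B \<Longrightarrow> formulas L V A \<subseteq> formulas L V B"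
  by (auto simp: formulas_def)

lemma fms_connectives [simp]:
  "Neg \<phi> \<in> fms L I \<longleftrightarrow> \<phi> \<in> fms L I"
  "Conj \<phi> \<psi> \<in> fms L I \<longleftrightarrow> \<phi> \<in> fms L I \<and> \<psi> \<in> fms L I"
  by (auto simp: fms_def)

lemma ex_var_in_fms: "\<phi> \<in> fms L (insert v I) \<Longrightarrow> ex_var v \<phi> \<in> fms L I"
  using unbound_abs_fm[of v _ \<phi>] by (auto simp: fms_def ex_var_def Let_def wf_abs_fm vars_abs_fm)

lemma map_fm_in_fms: "\<phi> \<in> fms L I \<Longrightarrow> f ` I \<subseteq> J \<Longrightarrow> map_fm f \<phi> \<in> fms L J"
  by (auto simp: fms_def wf_fm_map unbound_map fm.set_map)

lemma sat0_cong:
  assumes "\<phi> \<in> fms L I" "\<And>v. v \<in> I \<Longrightarrow> e v = e' v"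
  shows "sat0 M e \<phi> = sat0 M e' \<phi>"
  by (rule sat_cong) (use assms in \<open>auto simp: fms_def\<close>)

lemma finite_conjunction:
  assumes "finite q" "q \<subseteq> fms L I"
  obtains \<theta> where "\<theta> \<in> fms L I" "\<And>(M :: ('f, 'r, 'a) fo_structure) e. sat0 M e \<theta> \<longleftrightarrow> (\<forall>\<phi>\<in>q. sat0 M e \<phi>)"
proof -
  have "\<exists>\<theta>\<in>fms L I. \<forall>(M :: ('f, 'r, 'a) fo_structure) e. sat0 M e \<theta> \<longleftrightarrow> (\<forall>\<phi>\<in>q. sat0 M e \<phi>)"
    using assms
  proof (induction q)
    case empty
    \<comment> \<open>The empty conjunction must be a tautology available even for
      \<open>I = {}\<close>, hence one in a bound variable alone.\<close>
    show ?case
      by (rule bexI[of _ "Neg (Exists 0 (Neg (Eq (Bnd 0) (Bnd 0))))"]) (auto simp: fms_def)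
  next
    case (insert \<phi> q)
    then obtain \<theta> where "\<theta> \<in> fms L I"
      "\<forall>(M :: ('f, 'r, 'a) fo_structure) e. sat0 M e \<theta> \<longleftrightarrow> (\<forall>\<phi>\<in>q. sat0 M e \<phi>)" by auto
    then show ?case using insert.prems by (intro bexI[of _ "Conj \<phi> \<theta>"]) auto
  qed
  then show thesis using that by blast
qed

text \<open>One notion for several uses: that a map on parameters is elementary (compare
  \<open>id\<close> with the map), that an inclusion of structures is elementary (compare
  \<open>id\<close> with \<open>id\<close>), and that two tuples have the same type.\<close>

definition elem_equiv ::
  "('f, 'r) fo_language \<Rightarrow> 'v set \<Rightarrow> ('f, 'r, 'a) fo_structure \<Rightarrow> ('v \<Rightarrow> 'a)
     \<Rightarrow> ('f, 'r, 'a) fo_structure \<Rightarrow> ('v \<Rightarrow> 'a) \<Rightarrow> bool" where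
  "elem_equiv L I M e N b \<longleftrightarrow> (\<forall>\<phi>\<in>fms L I. sat0 M e \<phi> \<longleftrightarrow> sat0 N b \<phi>)"

lemma elem_equiv_sym: "elem_equiv L I M e N b \<Longrightarrow> elem_equiv L I N b M e"
  by (auto simp: elem_equiv_def)

lemma elem_equiv_trans: "elem_equiv L I M e N b \<Longrightarrow> elem_equiv L I N b N' b' \<Longrightarrow> elem_equiv L I M e N' b'"
  by (auto simp: elem_equiv_def)

lemma elem_equiv_cong:
  assumes "elem_equiv L I M e N b" "\<And>v. v \<in> I \<Longrightarrow> e v = e' v" "\<And>v. v \<in> I \<Longrightarrow> b v = b' v"
  shows "elem_equiv L I M e' N b'"
  unfolding elem_equiv_def
proof
  fix \<phi> assume \<phi>: "\<phi> \<in> fms L I"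
  have "sat0 M e \<phi> = sat0 M e' \<phi>" "sat0 N b \<phi> = sat0 N b' \<phi>"
    by (rule sat0_cong[OF \<phi>], erule assms(2,3))+
  then show "sat0 M e' \<phi> \<longleftrightarrow> sat0 N b' \<phi>"
    using assms(1) \<phi> unfolding elem_equiv_def by blast
qed

lemma elem_equiv_rename:
  assumes "elem_equiv L J M e N b" "f ` I \<subseteq> J"
  shows "elem_equiv L I M (e \<circ> f) N (b \<circ> f)"
  unfolding elem_equiv_def
proof
  fix \<phi> assume "\<phi> \<in> fms L I"
  then have "map_fm f \<phi> \<in> fms L J" by (rule map_fm_in_fms[OF _ assms(2)])
  then have "sat0 M e (map_fm f \<phi>) \<longleftrightarrow> sat0 N b (map_fm f \<phi>)"
    using assms(1) unfolding elem_equiv_def by blast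
  then show "sat0 M (e \<circ> f) \<phi> \<longleftrightarrow> sat0 N (b \<circ> f) \<phi>" unfolding sat_map .
qed

text \<open>The variables in \<open>J\<close> are quantified one at a time; the resulting formula
  over \<open>I\<close> transfers to \<open>N\<close>, and its witnesses there are the new
  values.\<close>

lemma elem_equiv_extend_formula:
  assumes "elem_equiv L I M e N b" "finite J" "\<phi> \<in> fms L (I \<union> J)" "I \<inter> J = {}"
    "\<And>v. v \<in> I \<Longrightarrow> e' v = e v" "e' ` J \<subseteq> universe M" "sat0 M e' \<phi>"
  shows "\<exists>b'. (\<forall>v. v \<notin> J \<longrightarrow> b' v = b v) \<and> b' ` J \<subseteq> universe N \<and> sat0 N b' \<phi>"
  using assms(2-)
proof (induction J arbitrary: \<phi> rule: finite_induct)
  case empty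
  then have "sat0 M e \<phi>" using sat0_cong[of \<phi> L I e' e M] by simp
  then have "sat0 N b \<phi>" using empty assms(1) by (simp add: elem_equiv_def)
  then show ?case by (intro exI[of _ b]) simp
next
  case (insert v J)
  have "\<exists>b'. (\<forall>w. w \<notin> J \<longrightarrow> b' w = b w) \<and> b' ` J \<subseteq> universe N \<and> sat0 N b' (ex_var v \<phi>)"
  proof (rule insert.IH)
    show "ex_var v \<phi> \<in> fms L (I \<union> J)" using insert.prems(1) by (intro ex_var_in_fms) simp
    show "sat0 M e' (ex_var v \<phi>)"
      unfolding sat_ex_var using insert.prems(4,5) by (intro bexI[of _ "e' v"]) simp_all
  qed (use insert.prems in auto)
  then obtain b' a where b': "\<forall>w. w \<notin> J \<longrightarrow> b' w = b w" "b' ` J \<subseteq> universe N" "a \<in> universe N"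
    "sat0 N (b'(v := a)) \<phi>"
    unfolding sat_ex_var by blast
  have "(b'(v := a)) ` insert v J \<subseteq> universe N" using b'(2,3) by auto
  moreover have "\<forall>w. w \<notin> insert v J \<longrightarrow> (b'(v := a)) w = b w" using b'(1) by simp
  ultimately show ?case using b'(4) by blast
qed

lemma elem_equiv_extend:
  fixes M N :: "('f, 'r, 'a) fo_structure"
  assumes eq: "elem_equiv L I M e N b" and q: "finite q" "q \<subseteq> fms L (I \<union> J)" and disj: "I \<inter> J = {}"
    and N: "universe N \<noteq> {}" and e': "\<And>v. v \<in> I \<Longrightarrow> e' v = e v" "e' ` J \<subseteq> universe M" "\<forall>\<phi>\<in>q. sat0 M e' \<phi>"
  obtains b' where "\<And>v. v \<in> I \<Longrightarrow> b' v = b v" "b' ` J \<subseteq> universe N" "\<forall>\<phi>\<in>q. sat0 N b' \<phi>"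
proof -
  \<comment> \<open>\<open>J\<close> may be infinite, but finitely many formulas mention only
    finitely many of its variables.\<close>
  define J' where "J' = J \<inter> \<Union> (fm_vars ` q)"
  have J': "finite J'" "J' \<subseteq> J" using q(1) by (auto simp: J'_def finite_fm_vars)
  have q': "q \<subseteq> fms L (I \<union> J')" using q(2) unfolding fms_def J'_def by blast
  obtain \<theta> where \<theta>: "\<theta> \<in> fms L (I \<union> J')"
    "\<And>(M :: ('f, 'r, 'a) fo_structure) e. sat0 M e \<theta> \<longleftrightarrow> (\<forall>\<phi>\<in>q. sat0 M e \<phi>)"
    using finite_conjunction[OF q(1) q'] by blast
  have "\<exists>b'. (\<forall>v. v \<notin> J' \<longrightarrow> b' v = b v) \<and> b' ` J' \<subseteq> universe N \<and> sat0 N b' \<theta>"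
  proof (rule elem_equiv_extend_formula[OF eq J'(1) \<theta>(1) _ e'(1)])
    show "I \<inter> J' = {}" "e' ` J' \<subseteq> universe M" using J'(2) disj e'(2) by blast+
    show "sat0 M e' \<theta>" unfolding \<theta>(2) by (rule e'(3))
  qed
  then obtain b0 where b0: "\<forall>v. v \<notin> J' \<longrightarrow> b0 v = b v" "b0 ` J' \<subseteq> universe N" "\<forall>\<phi>\<in>q. sat0 N b0 \<phi>"
    using \<theta>(2) by blast
  obtain n where n: "n \<in> universe N" using N by blast
  \<comment> \<open>The variables of \<open>J\<close> that do not occur in \<open>q\<close> still
    have to take a value in the universe.\<close>
  define b' where "b' v = (if v \<in> J - J' then n else b0 v)" for v
  show thesis
  proof
    show "b' v = b v" if "v \<in> I" for v using that disj J' b0(1) by (auto simp: b'_def)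
    show "b' ` J \<subseteq> universe N" using b0(2) n by (auto simp: b'_def)
    show "\<forall>\<phi>\<in>q. sat0 N b' \<phi>"
    proof
      fix \<phi> assume \<phi>: "\<phi> \<in> q"
      have "sat0 N b0 \<phi> = sat0 N b' \<phi>"
        by (rule sat0_cong[OF subsetD[OF q' \<phi>]]) (use disj in \<open>auto simp: b'_def\<close>)
      then show "sat0 N b' \<phi>" using b0(3) \<phi> by blast
    qed
  qed
qed

section \<open>Parameters and automorphisms\<close>

definition params :: "('f, 'r, 'x, 'a) pfm \<Rightarrow> 'a set" where
  "params \<phi> = {a. Inr a \<in> fm_vars \<phi>}"

lemma finite_params: "finite (params \<phi>)"
proof -
  have "params \<phi> = Inr -` fm_vars \<phi>" by (auto simp: params_def)
  then show ?thesis by (simp add: finite_vimageI finite_fm_vars)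
qed

lemma formulas_params: "\<phi> \<in> formulas L V A \<Longrightarrow> \<phi> \<in> formulas L V (params \<phi>)"
  by (auto simp: formulas_def params_def)

lemma params_subset: "\<phi> \<in> formulas L V A \<Longrightarrow> params \<phi> \<subseteq> A"
  by (auto simp: formulas_def params_def)

lemma formulas_connectives [simp]:
  "Neg \<phi> \<in> formulas L V A \<longleftrightarrow> \<phi> \<in> formulas L V A"
  "Conj \<phi> \<psi> \<in> formulas L V A \<longleftrightarrow> \<phi> \<in> formulas L V A \<and> \<psi> \<in> formulas L V A"
  by (simp_all add: formulas_eq_fms)

lemma holds_connectives [simp]:
  "holds M b (Neg \<phi>) \<longleftrightarrow> \<not> holds M b \<phi>"
  "holds M b (Conj \<phi> \<psi>) \<longleftrightarrow> holds M b \<phi> \<and> holds M b \<psi>"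
  by (simp_all add: holds_def)

lemma holds_map_params: "holds M b (map_params \<sigma> \<phi>) = sat0 M (case_sum b \<sigma>) \<phi>"
proof -
  have "case_sum b id \<circ> map_sum id \<sigma> = case_sum b \<sigma>" by (auto simp: fun_eq_iff split: sum.split)
  then show ?thesis unfolding holds_def map_params_def sat_map by simp
qed

lemma map_params_Neg: "map_params \<sigma> (Neg \<phi>) = Neg (map_params \<sigma> \<phi>)"
  by (simp add: map_params_def)

lemma map_params_in_formulas: "\<phi> \<in> formulas L V A \<Longrightarrow> \<sigma> ` A \<subseteq> B \<Longrightarrow> map_params \<sigma> \<phi> \<in> formulas L V B"
  unfolding formulas_eq_fms map_params_def by (erule map_fm_in_fms) auto

lemma map_params_comp:
  fixes \<phi> :: "('f, 'r, 'x, 'a) pfm"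
  shows "map_params \<sigma> (map_params \<tau> \<phi>) = map_params (\<sigma> \<circ> \<tau>) \<phi>"
proof -
  have "map_sum (id :: 'x \<Rightarrow> 'x) \<sigma> \<circ> map_sum id \<tau> = map_sum id (\<sigma> \<circ> \<tau>)"
    by (rule ext) (simp add: sum.map_comp)
  then show ?thesis by (simp only: map_params_def fm.map_comp)
qed

lemma map_params_cong:
  assumes "\<phi> \<in> formulas L V A" "\<And>a. a \<in> A \<Longrightarrow> \<sigma> a = \<tau> a"
  shows "map_params \<sigma> \<phi> = map_params \<tau> \<phi>"
  unfolding map_params_def
proof (rule fm.map_cong[OF refl])
  fix v assume "v \<in> fm_vars \<phi>"
  then have "v \<in> V <+> A" using assms(1) by (auto simp: formulas_def)
  then show "map_sum id \<sigma> v = map_sum id \<tau> v" using assms(2) by auto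
qed

lemma map_params_id [simp]: "map_params id \<phi> = \<phi>"
  by (simp add: map_params_def sum.map_id0 fm.map_id0)

text \<open>Membership of the value in the universe is proved along, because \<open>\<sigma>\<close>
  commutes with function symbols only there.\<close>

lemma eval_trm_automorphism:
  assumes M: "is_structure L M" and \<sigma>: "\<sigma> \<in> automorphisms L M"
  shows "wf_trm L t \<Longrightarrow> (\<And>v. v \<in> trm_vars t \<Longrightarrow> e v \<in> universe M) \<Longrightarrow>
    (\<And>n. n \<in> bnds_trm t \<Longrightarrow> s n \<in> universe M) \<Longrightarrow>
    eval_trm M e s t \<in> universe M \<and> eval_trm M (\<sigma> \<circ> e) (\<sigma> \<circ> s) t = \<sigma> (eval_trm M e s t)"
proof (induction t)
  case (App f ts)
  have ts: "eval_trm M e s t \<in> universe M \<and> eval_trm M (\<sigma> \<circ> e) (\<sigma> \<circ> s) t = \<sigma> (eval_trm M e s t)"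
    if "t \<in> set ts" for t
    by (rule App.IH[OF that]) (use App.prems that in \<open>auto simp: list_all_iff\<close>)
  let ?xs = "map (eval_trm M e s) ts"
  have f: "fun_arity L f = Some (length ?xs)" "set ?xs \<subseteq> universe M" using App.prems(1) ts by auto
  have "map (eval_trm M (\<sigma> \<circ> e) (\<sigma> \<circ> s)) ts = map \<sigma> ?xs"
    unfolding map_map map_eq_conv comp_apply[of \<sigma> "eval_trm M e s"] using ts by blast
  moreover have "fun_interp M f ?xs \<in> universe M"
    using M f unfolding is_structure_def by blast
  moreover have "\<sigma> (fun_interp M f ?xs) = fun_interp M f (map \<sigma> ?xs)"
    using \<sigma> f unfolding automorphisms_def by blast
  ultimately show ?case unfolding eval_trm.simps by (simp only:)
qed simp_all

lemma sat_automorphism: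
  assumes M: "is_structure L M" and \<sigma>: "\<sigma> \<in> automorphisms L M"
  shows "wf_fm L \<phi> \<Longrightarrow> (\<And>v. v \<in> fm_vars \<phi> \<Longrightarrow> e v \<in> universe M) \<Longrightarrow>
    (\<And>n. n \<in> unbound \<phi> \<Longrightarrow> s n \<in> universe M) \<Longrightarrow> sat M (\<sigma> \<circ> e) (\<sigma> \<circ> s) \<phi> = sat M e s \<phi>"
proof (induction \<phi> arbitrary: s)
  case (Eq t u)
  have inj: "inj \<sigma>" using \<sigma> by (auto simp: automorphisms_def permutes_inj)
  have "eval_trm M (\<sigma> \<circ> e) (\<sigma> \<circ> s) t = \<sigma> (eval_trm M e s t)" "eval_trm M (\<sigma> \<circ> e) (\<sigma> \<circ> s) u = \<sigma> (eval_trm M e s u)"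
    using eval_trm_automorphism[OF M \<sigma>, of t e s] eval_trm_automorphism[OF M \<sigma>, of u e s] Eq.prems by auto
  then show ?case unfolding sat.simps using inj by (simp add: inj_eq)
next
  case (Rel R ts)
  have ts: "eval_trm M e s t \<in> universe M \<and> eval_trm M (\<sigma> \<circ> e) (\<sigma> \<circ> s) t = \<sigma> (eval_trm M e s t)"
    if "t \<in> set ts" for t
    by (rule eval_trm_automorphism[OF M \<sigma>]) (use Rel.prems that in \<open>auto simp: list_all_iff\<close>)
  let ?xs = "map (eval_trm M e s) ts"
  have R: "rel_arity L R = Some (length ?xs)" "set ?xs \<subseteq> universe M" using Rel.prems(1) ts by auto
  have "map (eval_trm M (\<sigma> \<circ> e) (\<sigma> \<circ> s)) ts = map \<sigma> ?xs"
    unfolding map_map map_eq_conv comp_apply[of \<sigma> "eval_trm M e s"] using ts by blast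
  moreover have "rel_interp M R ?xs \<longleftrightarrow> rel_interp M R (map \<sigma> ?xs)"
    using \<sigma> R unfolding automorphisms_def by blast
  ultimately show ?case unfolding sat.simps by (simp only:)
next
  case (Neg \<phi>)
  have "sat M (\<sigma> \<circ> e) (\<sigma> \<circ> s) \<phi> = sat M e s \<phi>" by (rule Neg.IH) (use Neg.prems in auto)
  then show ?case unfolding sat.simps by (simp only:)
next
  case (Conj \<phi> \<psi>)
  have "sat M (\<sigma> \<circ> e) (\<sigma> \<circ> s) \<phi> = sat M e s \<phi>" by (rule Conj.IH(1)) (use Conj.prems in auto)
  moreover have "sat M (\<sigma> \<circ> e) (\<sigma> \<circ> s) \<psi> = sat M e s \<psi>" by (rule Conj.IH(2)) (use Conj.prems in auto)
  ultimately show ?case unfolding sat.simps by (simp only:)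
next
  case (Exists n \<phi>)
  have perm: "\<sigma> permutes universe M" using \<sigma> by (auto simp: automorphisms_def)
  have step: "sat M (\<sigma> \<circ> e) ((\<sigma> \<circ> s)(n := \<sigma> a)) \<phi> = sat M e (s(n := a)) \<phi>" if "a \<in> universe M" for a
  proof -
    have "sat M (\<sigma> \<circ> e) (\<sigma> \<circ> s(n := a)) \<phi> = sat M e (s(n := a)) \<phi>"
      by (rule Exists.IH) (use Exists.prems that in auto)
    moreover have "\<sigma> \<circ> s(n := a) = (\<sigma> \<circ> s)(n := \<sigma> a)" by (auto simp: fun_eq_iff)
    ultimately show ?thesis by (simp only:)
  qed
  have "(\<exists>a\<in>universe M. sat M (\<sigma> \<circ> e) ((\<sigma> \<circ> s)(n := a)) \<phi>) \<longleftrightarrow>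
      (\<exists>a\<in>\<sigma> ` universe M. sat M (\<sigma> \<circ> e) ((\<sigma> \<circ> s)(n := a)) \<phi>)"
    using permutes_image[OF perm] by (simp only:)
  also have "\<dots> \<longleftrightarrow> (\<exists>a\<in>universe M. sat M e (s(n := a)) \<phi>)"
    using step by blast
  finally show ?case unfolding sat.simps .
qed

lemma elem_equiv_automorphism:
  assumes M: "is_structure L M" and \<sigma>: "\<sigma> \<in> automorphisms L M" and e: "e ` I \<subseteq> universe M"
  shows "elem_equiv L I M e M (\<sigma> \<circ> e)"
  unfolding elem_equiv_def
proof
  fix \<phi> assume \<phi>: "\<phi> \<in> fms L I"
  \<comment> \<open>Composing with \<open>\<sigma>\<close> also changes the dummy values of the
    bound indices; the next step restores them, as no index is unbound.\<close>
  have "sat M (\<sigma> \<circ> e) (\<sigma> \<circ> (\<lambda>_. undefined)) \<phi> = sat0 M e \<phi>"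
    by (rule sat_automorphism[OF M \<sigma>]) (use \<phi> e in \<open>auto simp: fms_def\<close>)
  moreover have "sat M (\<sigma> \<circ> e) (\<sigma> \<circ> (\<lambda>_. undefined)) \<phi> = sat0 M (\<sigma> \<circ> e) \<phi>"
    by (rule sat_cong) (use \<phi> in \<open>auto simp: fms_def\<close>)
  ultimately show "sat0 M e \<phi> \<longleftrightarrow> sat0 M (\<sigma> \<circ> e) \<phi>" by (simp only:)
qed

section \<open>Types\<close>

lemma partial_type_realize:
  assumes "partial_type L M V A p" "finite q" "q \<subseteq> p"
  obtains b where "b ` V \<subseteq> universe M" "\<And>\<phi>. \<phi> \<in> q \<Longrightarrow> holds M b \<phi>"
proof -
  have "\<exists>b. b ` V \<subseteq> universe M \<and> (\<forall>\<phi>\<in>q. holds M b \<phi>)"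
    using assms by (simp add: partial_type_def)
  then show thesis using that by blast
qed

text \<open>Finite satisfiability is preserved by a map that is elementary on the parameters. With
  \<open>h\<close> an automorphism this gives the action on types, with \<open>h = id\<close> the
  passage between \<open>C\<close> and \<open>C'\<close> in both directions.\<close>

lemma partial_type_map:
  assumes p: "partial_type L M V A p" and h: "elem_equiv L A M id N h" "h ` A \<subseteq> B" and N: "universe N \<noteq> {}"
  shows "partial_type L N V B (map_params h ` p)"
  unfolding partial_type_def
proof (intro conjI allI impI)
  have sub: "p \<subseteq> formulas L V A" using p by (simp add: partial_type_def)
  then show "map_params h ` p \<subseteq> formulas L V B" using map_params_in_formulas[OF _ h(2)] by blast
  fix q assume "finite q \<and> q \<subseteq> map_params h ` p"
  then obtain q0 where q0: "finite q0" "q0 \<subseteq> p" "q = map_params h ` q0"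
    by (metis finite_subset_image)
  then obtain b0 where b0: "b0 ` V \<subseteq> universe M" "\<forall>\<phi>\<in>q0. holds M b0 \<phi>"
    using partial_type_realize[OF p q0(1,2)] by metis
  have eq: "elem_equiv L (Inr ` A) M (id \<circ> projr) N (h \<circ> projr)"
    by (rule elem_equiv_rename[OF h(1)]) auto
  have q0f: "q0 \<subseteq> fms L (Inr ` A \<union> Inl ` V)"
    using q0(2) sub unfolding formulas_eq_fms by (simp add: Un_commute)
  obtain b' where b': "\<And>v. v \<in> Inr ` A \<Longrightarrow> b' v = (h \<circ> projr) v" "b' ` Inl ` V \<subseteq> universe N"
    "\<forall>\<phi>\<in>q0. sat0 N b' \<phi>"
  proof (rule elem_equiv_extend[OF eq q0(1) q0f _ N, of "case_sum b0 id"])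
    show "\<forall>\<phi>\<in>q0. sat0 M (case_sum b0 id) \<phi>" using b0(2) by (simp add: holds_def)
  qed (use b0(1) in auto)
  have "holds N (b' \<circ> Inl) (map_params h \<phi>)" if "\<phi> \<in> q0" for \<phi>
  proof -
    have "sat0 N b' \<phi> = sat0 N (case_sum (b' \<circ> Inl) h) \<phi>"
      by (rule sat0_cong[OF subsetD[OF q0f that]]) (use b'(1) in auto)
    then show ?thesis unfolding holds_map_params using b'(3) that by blast
  qed
  then show "\<exists>b. b ` V \<subseteq> universe N \<and> (\<forall>\<phi>\<in>q. holds N b \<phi>)"
    using b'(2) unfolding q0(3) by (intro exI[of _ "b' \<circ> Inl"]) (simp add: image_comp)
qed

text \<open>Zorn's lemma gives a maximal finitely satisfiable set. If it lacked both
  \<open>\<phi>\<close> and \<open>Neg \<phi>\<close>, finite parts of it would refute each of them,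
  and a tuple realizing both parts would satisfy neither.\<close>

lemma partial_type_extends_to_complete_type:
  assumes "partial_type L M V A p"
  obtains q where "p \<subseteq> q" "complete_type L M V A q"
proof -
  define \<P> where "\<P> = {q. p \<subseteq> q \<and> partial_type L M V A q}"
  have "\<exists>m\<in>\<P>. \<forall>x\<in>\<P>. m \<subseteq> x \<longrightarrow> x = m"
  proof (rule subset_Zorn_nonempty)
    show "\<P> \<noteq> {}" using assms by (auto simp: \<P>_def)
    fix \<C> assume \<C>: "\<C> \<noteq> {}" "subset.chain \<P> \<C>"
    then have C: "\<And>q. q \<in> \<C> \<Longrightarrow> p \<subseteq> q \<and> partial_type L M V A q"
      by (auto simp: subset_chain_def \<P>_def)
    have "partial_type L M V A (\<Union> \<C>)"
      unfolding partial_type_def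
    proof (intro conjI allI impI)
      show "\<Union> \<C> \<subseteq> formulas L V A" using C by (auto simp: partial_type_def)
      fix q assume q: "finite q \<and> q \<subseteq> \<Union> \<C>"
      then obtain q' where "q' \<in> \<C>" "q \<subseteq> q'"
        using finite_subset_Union_chain[of q \<C> \<P>] \<C> by blast
      then show "\<exists>b. b ` V \<subseteq> universe M \<and> (\<forall>\<phi>\<in>q. holds M b \<phi>)"
        using C[of q'] q unfolding partial_type_def by blast
    qed
    then show "\<Union> \<C> \<in> \<P>" using C \<C>(1) unfolding \<P>_def by blast
  qed
  then obtain q where qP: "q \<in> \<P>" and qmax: "\<forall>x\<in>\<P>. q \<subseteq> x \<longrightarrow> x = q" by blast
  have q: "p \<subseteq> q" "partial_type L M V A q" using qP by (simp_all add: \<P>_def)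
  have max: "x = q" if "partial_type L M V A x" "q \<subseteq> x" for x
    using qmax that q(1) by (simp add: \<P>_def)
  have ext: "\<exists>q0. finite q0 \<and> q0 \<subseteq> q \<and> (\<forall>b. b ` V \<subseteq> universe M \<longrightarrow> (\<forall>\<psi>\<in>q0. holds M b \<psi>) \<longrightarrow> \<not> holds M b \<phi>)"
    if \<phi>: "\<phi> \<in> formulas L V A" "\<phi> \<notin> q" for \<phi>
  proof (rule ccontr)
    assume neg: "\<not> ?thesis"
    have "partial_type L M V A (insert \<phi> q)"
      unfolding partial_type_def
    proof (intro conjI allI impI)
      show "insert \<phi> q \<subseteq> formulas L V A" using \<phi> q by (auto simp: partial_type_def)
      fix r assume r: "finite r \<and> r \<subseteq> insert \<phi> q"
      then have "finite (r - {\<phi>})" "r - {\<phi>} \<subseteq> q" by auto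
      then obtain b where "b ` V \<subseteq> universe M" "\<forall>\<psi>\<in>r - {\<phi>}. holds M b \<psi>" "holds M b \<phi>"
        using neg by meson
      then show "\<exists>b. b ` V \<subseteq> universe M \<and> (\<forall>\<psi>\<in>r. holds M b \<psi>)" by blast
    qed
    then show False using max[of "insert \<phi> q"] \<phi>(2) by blast
  qed
  have "\<phi> \<in> q \<or> Neg \<phi> \<in> q" if \<phi>: "\<phi> \<in> formulas L V A" for \<phi>
  proof (rule ccontr)
    assume "\<not> ?thesis"
    then obtain q0 q1 where q0: "finite q0" "q0 \<subseteq> q"
        "\<forall>b. b ` V \<subseteq> universe M \<longrightarrow> (\<forall>\<psi>\<in>q0. holds M b \<psi>) \<longrightarrow> \<not> holds M b \<phi>"
      and q1: "finite q1" "q1 \<subseteq> q"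
        "\<forall>b. b ` V \<subseteq> universe M \<longrightarrow> (\<forall>\<psi>\<in>q1. holds M b \<psi>) \<longrightarrow> \<not> holds M b (Neg \<phi>)"
      using ext[of \<phi>] ext[of "Neg \<phi>"] \<phi> by auto
    have "finite (q0 \<union> q1)" "q0 \<union> q1 \<subseteq> q" using q0 q1 by blast+
    from partial_type_realize[OF q(2) this] obtain b
      where b: "b ` V \<subseteq> universe M" "\<And>\<psi>. \<psi> \<in> q0 \<union> q1 \<Longrightarrow> holds M b \<psi>" by metis
    have "\<not> holds M b \<phi>" using q0(3) b by simp
    moreover have "\<not> holds M b (Neg \<phi>)" using q1(3) b by simp
    ultimately show False by simp
  qed
  then have "complete_type L M V A q" using q(2) by (simp add: complete_type_def)
  then show thesis using that q(1) by blast
qed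

lemma complete_type_closed:
  assumes p: "complete_type L M V A p" and q: "finite q" "q \<subseteq> p" and \<phi>: "\<phi> \<in> formulas L V A"
    and imp: "\<And>b. b ` V \<subseteq> universe M \<Longrightarrow> \<forall>\<psi>\<in>q. holds M b \<psi> \<Longrightarrow> holds M b \<phi>"
  shows "\<phi> \<in> p"
proof (rule ccontr)
  assume "\<phi> \<notin> p"
  then have "Neg \<phi> \<in> p" using p \<phi> by (auto simp: complete_type_def)
  then have "finite (insert (Neg \<phi>) q)" "insert (Neg \<phi>) q \<subseteq> p" using q by simp_all
  moreover have "partial_type L M V A p" using p by (simp add: complete_type_def)
  ultimately obtain b where b: "b ` V \<subseteq> universe M" "\<And>\<psi>. \<psi> \<in> insert (Neg \<phi>) q \<Longrightarrow> holds M b \<psi>"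
    using partial_type_realize by metis
  have "holds M b \<phi>" by (rule imp[OF b(1)]) (simp add: b(2))
  then show False using b(2)[of "Neg \<phi>"] by simp
qed

lemma complete_type_Neg_iff:
  assumes p: "complete_type L M V A p" and \<phi>: "\<phi> \<in> formulas L V A"
  shows "Neg \<phi> \<in> p \<longleftrightarrow> \<phi> \<notin> p"
proof
  assume "Neg \<phi> \<in> p"
  show "\<phi> \<notin> p"
  proof
    assume "\<phi> \<in> p"
    then have "finite {\<phi>, Neg \<phi>}" "{\<phi>, Neg \<phi>} \<subseteq> p" using \<open>Neg \<phi> \<in> p\<close> by simp_all
    moreover have "partial_type L M V A p" using p by (simp add: complete_type_def)
    ultimately obtain b where b: "\<And>\<psi>. \<psi> \<in> {\<phi>, Neg \<phi>} \<Longrightarrow> holds M b \<psi>"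
      using partial_type_realize by metis
    show False using b[of \<phi>] b[of "Neg \<phi>"] by simp
  qed
qed (use assms in \<open>auto simp: complete_type_def\<close>)

lemma complete_type_Conj_iff:
  assumes p: "complete_type L M V A p" and \<phi>: "\<phi> \<in> formulas L V A" "\<psi> \<in> formulas L V A"
  shows "Conj \<phi> \<psi> \<in> p \<longleftrightarrow> \<phi> \<in> p \<and> \<psi> \<in> p"
proof
  assume c: "Conj \<phi> \<psi> \<in> p"
  have "\<phi> \<in> p" by (rule complete_type_closed[OF p, of "{Conj \<phi> \<psi>}"]) (use c \<phi> in simp_all)
  moreover have "\<psi> \<in> p" by (rule complete_type_closed[OF p, of "{Conj \<phi> \<psi>}"]) (use c \<phi> in simp_all)
  ultimately show "\<phi> \<in> p \<and> \<psi> \<in> p" by blast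
next
  assume c: "\<phi> \<in> p \<and> \<psi> \<in> p"
  show "Conj \<phi> \<psi> \<in> p" by (rule complete_type_closed[OF p, of "{\<phi>, \<psi>}"]) (use c \<phi> in simp_all)
qed

section \<open>The flow of types\<close>

text \<open>The last assumption is supplied by the given WAP quotients, since a flow includes its
  topological group. Closure of the automorphisms under inverses and composition is drawn from
  it.\<close>

locale type_flow =
  fixes L :: "('f, 'r) fo_language" and M :: "('f, 'r, 'a) fo_structure" and V :: "'x set"
    and \<pi> :: "('f, 'r, 'x, 'a) pfm set"
  assumes struct: "is_structure L M" and partial: "partial_type L M V {} \<pi>"
    and top_group: "topological_group (aut_group L M) (aut_topology L M)"
begin

abbreviation "Fm \<equiv> formulas L V (universe M)"
abbreviation "S \<equiv> types_containing L M V \<pi>"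
abbreviation "Y \<equiv> type_space L M V \<pi>"
abbreviation "Aut \<equiv> automorphisms L M"

section \<open>Cylinders: a base of clopen sets, and compactness\<close>

definition cyl :: "('f, 'r, 'x, 'a) pfm \<Rightarrow> ('f, 'r, 'x, 'a) pfm set set" where
  "cyl \<phi> = {p \<in> S. \<phi> \<in> p}"

lemma mem_S_iff: "p \<in> S \<longleftrightarrow> complete_type L M V (universe M) p \<and> \<pi> \<subseteq> p"
  by (simp add: types_containing_def)

lemma complete: "p \<in> S \<Longrightarrow> complete_type L M V (universe M) p"
  by (simp add: mem_S_iff)

lemma S_subset_Fm: "p \<in> S \<Longrightarrow> p \<subseteq> Fm"
  by (simp add: mem_S_iff complete_type_def partial_type_def)

lemma \<pi>_subset_Fm: "\<pi> \<subseteq> Fm"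
  using partial formulas_mono[of "{}" "universe M" L V] unfolding partial_type_def by blast

lemma universe_nonempty: "universe M \<noteq> {}"
  using struct by (simp add: is_structure_def)

lemma cyl_Neg: "\<phi> \<in> Fm \<Longrightarrow> cyl (Neg \<phi>) = S - cyl \<phi>"
  using complete_type_Neg_iff[OF complete] by (auto simp: cyl_def)

lemma cyl_Conj: "\<phi> \<in> Fm \<Longrightarrow> \<psi> \<in> Fm \<Longrightarrow> cyl (Conj \<phi> \<psi>) = cyl \<phi> \<inter> cyl \<psi>"
  using complete_type_Conj_iff[OF complete] by (auto simp: cyl_def)

lemma cyl_True: "\<exists>\<phi>\<in>Fm. cyl \<phi> = S"
proof
  let ?T = "Neg (Exists 0 (Neg (Eq (Bnd 0) (Bnd 0))))"
  show T: "?T \<in> Fm" by (auto simp: formulas_def)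
  have "?T \<in> p" if "p \<in> S" for p
    by (rule complete_type_closed[OF complete[OF that], of "{}"]) (use T in \<open>auto simp: holds_def\<close>)
  then show "cyl ?T = S" by (auto simp: cyl_def)
qed

lemma cyl_finite_Union:
  assumes "finite \<Phi>" "\<Phi> \<subseteq> Fm"
  obtains \<psi> where "\<psi> \<in> Fm" "cyl \<psi> = \<Union> (cyl ` \<Phi>)"
proof -
  have "\<exists>\<psi>\<in>Fm. cyl \<psi> = \<Union> (cyl ` \<Phi>)"
    using assms
  proof (induction \<Phi>)
    case empty
    obtain \<phi> where "\<phi> \<in> Fm" "cyl \<phi> = S" using cyl_True by blast
    then show ?case by (intro bexI[of _ "Neg \<phi>"]) (simp_all add: cyl_Neg)
  next
    case (insert \<phi> \<Phi>)
    then obtain \<psi> where \<psi>: "\<psi> \<in> Fm" "cyl \<psi> = \<Union> (cyl ` \<Phi>)" by auto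
    have "cyl \<phi> \<subseteq> S" "cyl \<psi> \<subseteq> S" by (auto simp: cyl_def)
    then have "cyl (Neg (Conj (Neg \<phi>) (Neg \<psi>))) = cyl \<phi> \<union> cyl \<psi>"
      using insert.prems \<psi>(1) by (simp add: cyl_Neg cyl_Conj) blast
    then show ?case
      using insert.prems \<psi> by (intro bexI[of _ "Neg (Conj (Neg \<phi>) (Neg \<psi>))"]) simp_all
  qed
  then show thesis using that by blast
qed

lemma type_space_eq: "Y = topology_generated_by (cyl ` Fm)"
proof -
  have "{{p \<in> S. \<phi> \<in> p} | \<phi>. \<phi> \<in> Fm} = cyl ` Fm" by (auto simp: cyl_def)
  then show ?thesis by (simp add: type_space_def)
qed

lemma topspace_type_space [simp]: "topspace Y = S"
proof -
  have "\<Union> (cyl ` Fm) = S"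
  proof
    show "\<Union> (cyl ` Fm) \<subseteq> S" by (auto simp: cyl_def)
    show "S \<subseteq> \<Union> (cyl ` Fm)" using cyl_True by blast
  qed
  then show ?thesis by (simp add: type_space_eq)
qed

lemma openin_cyl: "\<phi> \<in> Fm \<Longrightarrow> openin Y (cyl \<phi>)"
  unfolding type_space_eq by (rule topology_generated_by_Basis) blast

lemma closedin_cyl: "\<phi> \<in> Fm \<Longrightarrow> closedin Y (cyl \<phi>)"
  using openin_cyl[of "Neg \<phi>"] cyl_Neg[of \<phi>] unfolding closedin_def by (auto simp: cyl_def)

text \<open>Closure of the cylinders under intersection turns the generating family into a
  base.\<close>

lemma openin_type_space_base:
  assumes "openin Y U" "p \<in> U"
  obtains \<phi> where "\<phi> \<in> Fm" "\<phi> \<in> p" "cyl \<phi> \<subseteq> U"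
proof -
  have pS: "p \<in> S" using openin_subset[OF assms(1)] assms(2) by auto
  have "generate_topology_on (cyl ` Fm) U"
    using assms(1) unfolding type_space_eq by (rule openin_topology_generated_by)
  then have "\<exists>\<phi>\<in>Fm. \<phi> \<in> p \<and> cyl \<phi> \<subseteq> U"
    using assms(2)
  proof induction
    case (Int A B)
    then obtain \<phi> \<psi> where "\<phi> \<in> Fm" "\<phi> \<in> p" "cyl \<phi> \<subseteq> A" "\<psi> \<in> Fm" "\<psi> \<in> p" "cyl \<psi> \<subseteq> B" by blast
    then show ?case
      using complete_type_Conj_iff[OF complete[OF pS]] cyl_Conj
      by (intro bexI[of _ "Conj \<phi> \<psi>"]) auto
  next
    case (UN K)
    then obtain A where "A \<in> K" "p \<in> A" by blast
    then obtain \<phi> where "\<phi> \<in> Fm" "\<phi> \<in> p" "cyl \<phi> \<subseteq> A" using UN.IH by blast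
    then show ?case using \<open>A \<in> K\<close> by (intro bexI[of _ \<phi>]) auto
  next
    case (Basis A)
    then obtain \<phi> where "\<phi> \<in> Fm" "A = cyl \<phi>" by blast
    then show ?case using Basis by (intro bexI[of _ \<phi>]) (auto simp: cyl_def)
  qed simp
  then show thesis using that by blast
qed

text \<open>Without a finite subcover, \<open>\<pi>\<close> together with the negations of
  \<open>\<Phi>\<close> is finitely satisfiable: a finite part of it lies in a type that avoids the
  corresponding cylinders. A completion of the whole set is then a type in none of the
  cylinders.\<close>

lemma cover_finite_subcover:
  assumes \<Phi>: "\<Phi> \<subseteq> Fm" "S \<subseteq> \<Union> (cyl ` \<Phi>)"
  obtains \<Phi>' where "finite \<Phi>'" "\<Phi>' \<subseteq> \<Phi>" "S \<subseteq> \<Union> (cyl ` \<Phi>')"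
proof (rule ccontr)
  assume "\<not> thesis"
  then have no: "\<not> S \<subseteq> \<Union> (cyl ` \<Phi>')" if "finite \<Phi>'" "\<Phi>' \<subseteq> \<Phi>" for \<Phi>'
    using that \<open>\<not> thesis\<close> \<open>\<And>\<Phi>'. finite \<Phi>' \<Longrightarrow> \<Phi>' \<subseteq> \<Phi> \<Longrightarrow> S \<subseteq> \<Union> (cyl ` \<Phi>') \<Longrightarrow> thesis\<close> by metis
  have "partial_type L M V (universe M) (\<pi> \<union> Neg ` \<Phi>)"
    unfolding partial_type_def
  proof (intro conjI allI impI)
    show "\<pi> \<union> Neg ` \<Phi> \<subseteq> Fm" using \<Phi>(1) \<pi>_subset_Fm by auto
    fix q assume q: "finite q \<and> q \<subseteq> \<pi> \<union> Neg ` \<Phi>"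
    define \<Phi>' where "\<Phi>' = {\<phi> \<in> \<Phi>. Neg \<phi> \<in> q}"
    have "finite (Neg -` q)" using q by (intro finite_vimageI) (auto simp: inj_on_def)
    then have "finite \<Phi>'" by (rule finite_subset[rotated]) (auto simp: \<Phi>'_def)
    moreover have "\<Phi>' \<subseteq> \<Phi>" by (auto simp: \<Phi>'_def)
    ultimately obtain p where p: "p \<in> S" "p \<notin> \<Union> (cyl ` \<Phi>')" using no by blast
    have "\<phi> \<in> p" if \<phi>: "\<phi> \<in> q" for \<phi>
    proof (cases "\<phi> \<in> \<pi>")
      case True
      then show ?thesis using p(1) by (auto simp: mem_S_iff)
    next
      case False
      then obtain \<psi> where "\<psi> \<in> \<Phi>" "\<phi> = Neg \<psi>" using \<phi> q by blast
      moreover from this have "\<psi> \<notin> p" using p \<phi> by (auto simp: cyl_def \<Phi>'_def)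
      ultimately show ?thesis using complete_type_Neg_iff[OF complete[OF p(1)]] \<Phi>(1) by blast
    qed
    then have "q \<subseteq> p" by blast
    moreover have "partial_type L M V (universe M) p" using complete[OF p(1)] by (simp add: complete_type_def)
    ultimately show "\<exists>b. b ` V \<subseteq> universe M \<and> (\<forall>\<phi>\<in>q. holds M b \<phi>)"
      using partial_type_realize[of L M V "universe M" p q] q by metis
  qed
  then obtain p where p: "\<pi> \<union> Neg ` \<Phi> \<subseteq> p" "complete_type L M V (universe M) p"
    using partial_type_extends_to_complete_type by metis
  then have "p \<in> S" by (simp add: mem_S_iff)
  then obtain \<phi> where "\<phi> \<in> \<Phi>" "\<phi> \<in> p" using \<Phi>(2) by (auto simp: cyl_def)
  then show False using complete_type_Neg_iff[OF p(2), of \<phi>] p(1) \<Phi>(1) by blast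
qed

lemma compact_type_space: "compact_space Y"
  unfolding compact_space_alt
proof (intro allI impI, elim conjE)
  fix \<U> assume op: "\<forall>U\<in>\<U>. openin Y U" and cov: "topspace Y \<subseteq> \<Union> \<U>"
  define \<Phi> where "\<Phi> = {\<phi> \<in> Fm. \<exists>U\<in>\<U>. cyl \<phi> \<subseteq> U}"
  have "S \<subseteq> \<Union> (cyl ` \<Phi>)"
  proof
    fix p assume p: "p \<in> S"
    then obtain U where U: "U \<in> \<U>" "p \<in> U" using cov by auto
    then obtain \<phi> where "\<phi> \<in> Fm" "\<phi> \<in> p" "cyl \<phi> \<subseteq> U" using openin_type_space_base op by metis
    then have "\<phi> \<in> \<Phi>" "p \<in> cyl \<phi>" using U p by (auto simp: \<Phi>_def cyl_def)
    then show "p \<in> \<Union> (cyl ` \<Phi>)" by blast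
  qed
  moreover have "\<Phi> \<subseteq> Fm" by (auto simp: \<Phi>_def)
  ultimately obtain \<Phi>' where \<Phi>': "finite \<Phi>'" "\<Phi>' \<subseteq> \<Phi>" "S \<subseteq> \<Union> (cyl ` \<Phi>')"
    using cover_finite_subcover by metis
  have "\<forall>\<phi>\<in>\<Phi>'. \<exists>U. U \<in> \<U> \<and> cyl \<phi> \<subseteq> U" using \<Phi>'(2) by (auto simp: \<Phi>_def)
  from bchoice[OF this] obtain u where u: "\<forall>\<phi>\<in>\<Phi>'. u \<phi> \<in> \<U> \<and> cyl \<phi> \<subseteq> u \<phi>" by blast
  show "\<exists>\<F>. finite \<F> \<and> \<F> \<subseteq> \<U> \<and> topspace Y \<subseteq> \<Union> \<F>"
  proof (intro exI conjI)
    show "finite (u ` \<Phi>')" "u ` \<Phi>' \<subseteq> \<U>" using \<Phi>'(1) u by auto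
    have "\<Union> (cyl ` \<Phi>') \<subseteq> \<Union> (u ` \<Phi>')" using u by blast
    then show "topspace Y \<subseteq> \<Union> (u ` \<Phi>')" using \<Phi>'(3) by simp
  qed
qed

lemma types_separated:
  assumes "p \<in> S" "q \<in> S" "p \<noteq> q"
  obtains \<phi> where "\<phi> \<in> Fm" "\<phi> \<in> p" "\<phi> \<notin> q"
proof -
  have "\<exists>\<phi>. \<phi> \<in> p \<and> \<phi> \<notin> q"
  proof (rule ccontr)
    assume "\<not> ?thesis"
    then have sub: "p \<subseteq> q" by blast
    have "\<phi> \<in> p" if "\<phi> \<in> q" for \<phi>
    proof (rule ccontr)
      assume "\<phi> \<notin> p"
      have F: "\<phi> \<in> Fm" using that S_subset_Fm[OF assms(2)] by blast
      then have "Neg \<phi> \<in> q"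
        using complete_type_Neg_iff[OF complete[OF assms(1)] F] \<open>\<phi> \<notin> p\<close> sub by blast
      then show False using complete_type_Neg_iff[OF complete[OF assms(2)] F] that by blast
    qed
    then show False using sub assms(3) by blast
  qed
  then show thesis using that S_subset_Fm[OF assms(1)] by blast
qed

lemma Hausdorff_type_space: "Hausdorff_space Y"
  unfolding Hausdorff_space_def
proof (intro allI impI)
  fix p q assume "p \<in> topspace Y \<and> q \<in> topspace Y \<and> p \<noteq> q"
  then have pq: "p \<in> S" "q \<in> S" "p \<noteq> q" by auto
  then obtain \<phi> where \<phi>: "\<phi> \<in> Fm" "\<phi> \<in> p" "\<phi> \<notin> q" using types_separated by metis
  show "\<exists>U W. openin Y U \<and> openin Y W \<and> p \<in> U \<and> q \<in> W \<and> disjnt U W"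
  proof (intro exI conjI)
    show "openin Y (cyl \<phi>)" "openin Y (cyl (Neg \<phi>))" using \<phi>(1) by (simp_all add: openin_cyl)
    show "p \<in> cyl \<phi>" "q \<in> cyl (Neg \<phi>)" "disjnt (cyl \<phi>) (cyl (Neg \<phi>))"
      unfolding cyl_Neg[OF \<phi>(1)] using \<phi> pq by (auto simp: cyl_def disjnt_def)
  qed
qed

text \<open>The closed set is compact, hence covered by finitely many cylinders inside
  \<open>U\<close>, and a finite union of cylinders is a cylinder.\<close>

lemma separation_by_formula:
  assumes K: "closedin Y K" and U: "openin Y U" and KU: "K \<subseteq> U"
  obtains \<phi> where "\<phi> \<in> Fm" "K \<subseteq> cyl \<phi>" "cyl \<phi> \<subseteq> U"
proof -
  define \<Phi> where "\<Phi> = {\<phi> \<in> Fm. cyl \<phi> \<subseteq> U}"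
  have cov: "K \<subseteq> \<Union> (cyl ` \<Phi>)"
  proof
    fix p assume p: "p \<in> K"
    then have "p \<in> S" using closedin_subset[OF K] by auto
    obtain \<phi> where "\<phi> \<in> Fm" "\<phi> \<in> p" "cyl \<phi> \<subseteq> U" using openin_type_space_base[OF U] p KU by blast
    then have "\<phi> \<in> \<Phi>" "p \<in> cyl \<phi>" using \<open>p \<in> S\<close> by (auto simp: \<Phi>_def cyl_def)
    then show "p \<in> \<Union> (cyl ` \<Phi>)" by blast
  qed
  have "compactin Y K" using closedin_compact_space[OF compact_type_space K] .
  moreover have "openin Y W" if "W \<in> cyl ` \<Phi>" for W
    using that openin_cyl by (auto simp: \<Phi>_def)
  ultimately have "\<exists>\<F>. finite \<F> \<and> \<F> \<subseteq> cyl ` \<Phi> \<and> K \<subseteq> \<Union> \<F>"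
    using cov by (rule compactinD)
  then obtain \<F> where \<F>: "finite \<F>" "\<F> \<subseteq> cyl ` \<Phi>" "K \<subseteq> \<Union> \<F>" by blast
  obtain \<Phi>' where \<Phi>': "\<Phi>' \<subseteq> \<Phi>" "finite \<Phi>'" "\<F> = cyl ` \<Phi>'"
    using finite_subset_image[OF \<F>(1,2)] by metis
  have "\<Phi>' \<subseteq> Fm" using \<Phi>'(1) by (auto simp: \<Phi>_def)
  then obtain \<psi> where "\<psi> \<in> Fm" "cyl \<psi> = \<Union> (cyl ` \<Phi>')" using cyl_finite_Union \<Phi>'(2) by metis
  then show thesis using that[of \<psi>] \<F>(3) \<Phi>' by (auto simp: \<Phi>_def)
qed

section \<open>The action of automorphisms on types\<close>

lemma Aut_inverse:
  assumes "\<sigma> \<in> Aut"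
  obtains \<tau> where "\<tau> \<in> Aut" "\<tau> \<circ> \<sigma> = id" "\<sigma> \<circ> \<tau> = id"
proof -
  have g: "group (aut_group L M)" using top_group by (simp add: topological_group_def)
  let ?\<tau> = "inv\<^bsub>aut_group L M\<^esub> \<sigma>"
  have \<sigma>: "\<sigma> \<in> carrier (aut_group L M)" using assms by (simp add: aut_group_def)
  have "?\<tau> \<in> Aut" "?\<tau> \<circ> \<sigma> = id" "\<sigma> \<circ> ?\<tau> = id"
    using group.inv_closed[OF g \<sigma>] group.l_inv[OF g \<sigma>] group.r_inv[OF g \<sigma>] by (simp_all add: aut_group_def)
  then show thesis using that by blast
qed

lemma Aut_comp:
  assumes "\<sigma> \<in> Aut" "\<tau> \<in> Aut"
  shows "\<sigma> \<circ> \<tau> \<in> Aut"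
proof -
  have "monoid (aut_group L M)" using top_group by (simp add: topological_group_def group.is_monoid)
  then show ?thesis using monoid.m_closed[of "aut_group L M" \<sigma> \<tau>] assms by (simp add: aut_group_def)
qed

lemma Aut_image: "\<sigma> \<in> Aut \<Longrightarrow> \<sigma> ` universe M = universe M"
  by (simp add: automorphisms_def permutes_image)

lemma mem_type_action_iff:
  assumes "\<tau> \<circ> \<sigma> = id" "\<sigma> \<circ> \<tau> = id"
  shows "\<phi> \<in> type_action \<sigma> p \<longleftrightarrow> map_params \<tau> \<phi> \<in> p"
proof
  assume "\<phi> \<in> type_action \<sigma> p"
  then obtain \<psi> where "\<psi> \<in> p" "\<phi> = map_params \<sigma> \<psi>" by (auto simp: type_action_def)
  then show "map_params \<tau> \<phi> \<in> p" by (simp add: map_params_comp assms)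
next
  assume "map_params \<tau> \<phi> \<in> p"
  moreover have "\<phi> = map_params \<sigma> (map_params \<tau> \<phi>)" by (simp add: map_params_comp assms)
  ultimately show "\<phi> \<in> type_action \<sigma> p" unfolding type_action_def by (rule rev_image_eqI)
qed

lemma type_action_in_S:
  assumes \<sigma>: "\<sigma> \<in> Aut" and p: "p \<in> S"
  shows "type_action \<sigma> p \<in> S"
  unfolding mem_S_iff complete_type_def
proof (intro conjI ballI subsetI)
  obtain \<tau> where \<tau>: "\<tau> \<in> Aut" "\<tau> \<circ> \<sigma> = id" "\<sigma> \<circ> \<tau> = id" using Aut_inverse[OF \<sigma>] by metis
  have el: "elem_equiv L (universe M) M id M \<sigma>"
    using elem_equiv_automorphism[OF struct \<sigma>, of id "universe M"] by simp
  show "partial_type L M V (universe M) (type_action \<sigma> p)"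
    unfolding type_action_def
    by (rule partial_type_map[OF _ el])
      (use complete[OF p] Aut_image[OF \<sigma>] universe_nonempty in \<open>auto simp: complete_type_def\<close>)
  fix \<phi>
  show "\<phi> \<in> type_action \<sigma> p \<or> Neg \<phi> \<in> type_action \<sigma> p" if "\<phi> \<in> Fm"
  proof -
    have "map_params \<tau> \<phi> \<in> Fm" by (rule map_params_in_formulas[OF that]) (simp add: Aut_image[OF \<tau>(1)])
    then have "map_params \<tau> \<phi> \<in> p \<or> Neg (map_params \<tau> \<phi>) \<in> p"
      using complete[OF p] by (simp add: complete_type_def)
    then show ?thesis unfolding mem_type_action_iff[OF \<tau>(2,3)] map_params_Neg .
  qed
  show "\<phi> \<in> type_action \<sigma> p" if "\<phi> \<in> \<pi>"
  proof -
    have "\<phi> \<in> formulas L V {}" using that partial by (auto simp: partial_type_def)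
    then have "map_params \<tau> \<phi> = map_params id \<phi>" by (rule map_params_cong) simp
    then show ?thesis unfolding mem_type_action_iff[OF \<tau>(2,3)] using that p by (auto simp: mem_S_iff)
  qed
qed

lemma openin_aut_topology_agree:
  assumes "finite A"
  shows "openin (aut_topology L M) {h \<in> Aut. \<forall>a\<in>A. h a = g a}"
proof -
  let ?P = "product_topology (\<lambda>_. discrete_topology UNIV) UNIV :: ('a \<Rightarrow> 'a) topology"
  have "openin ?P {h \<in> topspace ?P. h a \<in> {g a}}" for a
    by (rule openin_continuous_map_preimage[OF continuous_map_product_projection]) auto
  then have "openin ?P (topspace ?P \<inter> (\<Inter>a\<in>A. {h \<in> topspace ?P. h a \<in> {g a}}))"
    using assms by (cases "A = {}") (auto intro!: openin_Int openin_INT2 simp del: topspace_product_topology)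
  moreover have "{h \<in> Aut. \<forall>a\<in>A. h a = g a} = (topspace ?P \<inter> (\<Inter>a\<in>A. {h \<in> topspace ?P. h a \<in> {g a}})) \<inter> Aut"
    by auto
  ultimately show ?thesis unfolding aut_topology_def openin_subtopology by blast
qed

lemma is_flow_type_space: "is_flow (aut_group L M) (aut_topology L M) Y type_action"
  unfolding is_flow_def
proof (intro conjI ballI)
  show "topological_group (aut_group L M) (aut_topology L M)" by (rule top_group)
  show "compact_space Y" "Hausdorff_space Y" by (rule compact_type_space, rule Hausdorff_type_space)
  show "type_action \<one>\<^bsub>aut_group L M\<^esub> p = p" for p
    by (simp add: type_action_def aut_group_def)
  show "type_action (g \<otimes>\<^bsub>aut_group L M\<^esub> h) p = type_action g (type_action h p)" for g h p
    by (simp add: type_action_def aut_group_def image_image map_params_comp)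
  have topA: "topspace (aut_topology L M) = Aut"
    using top_group by (simp add: topological_group_def aut_group_def)
  have "continuous_map (prod_topology (aut_topology L M) Y) (topology_generated_by (cyl ` Fm)) (\<lambda>(g, y). type_action g y)"
  proof (rule continuous_on_generated_topo)
    fix U assume "U \<in> cyl ` Fm"
    then obtain \<phi> where \<phi>: "\<phi> \<in> Fm" "U = cyl \<phi>" by blast
    let ?W = "(\<lambda>(g, y). type_action g y) -` U \<inter> topspace (prod_topology (aut_topology L M) Y)"
    show "openin (prod_topology (aut_topology L M) Y) ?W"
      unfolding openin_prod_topology_alt
    proof (intro allI impI)
      fix g p assume "(g, p) \<in> ?W"
      then have g: "g \<in> Aut" and p: "p \<in> S" and gp: "\<phi> \<in> type_action g p"
        unfolding \<phi>(2) by (auto simp: cyl_def topA)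
      then obtain \<psi> where \<psi>: "\<psi> \<in> p" "\<phi> = map_params g \<psi>" by (auto simp: type_action_def)
      have \<psi>F: "\<psi> \<in> Fm" using \<psi>(1) S_subset_Fm[OF p] by blast
      \<comment> \<open>A formula has finitely many parameters, and an automorphism that agrees with
        \<open>g\<close> on them still sends \<open>\<psi>\<close> to \<open>\<phi>\<close>.\<close>
      let ?N = "{h \<in> Aut. \<forall>a\<in>params \<psi>. h a = g a}"
      have sub: "?N \<times> cyl \<psi> \<subseteq> ?W"
      proof
        fix x assume "x \<in> ?N \<times> cyl \<psi>"
        then obtain h p' where x: "x = (h, p')" "h \<in> Aut" "\<forall>a\<in>params \<psi>. h a = g a" "p' \<in> S" "\<psi> \<in> p'"
          by (auto simp: cyl_def)
        have "map_params h \<psi> = \<phi>"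
          unfolding \<psi>(2) by (rule map_params_cong[OF formulas_params[OF \<psi>F]]) (use x in auto)
        then have "\<phi> \<in> type_action h p'" using x(5) unfolding type_action_def by blast
        then show "x \<in> ?W" unfolding \<phi>(2) using x type_action_in_S[OF x(2,4)] by (simp add: cyl_def topA)
      qed
      show "\<exists>A B. openin (aut_topology L M) A \<and> openin Y B \<and> g \<in> A \<and> p \<in> B \<and> A \<times> B \<subseteq> ?W"
      proof (intro exI conjI)
        show "openin (aut_topology L M) ?N" by (rule openin_aut_topology_agree[OF finite_params])
        show "openin Y (cyl \<psi>)" by (rule openin_cyl[OF \<psi>F])
        show "?N \<times> cyl \<psi> \<subseteq> ?W" by (rule sub)
      qed (use g p \<psi> in \<open>auto simp: cyl_def\<close>)
    qed
  next
    have "\<Union> (cyl ` Fm) = S" using topspace_type_space unfolding type_space_eq by simp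
    then show "(\<lambda>(g, y). type_action g y) ` topspace (prod_topology (aut_topology L M) Y) \<subseteq> \<Union> (cyl ` Fm)"
      using type_action_in_S by (auto simp: topA)
  qed
  then show "continuous_map (prod_topology (aut_topology L M) Y) Y (\<lambda>(g, y). type_action g y)"
    by (simp only: type_space_eq)
qed

end

section \<open>Elementary extensions\<close>

text \<open>Saturation and homogeneity are applied to countable sets of parameters, which lie below
  this cardinal.\<close>

lemma countable_ordLess_cardSuc:
  assumes "countable A"
  shows "|A| <o cardSuc (natLeq +c |V| )"
proof -
  obtain f :: "'a \<Rightarrow> nat" where "inj_on f A" using assms by (auto simp: countable_def)
  then have "|A| \<le>o |UNIV :: nat set|" using card_of_ordLeq[of A "UNIV :: nat set"] by blast
  then have "|A| \<le>o natLeq" using card_of_nat by (rule ordLeq_ordIso_trans)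
  moreover have "natLeq \<le>o natLeq +c |V|" by (rule ordLeq_csum1[OF natLeq_Card_order])
  moreover have "natLeq +c |V| <o cardSuc (natLeq +c |V| )" by (rule cardSuc_greater[OF Card_order_csum])
  ultimately show ?thesis by (metis ordLeq_transitive ordLeq_ordLess_trans)
qed

lemma partial_elementary_map_if_elem_equiv:
  fixes L :: "('f, 'r) fo_language" and M :: "('f, 'r, 'a) fo_structure"
  assumes "A \<subseteq> universe M" "h ` A \<subseteq> universe M" "elem_equiv L A M id M h"
  shows "partial_elementary_map L M A (h ` A) h"
  unfolding partial_elementary_map_def
proof (intro conjI ballI)
  fix \<phi> :: "('f, 'r, unit, 'a) pfm" assume "\<phi> \<in> formulas L {} A"
  then have \<phi>: "\<phi> \<in> fms L (Inr ` A)" by (simp add: formulas_eq_fms)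
  have "elem_equiv L (Inr ` A :: (unit + 'a) set) M (id \<circ> projr) M (h \<circ> projr)"
    by (rule elem_equiv_rename[OF assms(3)]) auto
  then have "sat0 M (id \<circ> projr) \<phi> = sat0 M (h \<circ> projr) \<phi>" using \<phi> unfolding elem_equiv_def by blast
  moreover have "sat0 M (id \<circ> projr) \<phi> = sat0 M (case_sum (\<lambda>_. undefined) id) \<phi>"
    by (rule sat0_cong[OF \<phi>]) auto
  moreover have "sat0 M (h \<circ> projr) \<phi> = sat0 M (case_sum (\<lambda>_. undefined) h) \<phi>"
    by (rule sat0_cong[OF \<phi>]) auto
  ultimately show "holds M (\<lambda>_. undefined) \<phi> = holds M (\<lambda>_. undefined) (map_params h \<phi>)"
    unfolding holds_map_params unfolding holds_def by (simp only:)
qed (use assms in simp_all)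

lemma elementary_substructure_imp_elem_equiv:
  fixes C C' :: "('f, 'r, 'a) fo_structure"
  assumes elementary: "elementary_substructure L C C'" and A: "A \<subseteq> universe C"
  shows "elem_equiv L A C id C' id"
  unfolding elem_equiv_def
proof
  fix \<phi> assume "\<phi> \<in> fms L A"
  then have "map_fm Inr \<phi> \<in> formulas L ({} :: unit set) (universe C)"
    unfolding formulas_eq_fms using A by (intro map_fm_in_fms) auto
  then have "holds C (\<lambda>_. undefined) (map_fm (Inr :: 'a \<Rightarrow> unit + 'a) \<phi>)
      = holds C' (\<lambda>_. undefined) (map_fm (Inr :: 'a \<Rightarrow> unit + 'a) \<phi>)"
    using elementary unfolding elementary_substructure_def by blast
  moreover have "case_sum (\<lambda>_ :: unit. undefined) id \<circ> Inr = (id :: 'a \<Rightarrow> 'a)" by auto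
  ultimately show "sat0 C id \<phi> = sat0 C' id \<phi>" unfolding holds_def sat_map by (simp only:)
qed

lemma automorphism_extending:
  fixes V :: "'x set"
  assumes "strongly_homogeneous L (cardSuc (natLeq +c |V| )) M" "countable A"
    "A \<subseteq> universe M" "h ` A \<subseteq> universe M" "elem_equiv L A M id M h"
  obtains \<sigma> where "\<sigma> \<in> automorphisms L M" "\<And>a. a \<in> A \<Longrightarrow> \<sigma> a = h a"
proof -
  have "|A| <o cardSuc (natLeq +c |V| )" "|h ` A| <o cardSuc (natLeq +c |V| )"
    using assms(2) by (simp_all add: countable_ordLess_cardSuc)
  then have "\<exists>\<sigma>\<in>automorphisms L M. \<forall>a\<in>A. \<sigma> a = h a"
    using assms(1) partial_elementary_map_if_elem_equiv[OF assms(3-5)]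
    unfolding strongly_homogeneous_def by blast
  then show thesis using that by blast
qed

locale type_flow_extension =
  small: type_flow L C V \<pi> + big: type_flow L C' V \<pi>
  for L :: "('f, 'r) fo_language" and C C' :: "('f, 'r, 'a) fo_structure" and V :: "'x set"
    and \<pi> :: "('f, 'r, 'x, 'a) pfm set" +
  assumes elementary: "elementary_substructure L C C'"
    and saturated: "saturated L (cardSuc (natLeq +c |V| )) C"
    and homogeneous: "strongly_homogeneous L (cardSuc (natLeq +c |V| )) C"
    and homogeneous': "strongly_homogeneous L (cardSuc (natLeq +c |V| )) C'"
begin

section \<open>Restriction and lifting of types\<close>

abbreviation "r \<equiv> restrict_type L C V"

lemma universe_subset: "universe C \<subseteq> universe C'"
  using elementary by (simp add: elementary_substructure_def)

lemmas elem_equiv_id = elementary_substructure_imp_elem_equiv[OF elementary]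

lemma elem_equiv_same_assignment:
  assumes "e ` I \<subseteq> universe C"
  shows "elem_equiv L I C e C' e"
  using elem_equiv_rename[OF elem_equiv_id[OF assms], of e I] by simp

lemma elem_equiv_small_iff_big:
  assumes "D \<subseteq> universe C" "h ` D \<subseteq> universe C"
  shows "elem_equiv L D C id C h \<longleftrightarrow> elem_equiv L D C' id C' h"
  using elem_equiv_id[OF assms(1)] elem_equiv_same_assignment[OF assms(2)] elem_equiv_sym elem_equiv_trans
  by metis

lemma Fm_subset: "small.Fm \<subseteq> big.Fm"
  by (rule formulas_mono[OF universe_subset])

text \<open>Finite satisfiability of the restriction is known in \<open>C'\<close>; as its
  parameters lie in \<open>C\<close>, elementarity brings it down.\<close>

lemma restrict_in_S:
  assumes "p \<in> big.S"
  shows "r p \<in> small.S"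
  unfolding small.mem_S_iff complete_type_def
proof (intro conjI ballI)
  have p: "partial_type L C' V (universe C') p" using big.complete[OF assms] by (simp add: complete_type_def)
  then have "partial_type L C' V (universe C) (r p)"
    by (auto simp: partial_type_def restrict_type_def)
  then have "partial_type L C V (universe C) (map_params id ` r p)"
    by (rule partial_type_map[OF _ elem_equiv_sym[OF elem_equiv_id]]) (simp_all add: small.universe_nonempty)
  then show "partial_type L C V (universe C) (r p)" by simp
  show "\<phi> \<in> r p \<or> Neg \<phi> \<in> r p" if "\<phi> \<in> small.Fm" for \<phi>
  proof -
    have "\<phi> \<in> p \<or> Neg \<phi> \<in> p" using big.complete[OF assms] that Fm_subset unfolding complete_type_def by blast
    then show ?thesis using that by (simp add: restrict_type_def)
  qed
  show "\<pi> \<subseteq> r p" using assms small.\<pi>_subset_Fm by (simp add: big.mem_S_iff restrict_type_def)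
qed

lemma subset_restrict_imp_eq:
  assumes "p \<in> small.S" "a \<in> big.S" "p \<subseteq> a"
  shows "r a = p"
proof (rule ccontr)
  assume "r a \<noteq> p"
  then obtain \<phi> where "\<phi> \<in> small.Fm" "\<phi> \<in> p" "\<phi> \<notin> r a"
    using small.types_separated[OF assms(1) restrict_in_S[OF assms(2)]] by metis
  then show False using assms(3) by (auto simp: restrict_type_def)
qed

text \<open>A type over \<open>C\<close> stays finitely satisfiable in \<open>C'\<close>, and any
  completion over \<open>C'\<close> restricts to it, because complete types over \<open>C\<close>
  contained in one another are equal.\<close>

lemma lift_exists:
  assumes "p \<in> small.S"
  obtains a where "a \<in> big.S" "r a = p" "p \<subseteq> a"
proof -
  have "partial_type L C V (universe C) p"
    using small.complete[OF assms] by (simp add: complete_type_def)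
  then have "partial_type L C' V (universe C') (map_params id ` p)"
    by (rule partial_type_map[OF _ elem_equiv_id]) (simp_all add: universe_subset big.universe_nonempty)
  then obtain a where a: "p \<subseteq> a" "complete_type L C' V (universe C') a"
    using partial_type_extends_to_complete_type by (metis image_cong image_ident map_params_id)
  then have "a \<in> big.S" using assms by (auto simp: big.mem_S_iff small.mem_S_iff)
  then show thesis using that a(1) subset_restrict_imp_eq[OF assms] by blast
qed

lemma quotient_map_restrict: "quotient_map big.Y small.Y r"
proof (rule continuous_imp_quotient_map[OF _ big.compact_type_space small.Hausdorff_type_space])
  have "continuous_map big.Y (topology_generated_by (small.cyl ` small.Fm)) r"
  proof (rule continuous_on_generated_topo)
    fix U assume "U \<in> small.cyl ` small.Fm"
    then obtain \<phi> where \<phi>: "\<phi> \<in> small.Fm" "U = small.cyl \<phi>" by blast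
    have "r -` U \<inter> topspace big.Y = big.cyl \<phi>"
      using \<phi> restrict_in_S by (auto simp: small.cyl_def big.cyl_def restrict_type_def)
    then show "openin big.Y (r -` U \<inter> topspace big.Y)" using big.openin_cyl \<phi>(1) Fm_subset by auto
  next
    have "\<Union> (small.cyl ` small.Fm) = small.S"
      using small.topspace_type_space unfolding small.type_space_eq by simp
    then show "r ` topspace big.Y \<subseteq> \<Union> (small.cyl ` small.Fm)" using restrict_in_S by auto
  qed
  then show "continuous_map big.Y small.Y r" by (simp only: small.type_space_eq)
  show "r ` topspace big.Y = topspace small.Y"
  proof
    show "r ` topspace big.Y \<subseteq> topspace small.Y" using restrict_in_S by auto
    show "topspace small.Y \<subseteq> r ` topspace big.Y"
    proof
      fix p assume "p \<in> topspace small.Y"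
      then have "p \<in> small.S" by simp
      then obtain a where "a \<in> big.S" "r a = p" using lift_exists by metis
      then show "p \<in> r ` topspace big.Y" by auto
    qed
  qed
qed

text \<open>The tuple \<open>x\<close> is realized in \<open>C\<close> one entry at a time, so that only types in one variable
  over finite sets have to be realized.\<close>

lemma realize_sequence:
  assumes D: "finite D" "D \<subseteq> universe C" and x: "\<And>n::nat. x n \<in> universe C'"
  obtains y where "\<And>n. y n \<in> universe C"
    "elem_equiv L (Inl ` D \<union> range Inr) C' (case_sum id x) C (case_sum id y)"
proof -
  \<comment> \<open>Variables \<open>Inl d\<close> stand for the fixed element \<open>d\<close>
    itself, variables \<open>Inr i\<close> for the entry with index \<open>i\<close>.\<close>
  define good where "good ys \<longleftrightarrow>
    elem_equiv L (Inl ` D \<union> Inr ` {..<length ys}) C' (case_sum id x) C (case_sum id ((!) ys))" for ys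
  have step: "\<exists>y\<in>universe C. good ys \<longrightarrow> good (ys @ [y])" if ys: "set ys \<subseteq> universe C" for ys
  proof (cases "good ys")
    case False
    then show ?thesis using small.universe_nonempty by blast
  next
    case True
    define n where "n = length ys"
    define I where "I = Inl ` D \<union> Inr ` {..<n}"
    define I' where "I' = insert (Inr n) I"
    define A where "A = D \<union> set ys"
    \<comment> \<open>Turns formulas about the sequence into formulas in one variable over
      \<open>A\<close>: fixed elements and earlier entries become parameters, the new entry becomes
      the variable. Repeated entries can make \<open>f\<close> non-injective, so formulas are pulled
      back below by \<open>inv_into\<close>.\<close>
    define f where "f = case_sum Inr (\<lambda>i. if i = n then Inl (0::nat) else Inr (ys ! i))"
    have eq: "elem_equiv L I C' (case_sum id x) C (case_sum id ((!) ys))"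
      using True by (simp add: good_def I_def n_def)
    have fI: "f ` I' = Inl ` {..<1} \<union> Inr ` A"
    proof -
      have "f ` Inl ` D = Inr ` D" by (simp add: f_def image_image)
      moreover have "f ` Inr ` {..<n} = Inr ` set ys"
        by (simp add: f_def image_image n_def set_conv_nth) (auto simp: image_iff)
      moreover have "f (Inr n) = Inl 0" by (simp add: f_def)
      ultimately show ?thesis unfolding I'_def I_def A_def image_insert image_Un by auto
    qed
    have case_f: "(case_sum b id \<circ> f) v = case_sum id ((!) (ys @ [b 0])) v" if "v \<in> I'" for b :: "nat \<Rightarrow> 'a" and v
      using that by (auto simp: I'_def I_def f_def n_def nth_append)
    have holds_f: "holds C b (map_fm f \<theta>) = sat0 C (case_sum id ((!) (ys @ [b 0]))) \<theta>"
      if "\<theta> \<in> fms L I'" for b :: "nat \<Rightarrow> 'a" and \<theta>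
      unfolding holds_def sat_map by (rule sat0_cong[OF that case_f])
    \<comment> \<open>What \<open>x n\<close> satisfies over \<open>D\<close> and the earlier
      entries of \<open>x\<close>, rewritten with \<open>ys\<close> in place of those
      entries.\<close>
    define p where "p = map_fm f ` {\<theta> \<in> fms L I'. sat0 C' (case_sum id x) \<theta>}"
    have "complete_type L C {..<1} A p"
      unfolding complete_type_def partial_type_def
    proof (intro conjI allI impI ballI)
      show "p \<subseteq> formulas L {..<1} A"
        unfolding p_def formulas_eq_fms using map_fm_in_fms[of _ L I' f] fI by auto
    next
      fix q assume "finite q \<and> q \<subseteq> p"
      then have "finite q" "q \<subseteq> map_fm f ` {\<theta> \<in> fms L I'. sat0 C' (case_sum id x) \<theta>}"
        unfolding p_def by blast+
      from finite_subset_image[OF this] obtain q0 where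
        q0: "finite q0" "q0 \<subseteq> {\<theta> \<in> fms L I'. sat0 C' (case_sum id x) \<theta>}" "q = map_fm f ` q0" by blast
      have q0': "q0 \<subseteq> fms L (I \<union> {Inr n})" using q0(2) by (auto simp: I'_def)
      \<comment> \<open>Finite satisfiability in \<open>C\<close>: the equivalence reached so far
        extends by a witness for finitely many formulas.\<close>
      obtain b' where b': "\<And>v. v \<in> I \<Longrightarrow> b' v = case_sum id ((!) ys) v" "b' ` {Inr n} \<subseteq> universe C"
        "\<forall>\<theta>\<in>q0. sat0 C b' \<theta>"
      proof (rule elem_equiv_extend[OF eq q0(1) q0' _ small.universe_nonempty, of "case_sum id x"])
        show "I \<inter> {Inr n} = {}" by (auto simp: I_def)
      qed (use q0(2) x in auto)
      have "holds C (\<lambda>_. b' (Inr n)) (map_fm f \<theta>)" if "\<theta> \<in> q0" for \<theta>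
      proof -
        have \<theta>: "\<theta> \<in> fms L I'" using that q0(2) by blast
        have "sat0 C b' \<theta> = sat0 C (case_sum id ((!) (ys @ [b' (Inr n)]))) \<theta>"
          by (rule sat0_cong[OF \<theta>]) (use b'(1) in \<open>auto simp: I'_def I_def n_def nth_append\<close>)
        then show ?thesis unfolding holds_f[OF \<theta>] using b'(3) that by blast
      qed
      then show "\<exists>b. b ` {..<1} \<subseteq> universe C \<and> (\<forall>\<phi>\<in>q. holds C b \<phi>)"
        unfolding q0(3) using b'(2) by (intro exI[of _ "\<lambda>_. b' (Inr n)"]) auto
    next
      fix \<phi> :: "('f, 'r, nat, 'a) pfm" assume "\<phi> \<in> formulas L {..<1} A"
      then have \<phi>: "\<phi> \<in> fms L (f ` I')" unfolding formulas_eq_fms fI .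
      define \<theta> where "\<theta> = map_fm (inv_into I' f) \<phi>"
      have \<theta>: "\<theta> \<in> fms L I'"
        unfolding \<theta>_def by (rule map_fm_in_fms[OF \<phi>]) (auto intro: inv_into_into)
      have "map_fm f \<theta> = map_fm id \<phi>"
        unfolding \<theta>_def fm.map_comp
        by (rule fm.map_cong[OF refl]) (use \<phi> in \<open>auto simp: fms_def f_inv_into_f subset_iff\<close>)
      then have \<phi>\<theta>: "map_fm f \<theta> = \<phi>" by (simp add: fm.map_id)
      show "\<phi> \<in> p \<or> Neg \<phi> \<in> p"
      proof (cases "sat0 C' (case_sum id x) \<theta>")
        case True
        then have "map_fm f \<theta> \<in> p" using \<theta> unfolding p_def by blast
        then show ?thesis using \<phi>\<theta> by simp
      next
        case False
        then have "Neg \<theta> \<in> {\<theta> \<in> fms L I'. sat0 C' (case_sum id x) \<theta>}" using \<theta> by simp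
        then have "map_fm f (Neg \<theta>) \<in> p" unfolding p_def by (rule imageI)
        then show ?thesis using \<phi>\<theta> by simp
      qed
    qed
    moreover have "A \<subseteq> universe C" "|A| <o cardSuc (natLeq +c |V| )"
      using D ys by (auto simp: A_def intro!: countable_ordLess_cardSuc countable_finite)
    ultimately obtain b where b: "b ` {..<1::nat} \<subseteq> universe C" "\<forall>\<phi>\<in>p. holds C b \<phi>"
    proof -
      have "A \<subseteq> universe C \<and> |A| <o cardSuc (natLeq +c |V| ) \<and> complete_type L C {..<1} A p
          \<longrightarrow> (\<exists>b. b ` {..<1::nat} \<subseteq> universe C \<and> (\<forall>\<phi>\<in>p. holds C b \<phi>))"
        using saturated unfolding saturated_def by (elim allE)
      moreover assume "complete_type L C {..<1} A p" "A \<subseteq> universe C" "|A| <o cardSuc (natLeq +c |V| )"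
      moreover assume "\<And>b. b ` {..<1::nat} \<subseteq> universe C \<Longrightarrow> \<forall>\<phi>\<in>p. holds C b \<phi> \<Longrightarrow> thesis"
      ultimately show thesis by blast
    qed
    have imp: "sat0 C (case_sum id ((!) (ys @ [b 0]))) \<theta>" if "\<theta> \<in> fms L I'" "sat0 C' (case_sum id x) \<theta>" for \<theta>
    proof -
      have "map_fm f \<theta> \<in> p" using that unfolding p_def by blast
      then show ?thesis using b(2) holds_f[OF that(1)] by blast
    qed
    have "elem_equiv L I' C' (case_sum id x) C (case_sum id ((!) (ys @ [b 0])))"
      unfolding elem_equiv_def
    proof
      fix \<theta> :: "('f, 'r, 'a + nat) fm" assume \<theta>: "\<theta> \<in> fms L I'"
      show "sat0 C' (case_sum id x) \<theta> = sat0 C (case_sum id ((!) (ys @ [b 0]))) \<theta>"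
        using imp[OF \<theta>] imp[of "Neg \<theta>"] \<theta> by auto
    qed
    moreover have "Inl ` D \<union> Inr ` {..<length (ys @ [b 0])} = I'"
      by (auto simp: I'_def I_def n_def less_Suc_eq)
    ultimately have "good (ys @ [b 0])" unfolding good_def by (simp only:)
    then show ?thesis using b(1) by auto
  qed
  obtain y where y: "\<And>n. y n \<in> universe C" "\<And>n. good (map y [0..<n]) \<longrightarrow> good (map y [0..<n] @ [y n])"
    using sequence_with_history[of "universe C" "\<lambda>ys y. good ys \<longrightarrow> good (ys @ [y])"] step by metis
  have "good (map y [0..<n])" for n
  proof (induction n)
    case 0
    have "elem_equiv L (Inl ` D :: ('a + nat) set) C (id \<circ> projl) C' (id \<circ> projl)"
      by (rule elem_equiv_rename[OF elem_equiv_id[OF D(2)]]) auto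
    then have "elem_equiv L (Inl ` D :: ('a + nat) set) C' (id \<circ> projl) C (id \<circ> projl)"
      by (rule elem_equiv_sym)
    then have "elem_equiv L (Inl ` D :: ('a + nat) set) C' (case_sum id x) C (case_sum id ((!) []))"
      by (rule elem_equiv_cong) auto
    then show ?case by (simp add: good_def)
  next
    case (Suc n)
    then show ?case using y(2)[of n] by simp
  qed
  note good_y = this
  have "elem_equiv L (Inl ` D \<union> range Inr) C' (case_sum id x) C (case_sum id y)"
    unfolding elem_equiv_def
  proof
    fix \<theta> :: "('f, 'r, 'a + nat) fm" assume \<theta>: "\<theta> \<in> fms L (Inl ` D \<union> range Inr)"
    \<comment> \<open>A formula mentions finitely many entries, so the equivalences for the initial
      segments yield the one for the whole sequence.\<close>
    have "finite {i. Inr i \<in> fm_vars \<theta>}"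
      using finite_vimageI[OF finite_fm_vars, of Inr \<theta>] by (simp add: vimage_def)
    then obtain n where n: "\<And>i. Inr i \<in> fm_vars \<theta> \<Longrightarrow> i < n"
      using finite_nat_set_iff_bounded by auto
    have \<theta>n: "\<theta> \<in> fms L (Inl ` D \<union> Inr ` {..<n})"
    proof -
      have "v \<in> Inl ` D \<union> Inr ` {..<n}" if v: "v \<in> fm_vars \<theta>" for v
      proof (cases v)
        case (Inl a)
        have "v \<in> Inl ` D \<union> range Inr" using v \<theta> by (auto simp: fms_def)
        then show ?thesis using Inl by auto
      next
        case (Inr i)
        then show ?thesis using n v by simp
      qed
      then have "fm_vars \<theta> \<subseteq> Inl ` D \<union> Inr ` {..<n}" by blast
      then show ?thesis using \<theta> by (simp add: fms_def)
    qed
    have "sat0 C' (case_sum id x) \<theta> = sat0 C (case_sum id ((!) (map y [0..<n]))) \<theta>"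
      using good_y[of n] \<theta>n unfolding good_def elem_equiv_def by simp
    also have "\<dots> = sat0 C (case_sum id y) \<theta>"
      by (rule sat0_cong[OF \<theta>n]) auto
    finally show "sat0 C' (case_sum id x) \<theta> = sat0 C (case_sum id y) \<theta>" .
  qed
  then show thesis using that y(1) by blast
qed

text \<open>Enumerate \<open>E\<close>, realize the type of this sequence over \<open>D\<close> in
  \<open>C\<close>, and let homogeneity of \<open>C'\<close> extend the resulting map. The map is
  elementary within \<open>C'\<close> because its values lie in the elementary substructure
  \<open>C\<close>.\<close>

lemma move_into_small:
  assumes E: "countable E" "E \<subseteq> universe C'" and D: "finite D" "D \<subseteq> universe C"
  obtains \<sigma> where "\<sigma> \<in> big.Aut" "\<sigma> ` E \<subseteq> universe C" "\<And>d. d \<in> D \<Longrightarrow> \<sigma> d = d"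
proof -
  \<comment> \<open>\<open>E\<close> may be empty, while an enumeration needs a member; an element
    of \<open>C\<close> does no harm.\<close>
  obtain c where c: "c \<in> universe C" using small.universe_nonempty by blast
  define x where "x = from_nat_into (insert c E)"
  have x: "range x = insert c E" using E(1) by (simp add: x_def range_from_nat_into)
  have "insert c E \<subseteq> universe C'" using E(2) c universe_subset by blast
  then have "x n \<in> universe C'" for n using x by (metis rangeI subsetD)
  then obtain y where y: "\<And>n. y n \<in> universe C"
    "elem_equiv L (Inl ` D \<union> range Inr) C' (case_sum id x) C (case_sum id y)"
    using realize_sequence[OF D] by metis
  \<comment> \<open>Elements of \<open>D\<close> keep their fixed name even if they also occur in
    \<open>E\<close>; all others get one of their indices.\<close>
  define g where "g a = (if a \<in> D then Inl a else Inr (SOME i. x i = a))" for a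
  let ?A = "D \<union> E"
  define h where "h = case_sum id y \<circ> g"
  have gx: "(case_sum id x \<circ> g) a = id a" if "a \<in> ?A" for a
  proof (cases "a \<in> D")
    case False
    then have "\<exists>i. x i = a" using that x by (metis UnE insertI2 rangeE)
    then have "x (SOME i. x i = a) = a" by (rule someI_ex)
    then show ?thesis using False by (simp add: g_def)
  qed (simp add: g_def)
  have hC: "h ` ?A \<subseteq> universe C" using y(1) D(2) by (auto simp: h_def g_def)
  have "elem_equiv L ?A C' (case_sum id x \<circ> g) C (case_sum id y \<circ> g)"
    by (rule elem_equiv_rename[OF y(2)]) (auto simp: g_def)
  then have "elem_equiv L ?A C' id C h"
    unfolding h_def[symmetric] by (rule elem_equiv_cong) (use gx in auto)
  then have el: "elem_equiv L ?A C' id C' h"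
    using elem_equiv_same_assignment[OF hC] by (rule elem_equiv_trans)
  have "countable ?A" "?A \<subseteq> universe C'" "h ` ?A \<subseteq> universe C'"
    using E D universe_subset hC by (auto simp: countable_finite)
  then obtain \<sigma> where \<sigma>: "\<sigma> \<in> big.Aut" "\<And>a. a \<in> ?A \<Longrightarrow> \<sigma> a = h a"
    using automorphism_extending[OF homogeneous' _ _ _ el] by metis
  show thesis
  proof
    show "\<sigma> \<in> big.Aut" by (rule \<sigma>(1))
    show "\<sigma> ` E \<subseteq> universe C" using \<sigma>(2) hC by auto
    show "\<sigma> d = d" if "d \<in> D" for d using \<sigma>(2)[of d] that by (simp add: h_def g_def)
  qed
qed

end

section \<open>Transfer of stable functions\<close>

lemma stable_function_const: "stable_function G Y act (\<lambda>_. c)"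
proof -
  have "\<not> order_property ((\<lambda>g y. (\<lambda>_. c) (act g y)) ` carrier G) (topspace Y)"
    unfolding order_property_orbit_iff[of "\<lambda>_. c" act G "topspace Y"]
  proof (intro notI, elim exE conjE)
    fix g :: "nat \<Rightarrow> 'a" and y :: "nat \<Rightarrow> 'c" and \<epsilon> :: real
    assume "0 < \<epsilon>" and le: "\<forall>n m::nat. n < m \<longrightarrow> \<epsilon> \<le> \<bar>c - c\<bar>"
    have "\<epsilon> \<le> \<bar>c - c\<bar>" by (rule le[rule_format, of 0 1]) simp
    then show False using \<open>0 < \<epsilon>\<close> by simp
  qed
  then show ?thesis by (simp add: stable_function_def)
qed

context type_flow
begin

text \<open>The closed set where \<open>f\<close> is within \<open>\<epsilon>\<close> of
  \<open>u\<close> lies in the open set where it is within \<open>\<delta>\<close>; the slack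
  between the radii makes room for a clopen set, which is a cylinder.\<close>

lemma level_formula:
  assumes f: "continuous_map Y euclideanreal f" and "\<epsilon> < (\<delta> :: real)"
  obtains \<phi> where "\<phi> \<in> Fm" "\<And>p. p \<in> S \<Longrightarrow> \<bar>f p - u\<bar> \<le> \<epsilon> \<Longrightarrow> \<phi> \<in> p"
    "\<And>p. p \<in> S \<Longrightarrow> \<phi> \<in> p \<Longrightarrow> \<bar>f p - u\<bar> < \<delta>"
proof -
  have "closedin Y {p \<in> topspace Y. f p \<in> cball u \<epsilon>}"
    by (rule closedin_continuous_map_preimage[OF f]) simp
  moreover have "openin Y {p \<in> topspace Y. f p \<in> ball u \<delta>}"
    by (rule openin_continuous_map_preimage[OF f]) simp
  moreover have "{p \<in> topspace Y. f p \<in> cball u \<epsilon>} \<subseteq> {p \<in> topspace Y. f p \<in> ball u \<delta>}"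
    using assms(2) by auto
  ultimately obtain \<phi> where \<phi>: "\<phi> \<in> Fm" "{p \<in> topspace Y. f p \<in> cball u \<epsilon>} \<subseteq> cyl \<phi>"
    "cyl \<phi> \<subseteq> {p \<in> topspace Y. f p \<in> ball u \<delta>}"
    by (rule separation_by_formula)
  show thesis
  proof (rule that[OF \<phi>(1)])
    show "\<phi> \<in> p" if "p \<in> S" "\<bar>f p - u\<bar> \<le> \<epsilon>" for p
      using \<phi>(2) that by (auto simp: cyl_def dist_real_def abs_minus_commute)
    show "\<bar>f p - u\<bar> < \<delta>" if "p \<in> S" "\<phi> \<in> p" for p
      using \<phi>(3) that by (auto simp: cyl_def dist_real_def abs_minus_commute)
  qed
qed

text \<open>The formulas for rational \<open>u\<close> and tolerance \<open>1 / (n + 1)\<close>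
  already determine the value of \<open>f\<close>. There are countably many, each with finitely many
  parameters.\<close>

lemma countable_support:
  assumes f: "continuous_map Y euclideanreal f"
  obtains E where "countable E" "E \<subseteq> universe M"
    "\<And>p q. p \<in> S \<Longrightarrow> q \<in> S \<Longrightarrow> p \<inter> formulas L V E = q \<inter> formulas L V E \<Longrightarrow> f p = f q"
proof -
  define P where "P u \<epsilon> \<phi> \<longleftrightarrow> \<phi> \<in> Fm \<and> (\<forall>p\<in>S. \<bar>f p - u\<bar> \<le> \<epsilon> \<longrightarrow> \<phi> \<in> p) \<and>
    (\<forall>p\<in>S. \<phi> \<in> p \<longrightarrow> \<bar>f p - u\<bar> < 2 * \<epsilon>)" for u \<epsilon> \<phi>
  define \<Theta> where "\<Theta> u \<epsilon> = (SOME \<phi>. P u \<epsilon> \<phi>)" for u \<epsilon>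
  have P: "P u \<epsilon> (\<Theta> u \<epsilon>)" if \<epsilon>: "0 < \<epsilon>" for u \<epsilon>
  proof -
    have "\<epsilon> < 2 * \<epsilon>" using \<epsilon> by simp
    from level_formula[OF f this, of u] have "\<exists>\<phi>. P u \<epsilon> \<phi>" unfolding P_def by metis
    then show ?thesis unfolding \<Theta>_def by (rule someI_ex)
  qed
  have \<Theta>: "\<And>u \<epsilon>. 0 < \<epsilon> \<Longrightarrow> \<Theta> u \<epsilon> \<in> Fm"
    "\<And>u \<epsilon> p. 0 < \<epsilon> \<Longrightarrow> p \<in> S \<Longrightarrow> \<bar>f p - u\<bar> \<le> \<epsilon> \<Longrightarrow> \<Theta> u \<epsilon> \<in> p"
    "\<And>u \<epsilon> p. 0 < \<epsilon> \<Longrightarrow> p \<in> S \<Longrightarrow> \<Theta> u \<epsilon> \<in> p \<Longrightarrow> \<bar>f p - u\<bar> < 2 * \<epsilon>"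
    using P unfolding P_def by blast+
  define E where "E = (\<Union>u\<in>\<rat>. \<Union>n. params (\<Theta> u (inverse (Suc n))))"
  have "countable E"
    unfolding E_def by (intro countable_UN countable_rat) (simp_all add: countable_finite finite_params)
  moreover have "E \<subseteq> universe M"
  proof
    fix a assume "a \<in> E"
    then obtain u n where "a \<in> params (\<Theta> u (inverse (Suc n)))" unfolding E_def by blast
    moreover have "\<Theta> u (inverse (Suc n)) \<in> Fm" by (rule \<Theta>(1)) simp
    ultimately show "a \<in> universe M" using params_subset by blast
  qed
  moreover have "f p = f q" if p: "p \<in> S" and q: "q \<in> S" and eq: "p \<inter> formulas L V E = q \<inter> formulas L V E" for p q
  proof (rule ccontr)
    assume "f p \<noteq> f q"
    \<comment> \<open>One formula will put \<open>f p\<close> within \<open>\<epsilon>\<close> of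
      \<open>u\<close> and \<open>f q\<close> within \<open>2 * \<epsilon>\<close>, so
      \<open>3 * \<epsilon>\<close> has to stay below their distance.\<close>
    then obtain n where n: "inverse (Suc n) < \<bar>f p - f q\<bar> / 3"
      using reals_Archimedean[of "\<bar>f p - f q\<bar> / 3"] by auto
    define \<epsilon> :: real where "\<epsilon> = inverse (Suc n)"
    have \<epsilon>: "0 < \<epsilon>" "3 * \<epsilon> < \<bar>f p - f q\<bar>" using n by (simp_all add: \<epsilon>_def)
    obtain u where u: "u \<in> \<rat>" "f p < u" "u < f p + \<epsilon>"
      using Rats_dense_in_real[of "f p" "f p + \<epsilon>"] \<epsilon>(1) by auto
    then have "\<Theta> u \<epsilon> \<in> p" by (intro \<Theta>(2)[OF \<epsilon>(1) p]) simp
    moreover have "params (\<Theta> u \<epsilon>) \<subseteq> E" using u(1) unfolding E_def \<epsilon>_def by blast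
    then have "\<Theta> u \<epsilon> \<in> formulas L V E"
      using formulas_params[OF \<Theta>(1)[OF \<epsilon>(1), of u]] formulas_mono[of "params (\<Theta> u \<epsilon>)" E L V] by blast
    ultimately have "\<Theta> u \<epsilon> \<in> q" using eq by blast
    then have "\<bar>f q - u\<bar> < 2 * \<epsilon>" by (rule \<Theta>(3)[OF \<epsilon>(1) q])
    then show False using u(2,3) \<epsilon>(2) by linarith
  qed
  ultimately show thesis using that by blast
qed

text \<open>\<open>\<phi>\<close> and \<open>\<psi>\<close> are meant to record that a function is
  near one of two values; nothing is said about the diagonal. The automorphisms move parameters
  while the types stay put, so that only the countable family of moved parameters has to be
  transported.\<close>

definition formula_order_property :: "('f, 'r, 'x, 'a) pfm \<Rightarrow> ('f, 'r, 'x, 'a) pfm \<Rightarrow> bool" where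
  "formula_order_property \<phi> \<psi> \<longleftrightarrow> (\<exists>\<sigma> p. (\<forall>n::nat. \<sigma> n \<in> Aut) \<and> (\<forall>n. p n \<in> S) \<and>
     (\<forall>n m. n < m \<longrightarrow> map_params (\<sigma> n) \<phi> \<in> p m) \<and> (\<forall>n m. m < n \<longrightarrow> map_params (\<sigma> n) \<psi> \<in> p m))"

text \<open>Moving the parameters of a formula amounts to acting on the type by the inverse, so the
  automorphisms are exchanged for their inverses.\<close>

lemma formula_order_property_iff:
  "formula_order_property \<phi> \<psi> \<longleftrightarrow> (\<exists>\<sigma> p. (\<forall>n::nat. \<sigma> n \<in> Aut) \<and> (\<forall>n. p n \<in> S) \<and>
     (\<forall>n m. n < m \<longrightarrow> \<phi> \<in> type_action (\<sigma> n) (p m)) \<and> (\<forall>n m. m < n \<longrightarrow> \<psi> \<in> type_action (\<sigma> n) (p m)))"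
  (is "?L \<longleftrightarrow> ?R")
proof -
  have inv: "\<exists>\<tau>. (\<forall>n::nat. \<tau> n \<in> Aut) \<and> (\<forall>n. \<tau> n \<circ> \<sigma> n = id) \<and> (\<forall>n. \<sigma> n \<circ> \<tau> n = id)"
    if "\<forall>n. \<sigma> n \<in> Aut" for \<sigma> :: "nat \<Rightarrow> 'a \<Rightarrow> 'a"
  proof -
    have "\<forall>n. \<exists>\<tau>. \<tau> \<in> Aut \<and> \<tau> \<circ> \<sigma> n = id \<and> \<sigma> n \<circ> \<tau> = id" using Aut_inverse that by metis
    from choice[OF this] show ?thesis by blast
  qed
  show ?thesis
  proof
    assume ?L
    then obtain \<sigma> p where *: "\<forall>n::nat. \<sigma> n \<in> Aut" "\<forall>n. p n \<in> S"
      "\<And>n m. n < m \<Longrightarrow> map_params (\<sigma> n) \<phi> \<in> p m" "\<And>n m. m < n \<Longrightarrow> map_params (\<sigma> n) \<psi> \<in> p m"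
      unfolding formula_order_property_def by blast
    obtain \<tau> where \<tau>: "\<forall>n. \<tau> n \<in> Aut" "\<And>n. \<tau> n \<circ> \<sigma> n = id" "\<And>n. \<sigma> n \<circ> \<tau> n = id" using inv[OF *(1)] by blast
    show ?R
      by (intro exI[of _ \<tau>] exI[of _ p]) (use * \<tau> in \<open>simp add: mem_type_action_iff[OF \<tau>(3,2)]\<close>)
  next
    assume ?R
    then obtain \<sigma> p where *: "\<forall>n::nat. \<sigma> n \<in> Aut" "\<forall>n. p n \<in> S"
      "\<And>n m. n < m \<Longrightarrow> \<phi> \<in> type_action (\<sigma> n) (p m)" "\<And>n m. m < n \<Longrightarrow> \<psi> \<in> type_action (\<sigma> n) (p m)"
      by blast
    obtain \<tau> where \<tau>: "\<forall>n. \<tau> n \<in> Aut" "\<And>n. \<tau> n \<circ> \<sigma> n = id" "\<And>n. \<sigma> n \<circ> \<tau> n = id" using inv[OF *(1)] by blast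
    show ?L
      unfolding formula_order_property_def
      by (intro exI[of _ \<tau>] exI[of _ p]) (use * \<tau> in \<open>simp add: mem_type_action_iff[OF \<tau>(2,3)]\<close>)
  qed
qed

lemma order_property_if_formula_order_property:
  assumes "formula_order_property \<phi> \<psi>" "0 < \<epsilon>"
    and gap: "\<And>p q. p \<in> S \<Longrightarrow> q \<in> S \<Longrightarrow> \<phi> \<in> p \<Longrightarrow> \<psi> \<in> q \<Longrightarrow> \<epsilon> \<le> \<bar>k p - k q\<bar>"
  shows "order_property ((\<lambda>g p. k (type_action g p)) ` Aut) S"
proof -
  obtain \<sigma> q where q: "\<And>n::nat. \<sigma> n \<in> Aut" "\<And>n. q n \<in> S"
    "\<And>n m. n < m \<Longrightarrow> \<phi> \<in> type_action (\<sigma> n) (q m)" "\<And>n m. m < n \<Longrightarrow> \<psi> \<in> type_action (\<sigma> n) (q m)"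
    using assms(1) unfolding formula_order_property_iff by blast
  show ?thesis
    unfolding order_property_def
  proof (intro exI conjI allI impI)
    show "(\<lambda>p. k (type_action (\<sigma> n) p)) \<in> (\<lambda>g p. k (type_action g p)) ` Aut" "q n \<in> S" for n
      using q(1,2) by blast+
    show "\<epsilon> \<le> \<bar>k (type_action (\<sigma> n) (q m)) - k (type_action (\<sigma> m) (q n))\<bar>" if "n < m" for n m
      by (intro gap type_action_in_S q that)
  qed (rule assms(2))
qed

text \<open>The two values and the tolerance are found before the formulas, because the formulas are
  then chosen by \<open>level_formula\<close> to fit these values.\<close>

lemma formula_order_property_if_order_property:
  assumes op: "order_property ((\<lambda>g p. k (type_action g p)) ` Aut) S" and B: "\<And>p. p \<in> S \<Longrightarrow> \<bar>k p\<bar> \<le> B"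
  obtains \<epsilon> u v :: real where "0 < \<epsilon>" "3 * \<epsilon> \<le> \<bar>u - v\<bar>"
    "\<And>\<phi> \<psi>. (\<And>p. p \<in> S \<Longrightarrow> \<bar>k p - u\<bar> \<le> \<epsilon> \<Longrightarrow> \<phi> \<in> p) \<Longrightarrow> (\<And>p. p \<in> S \<Longrightarrow> \<bar>k p - v\<bar> \<le> \<epsilon> \<Longrightarrow> \<psi> \<in> p) \<Longrightarrow>
      formula_order_property \<phi> \<psi>"
proof -
  have "\<bar>F p\<bar> \<le> B" if F: "F \<in> (\<lambda>g p. k (type_action g p)) ` Aut" and p: "p \<in> S" for F p
  proof -
    obtain g where g: "g \<in> Aut" "F = (\<lambda>p. k (type_action g p))" using F by blast
    show ?thesis unfolding g(2) by (intro B type_action_in_S g(1) p)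
  qed
  then obtain F p u v and \<epsilon> :: real where
    F: "\<And>n::nat. F n \<in> (\<lambda>g p. k (type_action g p)) ` Aut" "\<And>n::nat. p n \<in> S"
    and uv: "0 < \<epsilon>" "3 * \<epsilon> \<le> \<bar>u - v\<bar>"
    and near: "\<And>n m. n < m \<Longrightarrow> \<bar>F n (p m) - u\<bar> \<le> \<epsilon>" "\<And>n m. m < n \<Longrightarrow> \<bar>F n (p m) - v\<bar> \<le> \<epsilon>"
    using order_property_separated[where B = B, OF op] by metis
  have "\<forall>n. \<exists>g. g \<in> Aut \<and> F n = (\<lambda>p. k (type_action g p))" using F(1) by blast
  from choice[OF this] obtain g where g: "\<And>n. g n \<in> Aut" "\<And>n. F n = (\<lambda>p. k (type_action (g n) p))"
    by blast
  show thesis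
  proof (rule that[OF uv])
    fix \<phi> \<psi>
    assume \<phi>: "\<And>p. p \<in> S \<Longrightarrow> \<bar>k p - u\<bar> \<le> \<epsilon> \<Longrightarrow> \<phi> \<in> p" "\<And>p. p \<in> S \<Longrightarrow> \<bar>k p - v\<bar> \<le> \<epsilon> \<Longrightarrow> \<psi> \<in> p"
    show "formula_order_property \<phi> \<psi>"
      unfolding formula_order_property_iff
    proof (intro exI conjI allI impI)
      show "g n \<in> Aut" "p n \<in> S" for n by (rule g(1), rule F(2))
      fix n m :: nat
      show "\<phi> \<in> type_action (g n) (p m)" if "n < m"
        by (rule \<phi>(1)[OF type_action_in_S[OF g(1) F(2)]]) (use near(1)[OF that] g(2) in simp)
      show "\<psi> \<in> type_action (g n) (p m)" if "m < n"
        by (rule \<phi>(2)[OF type_action_in_S[OF g(1) F(2)]]) (use near(2)[OF that] g(2) in simp)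
    qed
  qed
qed

end

context type_flow_extension
begin

text \<open>Each \<open>\<sigma> n\<close> matters only on the finite set \<open>D\<close>, where it
  is elementary in \<open>C'\<close> as well, and homogeneity of \<open>C'\<close> extends it.
  Arbitrary lifts of the types will do, since a lift keeps all formulas.\<close>

lemma formula_order_property_small_imp_big:
  assumes \<phi>: "\<phi> \<in> small.Fm" "\<psi> \<in> small.Fm" and fop: "small.formula_order_property \<phi> \<psi>"
  shows "big.formula_order_property \<phi> \<psi>"
proof -
  obtain \<sigma> p where *: "\<And>n::nat. \<sigma> n \<in> small.Aut" "\<And>n. p n \<in> small.S"
    "\<And>n m. n < m \<Longrightarrow> map_params (\<sigma> n) \<phi> \<in> p m" "\<And>n m. m < n \<Longrightarrow> map_params (\<sigma> n) \<psi> \<in> p m"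
    using fop unfolding small.formula_order_property_def by blast
  define D where "D = params \<phi> \<union> params \<psi>"
  have D: "countable D" "D \<subseteq> universe C"
    using params_subset[OF \<phi>(1)] params_subset[OF \<phi>(2)]
    by (auto simp: D_def finite_params countable_finite)
  have \<phi>D: "\<phi> \<in> formulas L V D" "\<psi> \<in> formulas L V D"
    using formulas_params[OF \<phi>(1)] formulas_params[OF \<phi>(2)] formulas_mono[of _ D L V] by (auto simp: D_def)
  have "\<exists>\<tau>. \<tau> \<in> big.Aut \<and> (\<forall>a\<in>D. \<tau> a = \<sigma> n a)" for n
  proof -
    have img: "\<sigma> n ` D \<subseteq> universe C" using small.Aut_image[OF *(1)[of n]] D(2) by blast
    have "elem_equiv L D C id C (\<sigma> n)"
      using elem_equiv_automorphism[OF small.struct *(1)[of n], of id D] D(2) by simp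
    then have "elem_equiv L D C' id C' (\<sigma> n)" using elem_equiv_small_iff_big[OF D(2) img] by simp
    then show ?thesis
      using automorphism_extending[OF homogeneous' D(1)] D(2) img universe_subset by (metis subset_trans)
  qed
  then obtain \<tau> where \<tau>: "\<And>n. \<tau> n \<in> big.Aut" "\<And>n a. a \<in> D \<Longrightarrow> \<tau> n a = \<sigma> n a" by metis
  have mp: "map_params (\<tau> n) \<theta> = map_params (\<sigma> n) \<theta>" if "\<theta> \<in> formulas L V D" for n \<theta>
    by (rule map_params_cong[OF that \<tau>(2)])
  have "\<forall>n. \<exists>a. a \<in> big.S \<and> p n \<subseteq> a" using lift_exists *(2) by metis
  from choice[OF this] obtain a where a: "\<And>n. a n \<in> big.S" "\<And>n. p n \<subseteq> a n" by blast
  show ?thesis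
    unfolding big.formula_order_property_def
  proof (intro exI conjI allI impI)
    show "\<tau> n \<in> big.Aut" "a n \<in> big.S" for n using \<tau> a by blast+
    fix n m :: nat
    show "map_params (\<tau> n) \<phi> \<in> a m" if "n < m"
      unfolding mp[OF \<phi>D(1)] using *(3)[OF that] a(2) by blast
    show "map_params (\<tau> n) \<psi> \<in> a m" if "m < n"
      unfolding mp[OF \<phi>D(2)] using *(4)[OF that] a(2) by blast
  qed
qed

text \<open>The moved parameters together form a countable set \<open>E\<close>, which one
  automorphism \<open>\<rho>\<close> of \<open>C'\<close> brings into \<open>C\<close>. After this
  the maps on \<open>D\<close> extend to automorphisms of \<open>C\<close>, and the types, moved
  along by \<open>\<rho>\<close>, can be restricted without losing the formulas concerned.\<close>

lemma formula_order_property_big_imp_small: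
  assumes \<phi>: "\<phi> \<in> small.Fm" "\<psi> \<in> small.Fm" and fop: "big.formula_order_property \<phi> \<psi>"
  shows "small.formula_order_property \<phi> \<psi>"
proof -
  obtain \<sigma> p where *: "\<And>n::nat. \<sigma> n \<in> big.Aut" "\<And>n. p n \<in> big.S"
    "\<And>n m. n < m \<Longrightarrow> map_params (\<sigma> n) \<phi> \<in> p m" "\<And>n m. m < n \<Longrightarrow> map_params (\<sigma> n) \<psi> \<in> p m"
    using fop unfolding big.formula_order_property_def by blast
  define D where "D = params \<phi> \<union> params \<psi>"
  have D: "countable D" "D \<subseteq> universe C"
    using params_subset[OF \<phi>(1)] params_subset[OF \<phi>(2)]
    by (auto simp: D_def finite_params countable_finite)
  have \<phi>D: "\<phi> \<in> formulas L V D" "\<psi> \<in> formulas L V D"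
    using formulas_params[OF \<phi>(1)] formulas_params[OF \<phi>(2)] formulas_mono[of _ D L V] by (auto simp: D_def)
  define E where "E = (\<Union>n. \<sigma> n ` D)"
  have "countable E" using D(1) by (auto simp: E_def)
  moreover have "E \<subseteq> universe C'"
    using big.Aut_image[OF *(1)] D(2) universe_subset unfolding E_def by blast
  ultimately obtain \<rho> where \<rho>: "\<rho> \<in> big.Aut" "\<rho> ` E \<subseteq> universe C"
    using move_into_small[of E "{}"] by auto
  have "\<exists>\<tau>. \<tau> \<in> small.Aut \<and> (\<forall>a\<in>D. \<tau> a = (\<rho> \<circ> \<sigma> n) a)" for n
  proof -
    have img: "(\<rho> \<circ> \<sigma> n) ` D \<subseteq> universe C" using \<rho>(2) by (auto simp: E_def)
    have "elem_equiv L D C' id C' (\<rho> \<circ> \<sigma> n)"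
      using elem_equiv_automorphism[OF big.struct big.Aut_comp[OF \<rho>(1) *(1)[of n]], of id D] D(2) universe_subset
      by auto
    then have "elem_equiv L D C id C (\<rho> \<circ> \<sigma> n)" using elem_equiv_small_iff_big[OF D(2) img] by simp
    then show ?thesis
      using automorphism_extending[OF homogeneous D(1) D(2) img] by metis
  qed
  then obtain \<tau> where \<tau>: "\<And>n. \<tau> n \<in> small.Aut" "\<And>n a. a \<in> D \<Longrightarrow> \<tau> n a = (\<rho> \<circ> \<sigma> n) a" by metis
  define q where "q n = r (type_action \<rho> (p n))" for n
  have qS: "q n \<in> small.S" for n
    unfolding q_def by (intro restrict_in_S big.type_action_in_S \<rho>(1) *(2))
  have mem: "map_params (\<tau> n) \<theta> \<in> q m" if \<theta>: "\<theta> \<in> formulas L V D" "map_params (\<sigma> n) \<theta> \<in> p m" for n m \<theta>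
  proof -
    have eq: "map_params (\<tau> n) \<theta> = map_params \<rho> (map_params (\<sigma> n) \<theta>)"
      unfolding map_params_comp by (rule map_params_cong[OF \<theta>(1) \<tau>(2)])
    have "map_params (\<tau> n) \<theta> \<in> type_action \<rho> (p m)"
      unfolding eq type_action_def using \<theta>(2) by (rule imageI)
    moreover have "map_params (\<tau> n) \<theta> \<in> small.Fm"
    proof (rule map_params_in_formulas[OF \<theta>(1)])
      show "\<tau> n ` D \<subseteq> universe C" using small.Aut_image[OF \<tau>(1)[of n]] D(2) by blast
    qed
    ultimately show ?thesis by (simp add: q_def restrict_type_def)
  qed
  show ?thesis
    unfolding small.formula_order_property_def
  proof (intro exI conjI allI impI)
    show "\<tau> n \<in> small.Aut" "q n \<in> small.S" for n using \<tau>(1) qS by blast+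
    fix n m :: nat
    show "map_params (\<tau> n) \<phi> \<in> q m" if "n < m" by (rule mem[OF \<phi>D(1) *(3)[OF that]])
    show "map_params (\<tau> n) \<psi> \<in> q m" if "m < n" by (rule mem[OF \<phi>D(2) *(4)[OF that]])
  qed
qed

section \<open>Stability over \<open>C\<close> and over \<open>C'\<close>\<close>

abbreviation "stable_small \<equiv> stable_function (aut_group L C) small.Y type_action"
abbreviation "stable_big \<equiv> stable_function (aut_group L C') big.Y type_action"

text \<open>One pair of formulas over \<open>C\<close> serves both sides: a type over
  \<open>C'\<close> and its restriction agree on them, so only \<open>formula_order_property\<close>
  has to be transferred.\<close>

lemma stable_restrict_iff: "stable_big (\<lambda>p. f (r p)) \<longleftrightarrow> stable_small f"
proof -
  have cont_iff: "continuous_map big.Y euclideanreal (\<lambda>p. f (r p)) \<longleftrightarrow> continuous_map small.Y euclideanreal f"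
    using continuous_compose_quotient_map_eq[OF quotient_map_restrict, of euclideanreal f] by (simp add: comp_def)
  have carrier: "carrier (aut_group L M) = automorphisms L M" for M :: "('f, 'r, 'a) fo_structure"
    by (simp add: aut_group_def)
  have "order_property ((\<lambda>g p. f (r (type_action g p))) ` big.Aut) big.S \<longleftrightarrow>
      order_property ((\<lambda>g p. f (type_action g p)) ` small.Aut) small.S" (is "?B \<longleftrightarrow> ?S")
    if f: "continuous_map small.Y euclideanreal f"
  proof -
    obtain B where B: "\<And>p. p \<in> small.S \<Longrightarrow> \<bar>f p\<bar> \<le> B"
      using continuous_map_bounded[OF small.compact_type_space f] by (metis small.topspace_type_space)
    have formulas: "\<exists>\<phi> \<psi>. \<phi> \<in> small.Fm \<and> \<psi> \<in> small.Fm \<and>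
        (\<forall>p\<in>small.S. \<bar>f p - u\<bar> \<le> \<epsilon> \<longrightarrow> \<phi> \<in> p) \<and> (\<forall>p\<in>small.S. \<bar>f p - v\<bar> \<le> \<epsilon> \<longrightarrow> \<psi> \<in> p) \<and>
        (\<forall>p\<in>small.S. \<forall>q\<in>small.S. \<phi> \<in> p \<longrightarrow> \<psi> \<in> q \<longrightarrow> \<epsilon> / 2 \<le> \<bar>f p - f q\<bar>)"
      if uv: "0 < \<epsilon>" "3 * \<epsilon> \<le> \<bar>u - v\<bar>" for u v \<epsilon> :: real
    proof -
      \<comment> \<open>Each formula allows an error below \<open>5 / 4 * \<epsilon>\<close>, which
        leaves \<open>\<epsilon> / 2\<close> of the distance \<open>3 * \<epsilon>\<close>.\<close>
      have lt: "\<epsilon> < 5 / 4 * \<epsilon>" using uv(1) by simp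
      obtain \<phi> where \<phi>: "\<phi> \<in> small.Fm" "\<And>p. p \<in> small.S \<Longrightarrow> \<bar>f p - u\<bar> \<le> \<epsilon> \<Longrightarrow> \<phi> \<in> p"
        "\<And>p. p \<in> small.S \<Longrightarrow> \<phi> \<in> p \<Longrightarrow> \<bar>f p - u\<bar> < 5 / 4 * \<epsilon>"
        using small.level_formula[OF f lt, of u] by blast
      obtain \<psi> where \<psi>: "\<psi> \<in> small.Fm" "\<And>p. p \<in> small.S \<Longrightarrow> \<bar>f p - v\<bar> \<le> \<epsilon> \<Longrightarrow> \<psi> \<in> p"
        "\<And>p. p \<in> small.S \<Longrightarrow> \<psi> \<in> p \<Longrightarrow> \<bar>f p - v\<bar> < 5 / 4 * \<epsilon>"
        using small.level_formula[OF f lt, of v] by blast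
      have "\<epsilon> / 2 \<le> \<bar>f p - f q\<bar>" if "p \<in> small.S" "q \<in> small.S" "\<phi> \<in> p" "\<psi> \<in> q" for p q
        using \<phi>(3)[OF that(1,3)] \<psi>(3)[OF that(2,4)] uv(2) by linarith
      then show ?thesis using \<phi>(1,2) \<psi>(1,2) by blast
    qed
    show ?thesis
    proof
      assume op: ?B
      obtain \<epsilon> u v :: real where uv: "0 < \<epsilon>" "3 * \<epsilon> \<le> \<bar>u - v\<bar>"
        and fop: "\<And>\<phi> \<psi>. (\<And>p. p \<in> big.S \<Longrightarrow> \<bar>f (r p) - u\<bar> \<le> \<epsilon> \<Longrightarrow> \<phi> \<in> p) \<Longrightarrow>
          (\<And>p. p \<in> big.S \<Longrightarrow> \<bar>f (r p) - v\<bar> \<le> \<epsilon> \<Longrightarrow> \<psi> \<in> p) \<Longrightarrow> big.formula_order_property \<phi> \<psi>"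
        using big.formula_order_property_if_order_property[where k = "\<lambda>p. f (r p)", OF op B[OF restrict_in_S]]
        by (metis (no_types, lifting))
      obtain \<phi> \<psi> where \<phi>: "\<phi> \<in> small.Fm" "\<psi> \<in> small.Fm"
        "\<forall>p\<in>small.S. \<bar>f p - u\<bar> \<le> \<epsilon> \<longrightarrow> \<phi> \<in> p" "\<forall>p\<in>small.S. \<bar>f p - v\<bar> \<le> \<epsilon> \<longrightarrow> \<psi> \<in> p"
        "\<forall>p\<in>small.S. \<forall>q\<in>small.S. \<phi> \<in> p \<longrightarrow> \<psi> \<in> q \<longrightarrow> \<epsilon> / 2 \<le> \<bar>f p - f q\<bar>"
        using formulas[OF uv] by blast
      have "big.formula_order_property \<phi> \<psi>"
        by (rule fop) (use \<phi>(3,4) restrict_in_S in \<open>auto simp: restrict_type_def\<close>)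
      then have "small.formula_order_property \<phi> \<psi>"
        by (rule formula_order_property_big_imp_small[OF \<phi>(1,2)])
      then show ?S
        by (rule small.order_property_if_formula_order_property[where \<epsilon> = "\<epsilon> / 2"]) (use uv \<phi>(5) in auto)
    next
      assume op: ?S
      obtain \<epsilon> u v :: real where uv: "0 < \<epsilon>" "3 * \<epsilon> \<le> \<bar>u - v\<bar>"
        and fop: "\<And>\<phi> \<psi>. (\<And>p. p \<in> small.S \<Longrightarrow> \<bar>f p - u\<bar> \<le> \<epsilon> \<Longrightarrow> \<phi> \<in> p) \<Longrightarrow>
          (\<And>p. p \<in> small.S \<Longrightarrow> \<bar>f p - v\<bar> \<le> \<epsilon> \<Longrightarrow> \<psi> \<in> p) \<Longrightarrow> small.formula_order_property \<phi> \<psi>"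
        using small.formula_order_property_if_order_property[where k = f, OF op B] by (metis (no_types, lifting))
      obtain \<phi> \<psi> where \<phi>: "\<phi> \<in> small.Fm" "\<psi> \<in> small.Fm"
        "\<forall>p\<in>small.S. \<bar>f p - u\<bar> \<le> \<epsilon> \<longrightarrow> \<phi> \<in> p" "\<forall>p\<in>small.S. \<bar>f p - v\<bar> \<le> \<epsilon> \<longrightarrow> \<psi> \<in> p"
        "\<forall>p\<in>small.S. \<forall>q\<in>small.S. \<phi> \<in> p \<longrightarrow> \<psi> \<in> q \<longrightarrow> \<epsilon> / 2 \<le> \<bar>f p - f q\<bar>"
        using formulas[OF uv] by blast
      have "small.formula_order_property \<phi> \<psi>"
        by (rule fop) (use \<phi>(3,4) in auto)
      then have "big.formula_order_property \<phi> \<psi>"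
        by (rule formula_order_property_small_imp_big[OF \<phi>(1,2)])
      moreover have "\<epsilon> / 2 \<le> \<bar>f (r p) - f (r q)\<bar>"
        if "p \<in> big.S" "q \<in> big.S" "\<phi> \<in> p" "\<psi> \<in> q" for p q
        using \<phi>(1,2,5) that restrict_in_S by (simp add: restrict_type_def)
      ultimately show ?B
        using uv by (intro big.order_property_if_formula_order_property[where \<epsilon> = "\<epsilon> / 2"]) auto
    qed
  qed
  then show ?thesis
    unfolding stable_function_def cont_iff carrier big.topspace_type_space small.topspace_type_space by blast
qed

lemma stable_big_cong:
  assumes "stable_big k" "\<And>p. p \<in> big.S \<Longrightarrow> k p = k' p"
  shows "stable_big k'"
  unfolding stable_function_def
proof
  show "continuous_map big.Y euclideanreal k'"
    using assms by (auto simp: stable_function_def intro: continuous_map_eq[where f = k])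
  show "\<not> order_property ((\<lambda>g p. k' (type_action g p)) ` carrier (aut_group L C')) (topspace big.Y)"
  proof
    assume "order_property ((\<lambda>g p. k' (type_action g p)) ` carrier (aut_group L C')) (topspace big.Y)"
    then have "order_property ((\<lambda>g p. k (type_action g p)) ` carrier (aut_group L C')) (topspace big.Y)"
    proof (rule order_property_mono)
      fix F assume "F \<in> (\<lambda>g p. k' (type_action g p)) ` carrier (aut_group L C')"
      then obtain g where g: "g \<in> carrier (aut_group L C')" "F = (\<lambda>p. k' (type_action g p))" by blast
      have "\<forall>p\<in>topspace big.Y. F p = k (type_action g p)"
        using g assms(2) big.type_action_in_S[of g] by (simp add: aut_group_def)
      then show "\<exists>F'\<in>(\<lambda>g p. k (type_action g p)) ` carrier (aut_group L C'). \<forall>p\<in>topspace big.Y. F p = F' p"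
        using g(1) by (intro bexI[of _ "\<lambda>p. k (type_action g p)"]) auto
    qed
    then show False using assms(1) by (simp add: stable_function_def)
  qed
qed

section \<open>Transfer of the relation\<close>

abbreviation "stab \<equiv> stable_equiv (aut_group L C) small.Y type_action"
abbreviation "stab' \<equiv> stable_equiv (aut_group L C') big.Y type_action"

text \<open>A stable function over \<open>C\<close> that separates \<open>r a\<close> and
  \<open>r b\<close> pulls back to one over \<open>C'\<close> that separates \<open>a\<close> and
  \<open>b\<close>.\<close>

lemma restrict_stable_equiv_subset: "(a, b) \<in> stab' \<Longrightarrow> (r a, r b) \<in> stab"
  unfolding stable_equiv_def using stable_restrict_iff restrict_in_S by auto

text \<open>After moving the countably many parameters of the functions \<open>k\<close> into \<open>C\<close>, these functions
  factor through the restriction map.\<close>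

lemma stable_equiv_lift_finite:
  assumes pq: "(p, q) \<in> stab" and D: "finite D" "D \<subseteq> universe C"
    and H: "finite H" "\<And>k. k \<in> H \<Longrightarrow> stable_big k"
  obtains a b where "a \<in> big.S" "b \<in> big.S" "p \<inter> formulas L V D \<subseteq> a" "q \<inter> formulas L V D \<subseteq> b"
    "\<And>k. k \<in> H \<Longrightarrow> k a = k b"
proof -
  have pqS: "p \<in> small.S" "q \<in> small.S" using pq by (auto simp: stable_equiv_def)
  have "\<exists>E. countable E \<and> E \<subseteq> universe C' \<and>
      (\<forall>p\<in>big.S. \<forall>q\<in>big.S. p \<inter> formulas L V E = q \<inter> formulas L V E \<longrightarrow> k p = k q)" if "k \<in> H" for k
  proof -
    have "continuous_map big.Y euclideanreal k" using H(2)[OF that] by (simp add: stable_function_def)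
    from big.countable_support[OF this] show ?thesis by metis
  qed
  then obtain E where E: "\<And>k. k \<in> H \<Longrightarrow> countable (E k)" "\<And>k. k \<in> H \<Longrightarrow> E k \<subseteq> universe C'"
    "\<And>k p q. k \<in> H \<Longrightarrow> p \<in> big.S \<Longrightarrow> q \<in> big.S \<Longrightarrow> p \<inter> formulas L V (E k) = q \<inter> formulas L V (E k) \<Longrightarrow> k p = k q"
    by metis
  have "countable (\<Union> (E ` H))" "\<Union> (E ` H) \<subseteq> universe C'"
    using E(1,2) H(1) by (auto simp: countable_finite)
  then obtain \<rho> where \<rho>: "\<rho> \<in> big.Aut" "\<rho> ` \<Union> (E ` H) \<subseteq> universe C" "\<And>d. d \<in> D \<Longrightarrow> \<rho> d = d"
    using move_into_small[OF _ _ D] by metis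
  obtain \<tau> where \<tau>: "\<tau> \<in> big.Aut" "\<tau> \<circ> \<rho> = id" "\<rho> \<circ> \<tau> = id" using big.Aut_inverse[OF \<rho>(1)] by metis
  obtain a0 where a0: "a0 \<in> big.S" "r a0 = p" "p \<subseteq> a0" using lift_exists[OF pqS(1)] by metis
  obtain b0 where b0: "b0 \<in> big.S" "r b0 = q" "q \<subseteq> b0" using lift_exists[OF pqS(2)] by metis
  \<comment> \<open>Since \<open>\<rho>\<close> fixes \<open>D\<close>, formulas over
    \<open>D\<close> survive the translation by its inverse \<open>\<tau>\<close>.\<close>
  have fixD: "\<phi> \<in> type_action \<tau> c" if "\<phi> \<in> formulas L V D" "\<phi> \<in> c" for \<phi> c
  proof -
    have "map_params \<rho> \<phi> = map_params id \<phi>" by (rule map_params_cong[OF that(1)]) (simp add: \<rho>(3))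
    then show ?thesis unfolding big.mem_type_action_iff[OF \<tau>(3,2)] using that(2) by simp
  qed
  have kab: "k (type_action \<tau> a0) = k (type_action \<tau> b0)" if k: "k \<in> H" for k
  proof -
    define k' where "k' c = k (type_action \<tau> c)" for c
    have "\<tau> \<in> carrier (aut_group L C')" using \<tau>(1) by (simp add: aut_group_def)
    then have k': "stable_big k'"
      unfolding k'_def by (rule stable_function_translate[OF big.is_flow_type_space H(2)[OF k]])
    \<comment> \<open>A formula over \<open>E k\<close> belongs to the translate of \<open>c\<close>
      exactly if its image under \<open>\<rho>\<close> belongs to \<open>c\<close>, and this image
      has its parameters in \<open>C\<close>.\<close>
    have factor: "k' c = k' d" if c: "c \<in> big.S" and d: "d \<in> big.S" and cd: "r c = r d" for c d
      unfolding k'_def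
    proof (rule E(3)[OF k])
      show "type_action \<tau> c \<in> big.S" "type_action \<tau> d \<in> big.S"
        using big.type_action_in_S[OF \<tau>(1)] c d by blast+
      have "\<theta> \<in> type_action \<tau> c \<longleftrightarrow> \<theta> \<in> type_action \<tau> d" if "\<theta> \<in> formulas L V (E k)" for \<theta>
      proof -
        have "\<rho> ` E k \<subseteq> universe C" using \<rho>(2) k by blast
        then have "map_params \<rho> \<theta> \<in> small.Fm" by (rule map_params_in_formulas[OF that])
        then have "map_params \<rho> \<theta> \<in> c \<longleftrightarrow> map_params \<rho> \<theta> \<in> d" using cd by (auto simp: restrict_type_def)
        then show ?thesis unfolding big.mem_type_action_iff[OF \<tau>(3,2)] .
      qed
      then show "type_action \<tau> c \<inter> formulas L V (E k) = type_action \<tau> d \<inter> formulas L V (E k)" by blast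
    qed
    \<comment> \<open>By \<open>factor\<close> the choice of the lift is immaterial.\<close>
    define f where "f z = k' (SOME c. c \<in> big.S \<and> r c = z)" for z
    have fr: "f (r c) = k' c" if "c \<in> big.S" for c
    proof -
      have "\<exists>d. d \<in> big.S \<and> r d = r c" using that by blast
      then have "(SOME d. d \<in> big.S \<and> r d = r c) \<in> big.S \<and> r (SOME d. d \<in> big.S \<and> r d = r c) = r c"
        by (rule someI_ex)
      then show ?thesis unfolding f_def using factor that by blast
    qed
    have "stable_big (\<lambda>c. f (r c))" by (rule stable_big_cong[OF k']) (simp add: fr)
    then have "stable_small f" by (simp only: stable_restrict_iff)
    then have "f p = f q" using pq unfolding stable_equiv_def by blast
    then have "k' a0 = k' b0" using fr[OF a0(1)] fr[OF b0(1)] a0(2) b0(2) by simp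
    then show ?thesis by (simp add: k'_def)
  qed
  show thesis
  proof
    show "type_action \<tau> a0 \<in> big.S" "type_action \<tau> b0 \<in> big.S"
      using big.type_action_in_S[OF \<tau>(1)] a0 b0 by blast+
    show "p \<inter> formulas L V D \<subseteq> type_action \<tau> a0" "q \<inter> formulas L V D \<subseteq> type_action \<tau> b0"
      using fixD a0(3) b0(3) by blast+
  qed (rule kab)
qed

text \<open>The pair sought is described by closed conditions, one for each formula of
  \<open>p\<close>, formula of \<open>q\<close> and stable function. Finitely many of them involve
  finitely many parameters and functions, which is the case already settled; compactness of the
  product gives a common solution.\<close>

lemma stable_equiv_lift:
  assumes pq: "(p, q) \<in> stab"
  obtains a b where "(a, b) \<in> stab'" "r a = p" "r b = q"
proof -
  have pqS: "p \<in> small.S" "q \<in> small.S" using pq by (auto simp: stable_equiv_def)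
  let ?YY = "prod_topology big.Y big.Y"
  define K where "K = (\<lambda>(\<phi>, \<psi>, k). {x \<in> topspace ?YY. \<phi> \<in> fst x \<and> \<psi> \<in> snd x \<and> k (fst x) - k (snd x) \<in> {0 :: real}})"
  define J where "J = p \<times> q \<times> {k. stable_big k}"
  have closed: "closedin ?YY (K j)" if j: "j \<in> J" for j
  proof -
    obtain \<phi> \<psi> k where jk: "j = (\<phi>, \<psi>, k)" "\<phi> \<in> p" "\<psi> \<in> q" "stable_big k" using j unfolding J_def by blast
    have F: "\<phi> \<in> big.Fm" "\<psi> \<in> big.Fm"
      using jk(2,3) small.S_subset_Fm[OF pqS(1)] small.S_subset_Fm[OF pqS(2)] Fm_subset by blast+
    have "closedin ?YY {x \<in> topspace ?YY. k (fst x) - k (snd x) \<in> {0}}"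
      by (rule closedin_continuous_map_preimage[OF continuous_map_difference])
        (use jk(4) in \<open>auto simp: stable_function_def\<close>)
    moreover have "closedin ?YY (big.cyl \<phi> \<times> big.cyl \<psi>)"
      using big.closedin_cyl F by (simp add: closedin_prod_Times_iff)
    moreover have "K j = {x \<in> topspace ?YY. k (fst x) - k (snd x) \<in> {0}} \<inter> (big.cyl \<phi> \<times> big.cyl \<psi>)"
      unfolding K_def jk(1) by (auto simp: big.cyl_def)
    ultimately show ?thesis by (simp only: closedin_Int)
  qed
  have fip: "topspace ?YY \<inter> \<Inter> \<F> \<noteq> {}" if \<F>: "finite \<F>" "\<F> \<subseteq> K ` J" for \<F>
  proof -
    obtain J' where J': "J' \<subseteq> J" "finite J'" "\<F> = K ` J'" using finite_subset_image[OF \<F>] by blast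
    define D where "D = (\<Union>(\<phi>, \<psi>, k)\<in>J'. params \<phi> \<union> params \<psi>)"
    define H where "H = (snd \<circ> snd) ` J'"
    have "finite D" unfolding D_def using J'(2) by (auto simp: finite_params)
    moreover have "D \<subseteq> universe C"
    proof -
      have "params \<phi> \<subseteq> universe C" if "\<phi> \<in> p \<or> \<phi> \<in> q" for \<phi>
        using that small.S_subset_Fm[OF pqS(1)] small.S_subset_Fm[OF pqS(2)] params_subset by blast
      then show ?thesis using J'(1) unfolding D_def J_def by blast
    qed
    moreover have "finite H" "\<And>k. k \<in> H \<Longrightarrow> stable_big k" using J'(1,2) by (auto simp: H_def J_def)
    ultimately obtain a b where ab: "a \<in> big.S" "b \<in> big.S" "p \<inter> formulas L V D \<subseteq> a" "q \<inter> formulas L V D \<subseteq> b"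
      "\<And>k. k \<in> H \<Longrightarrow> k a = k b"
      using stable_equiv_lift_finite[OF pq] by metis
    have "(a, b) \<in> K j" if j: "j \<in> J'" for j
    proof -
      obtain \<phi> \<psi> k where jk: "j = (\<phi>, \<psi>, k)" "\<phi> \<in> p" "\<psi> \<in> q" using j J'(1) unfolding J_def by blast
      have "params \<phi> \<subseteq> D" "params \<psi> \<subseteq> D" using j jk(1) unfolding D_def by blast+
      moreover have "\<phi> \<in> formulas L V (params \<phi>)" "\<psi> \<in> formulas L V (params \<psi>)"
        using jk(2,3) small.S_subset_Fm[OF pqS(1)] small.S_subset_Fm[OF pqS(2)] formulas_params by blast+
      ultimately have "\<phi> \<in> formulas L V D" "\<psi> \<in> formulas L V D"
        using formulas_mono[of _ D L V] by blast+
      then have "\<phi> \<in> a" "\<psi> \<in> b" using ab(3,4) jk(2,3) by blast+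
      moreover have "k \<in> H" using j jk(1) by (force simp: H_def)
      ultimately show ?thesis using ab(1,2,5) by (simp add: K_def jk(1))
    qed
    then have "(a, b) \<in> topspace ?YY \<inter> \<Inter> \<F>" using ab(1,2) J'(3) by simp
    then show ?thesis by blast
  qed
  have "compact_space ?YY"
    using big.compact_type_space by (simp add: compact_space_prod_topology)
  then have "compactin ?YY (topspace ?YY)" by (simp only: compact_space_def)
  then have "topspace ?YY \<inter> \<Inter> (K ` J) \<noteq> {}"
    unfolding compactin_fip using closed fip by (elim conjE allE[of _ "K ` J"]) blast
  then obtain a b where ab: "a \<in> big.S" "b \<in> big.S" "\<And>j. j \<in> J \<Longrightarrow> (a, b) \<in> K j" by auto
  have mem: "\<phi> \<in> a \<and> \<psi> \<in> b \<and> k a = k b" if "\<phi> \<in> p" "\<psi> \<in> q" "stable_big k" for \<phi> \<psi> k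
    using ab(3)[of "(\<phi>, \<psi>, k)"] that by (simp add: J_def K_def)
  \<comment> \<open>The conditions come in triples, so reading off one component requires members
    for the others: a constant function and, next, some formula of each type.\<close>
  note stable0 = stable_function_const[of "aut_group L C'" big.Y type_action 0]
  have nonempty: "p \<noteq> {}" "q \<noteq> {}" using small.cyl_True pqS by (auto simp: small.cyl_def)
  show thesis
  proof
    show "r a = p" by (rule subset_restrict_imp_eq[OF pqS(1) ab(1)]) (use mem[OF _ _ stable0] nonempty in blast)
    show "r b = q" by (rule subset_restrict_imp_eq[OF pqS(2) ab(2)]) (use mem[OF _ _ stable0] nonempty in blast)
    show "(a, b) \<in> stab'"
      unfolding stable_equiv_def using ab(1,2) mem nonempty by auto
  qed
qed

theorem restrict_stable_equiv: "{(r a, r b) | a b. (a, b) \<in> stab'} = stab"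
proof (intro equalityI subsetI)
  fix x assume "x \<in> {(r a, r b) | a b. (a, b) \<in> stab'}"
  then show "x \<in> stab" using restrict_stable_equiv_subset by blast
next
  fix x assume x: "x \<in> stab"
  obtain p q where pq: "x = (p, q)" by force
  then obtain a b where "(a, b) \<in> stab'" "r a = p" "r b = q" using stable_equiv_lift x by metis
  then show "x \<in> {(r a, r b) | a b. (a, b) \<in> stab'}" using pq by blast
qed

end

theorem theorem4p5:
  fixes L :: "('f, 'r) fo_language"
    and T :: "('f, 'r, unit) fm set"
    and V :: "'x set"
    and \<pi> :: "('f, 'r, 'x, 'a) pfm set"
    and C C' :: "('f, 'r, 'a) fo_structure"
    and F F' :: "('f, 'r, 'x, 'a) pfm set rel"
  assumes "complete_theory L T"
    and "is_model L T C" and "is_model L T C'"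
    and "elementary_substructure L C C'"
    and "partial_type L C V {} \<pi>"
    and "saturated L (cardSuc (natLeq +c |V| )) C"
    and "strongly_homogeneous L (cardSuc (natLeq +c |V| )) C"
    and "saturated L (cardSuc (natLeq +c |V| )) C'"
    and "strongly_homogeneous L (cardSuc (natLeq +c |V| )) C'"
    and "finest_wap_equiv (aut_group L C) (aut_topology L C) (type_space L C V \<pi>) type_action F"
    and "finest_wap_equiv (aut_group L C') (aut_topology L C') (type_space L C' V \<pi>) type_action F'"
  shows "{(restrict_type L C V a, restrict_type L C V b) | a b. (a, b) \<in> F'} = F"
proof -
  have group: "topological_group (aut_group L M) (aut_topology L M)"
    if "finest_wap_equiv (aut_group L M) (aut_topology L M) (type_space L M V \<pi>) type_action E"
    for M :: "('f, 'r, 'a) fo_structure" and E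
    using that unfolding finest_wap_equiv_def has_wap_quotient_def wap_flow_def is_flow_def by blast
  have struct: "is_structure L C" "is_structure L C'" "universe C \<subseteq> universe C'"
    using assms(4) by (simp_all add: elementary_substructure_def)
  interpret small: type_flow L C V \<pi>
    by unfold_locales (rule struct(1), rule assms(5), rule group[OF assms(10)])
  \<comment> \<open>\<open>\<pi>\<close> is given as a partial type in \<open>C\<close>; as it has
    no parameters, elementarity makes it one in \<open>C'\<close>.\<close>
  have "elem_equiv L {} C id C' id"
    by (rule elementary_substructure_imp_elem_equiv[OF assms(4)]) simp
  then have "partial_type L C' V {} (map_params id ` \<pi>)"
    by (rule partial_type_map[OF assms(5)]) (use struct(2) in \<open>simp_all add: is_structure_def\<close>)
  then have "partial_type L C' V {} \<pi>" by simp
  then interpret big: type_flow L C' V \<pi>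
    by unfold_locales (rule struct(2), assumption, rule group[OF assms(11)])
  interpret type_flow_extension L C C' V \<pi>
    by unfold_locales (rule assms(4,6,7,9))+
  have "F = stab" "F' = stab'"
    using finest_wap_equiv_eq_stable_equiv[OF small.is_flow_type_space assms(10)]
      finest_wap_equiv_eq_stable_equiv[OF big.is_flow_type_space assms(11)] by simp_all
  then show ?thesis using restrict_stable_equiv by simp
qed

end
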